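(* Let $\mu$ be a Borel probability measure on $\mathbb{C}$ with compact, infinite support, and let $D=(d_{i,j})_{i,j=1}^{\infty}$ be the Hessenberg matrix associated with $\mu$. Assume that: (1) $\mu$ is regular, and its support $\Gamma=\operatorname{supp}(\mu)$ is a Jordan arc or a finite union of Jordan arcs such that $\mathbb{C}_\infty\setminus\Gamma$ is a simply connected subset of the Riemann sphere $\mathbb{C}_\infty$; (2) the operator $D$ on $\ell^2$ is uniformly asymptotically Toeplitz, and the corresponding limit matrix $T$ has a continuous symbol. Then the symbol of $T$ is the restriction to the unit circle $\mathbb{T}$ of the Riemann mapping function $\phi:\mathbb{C}_\infty\setminus\overline{\mathbb{D}}\to\mathbb{C}_\infty\setminus\Gamma$, which maps the exterior of the closed unit disk conformally onto the exterior of the support of $\mu$.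
   Context: $\mathbb{D}$ is the open unit disk, $\mathbb{T}$ the unit circle, $\mathbb{C}_\infty$ the Riemann sphere. A Jordan arc is a subset of $\mathbb{C}$ homeomorphic to $[0,1]$. Simply connected open sets are understood to be connected. Orthonormal polynomials and Hessenberg matrix: $\{P_n\}_{n\ge 0}$ is the sequence of orthonormal polynomials for $\langle Q,R\rangle_\mu=\int Q\overline{R}\,d\mu$, with $\deg P_n=n$, positive leading coefficient $\gamma_n$, and $P_0=1$. The Hessenberg matrix $D=(d_{i,j})_{i,j\ge1}$ associated with $\mu$ is the infinite upper Hessenberg matrix defined by $zP_n(z)=\sum_{k=0}^{n+1}d_{k+1,n+1}P_k(z)$, $n\ge 0$ (with $d_{i,j}=0$ for $i>j+1$). It is the matrix, in the basis $\{P_n\}$, of multiplication by $z$ on the closure of the polynomials in $L^2(\mu)$, and it is regarded as an operator on $\ell^2$. Regular measure: $\mu$ is regular if $\lim_{n\to\infty}\gamma_n^{-1/n}=\operatorname{cap}(\operatorname{supp}(\mu))$, the logarithmic capacity. Uniformly asymptotically Toeplitz: a bounded operator $A$ on $\ell^2$ is uniformly asymptotically Toeplitz if there is a bounded operator $T$ on $\ell^2$ with $\lim_{n\to\infty}\|S^{*n}AS^n-T\|=0$, where $S$ is the forward (unilateral) shift on $\ell^2$. The limit $T$ is called the limit matrix; it is a Toeplitz matrix, $T=(a_{i-j})_{i,j\ge1}$. Symbol: the symbol of a Toeplitz matrix $T=(a_{i-j})_{i,j\ge1}$ is the function on $\mathbb{T}$ given by the Laurent (Fourier) series $\sum_{k\in\mathbb{Z}}a_kz^k$.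 For $T$ the limit of a Hessenberg matrix, $a_k=0$ for $k\ge 2$, so, writing $d_k=a_k$, the symbol is $f_T(z)=\sum_{k=-1}^\infty d_{-k}z^{-k}$, where $d_k=\lim_{n\to\infty}d_{n+k,n}$. For a bounded $T$ the symbol is the element of $L^\infty(\mathbb{T})$ with these Fourier coefficients; "continuous symbol" means that it has a continuous representative, which is then called the symbol. Riemann mapping function: for a compact $\Gamma\subset\mathbb{C}$, not a point, with $\mathbb{C}_\infty\setminus\Gamma$ simply connected, $\phi$ is the unique conformal (bijective) map $\mathbb{C}_\infty\setminus\overline{\mathbb{D}}\to\mathbb{C}_\infty\setminus\Gamma$ with $\phi(\infty)=\infty$ and $\phi'(\infty)>0$, i.e. with expansion $\phi(z)=c_1z+c_0+c_{-1}z^{-1}+\cdots$ for $|z|>1$ and $c_1>0$ (then $c_1=\operatorname{cap}(\Gamma)$). "Restriction to $\mathbb{T}$" refers to the continuous extension of $\phi$ to $\{|z|\ge1\}$. *)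

theory Defs
  imports "HOL-Probability.Probability" "HOL-Complex_Analysis.Complex_Analysis"
begin

section \<open>The Hilbert space of square-summable complex sequences\<close>

typedef ell2 = "{x :: nat \<Rightarrow> complex. summable (\<lambda>n. (cmod (x n))\<^sup>2)}"
  morphisms coord Abs_ell2
  by (rule exI[of _ "\<lambda>_. 0"]) simp

setup_lifting type_definition_ell2

lemma ell2_eqI: "(\<And>n. coord x n = coord y n) \<Longrightarrow> x = y"
  by (metis coord_inject ext)

lemma summable_coord: "summable (\<lambda>n. (cmod (coord x n))\<^sup>2)"
  using coord[of x] by simp

lemma summable_square_add:
  fixes x y :: "nat \<Rightarrow> complex"
  assumes "summable (\<lambda>n. (cmod (x n))\<^sup>2)" and "summable (\<lambda>n. (cmod (y n))\<^sup>2)"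
  shows "summable (\<lambda>n. (cmod (x n + y n))\<^sup>2)"
proof (rule summable_comparison_test')
  show "summable (\<lambda>n. 2 * (cmod (x n))\<^sup>2 + 2 * (cmod (y n))\<^sup>2)"
    using assms by (intro summable_add summable_mult)
  fix n
  have "(cmod (x n + y n))\<^sup>2 \<le> (cmod (x n) + cmod (y n))\<^sup>2"
    by (intro power_mono norm_triangle_ineq) simp
  also have "\<dots> \<le> 2 * (cmod (x n))\<^sup>2 + 2 * (cmod (y n))\<^sup>2"
    using zero_le_power2[of "cmod (x n) - cmod (y n)"]
    by (simp add: power2_sum power2_diff)
  finally show "norm ((cmod (x n + y n))\<^sup>2) \<le> 2 * (cmod (x n))\<^sup>2 + 2 * (cmod (y n))\<^sup>2"
    by simp
qed

lemma summable_square_mult: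
  fixes x :: "nat \<Rightarrow> complex"
  assumes "summable (\<lambda>n. (cmod (x n))\<^sup>2)"
  shows "summable (\<lambda>n. (cmod (c * x n))\<^sup>2)"
  using assms by (simp add: norm_mult power_mult_distrib summable_mult)

lift_definition scaleC :: "complex \<Rightarrow> ell2 \<Rightarrow> ell2" is "\<lambda>c x n. c * x n"
  by (rule summable_square_mult)

instantiation ell2 :: real_vector
begin

lift_definition zero_ell2 :: ell2 is "\<lambda>_. 0" by simp

lift_definition plus_ell2 :: "ell2 \<Rightarrow> ell2 \<Rightarrow> ell2" is "\<lambda>x y n. x n + y n"
  by (rule summable_square_add)

lift_definition uminus_ell2 :: "ell2 \<Rightarrow> ell2" is "\<lambda>x n. - x n" by simp

lift_definition minus_ell2 :: "ell2 \<Rightarrow> ell2 \<Rightarrow> ell2" is "\<lambda>x y n. x n - y n"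
  subgoal for x y using summable_square_add[of x "\<lambda>n. - y n"] by simp
  done

lift_definition scaleR_ell2 :: "real \<Rightarrow> ell2 \<Rightarrow> ell2" is "\<lambda>r x n. complex_of_real r * x n"
  by (rule summable_square_mult)

instance
  by standard (transfer; simp add: fun_eq_iff algebra_simps)+

end

lemma summable_coord_inner: "summable (\<lambda>n. coord x n \<bullet> coord y n)"
proof (rule summable_comparison_test')
  show "summable (\<lambda>n. (cmod (coord x n))\<^sup>2 + (cmod (coord y n))\<^sup>2)"
    by (intro summable_add summable_coord)
  fix n
  have "\<bar>coord x n \<bullet> coord y n\<bar> \<le> cmod (coord x n) * cmod (coord y n)"
    by (rule Cauchy_Schwarz_ineq2)
  also have "\<dots> \<le> (cmod (coord x n))\<^sup>2 + (cmod (coord y n))\<^sup>2"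
    using zero_le_power2[of "cmod (coord x n) - cmod (coord y n)"]
      mult_nonneg_nonneg[OF norm_ge_zero norm_ge_zero, of "coord x n" "coord y n"]
    unfolding power2_diff by linarith
  finally show "norm (coord x n \<bullet> coord y n) \<le> (cmod (coord x n))\<^sup>2 + (cmod (coord y n))\<^sup>2"
    by simp
qed

text \<open>
  The inner product below is the real part of the Hermitian inner product of \<open>\<ell>\<^sup>2\<close>; it induces
  the usual norm, and for complex-linear operators it has the same adjoints.
\<close>

instantiation ell2 :: real_inner
begin

definition inner_ell2 :: "ell2 \<Rightarrow> ell2 \<Rightarrow> real" where
  "inner_ell2 x y = (\<Sum>n. coord x n \<bullet> coord y n)"

definition norm_ell2 :: "ell2 \<Rightarrow> real" where
  "norm_ell2 x = sqrt (x \<bullet> x)"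

definition sgn_ell2 :: "ell2 \<Rightarrow> ell2" where
  "sgn_ell2 x = x /\<^sub>R norm x"

definition dist_ell2 :: "ell2 \<Rightarrow> ell2 \<Rightarrow> real" where
  "dist_ell2 x y = norm (x - y)"

definition uniformity_ell2 :: "(ell2 \<times> ell2) filter" where
  "uniformity_ell2 = (INF e\<in>{0 <..}. principal {(x, y). dist x y < e})"

definition open_ell2 :: "ell2 set \<Rightarrow> bool" where
  "open_ell2 U \<longleftrightarrow> (\<forall>x\<in>U. \<forall>\<^sub>F (x', y) in uniformity. x' = x \<longrightarrow> y \<in> U)"

instance
proof
  fix x y z :: ell2 and r :: real
  show "x \<bullet> y = y \<bullet> x"
    by (simp add: inner_ell2_def inner_commute)
  show "(x + y) \<bullet> z = x \<bullet> z + y \<bullet> z"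
    by (simp add: inner_ell2_def plus_ell2.rep_eq inner_add_left suminf_add summable_coord_inner)
  have "(complex_of_real r * a) \<bullet> b = r * (a \<bullet> b)" for a b
    by (metis inner_scaleR_left scaleR_conv_of_real)
  then show "(r *\<^sub>R x) \<bullet> y = r * (x \<bullet> y)"
    by (simp add: inner_ell2_def scaleR_ell2.rep_eq suminf_mult summable_coord_inner)
  show "0 \<le> x \<bullet> x"
    by (simp add: inner_ell2_def suminf_nonneg summable_coord_inner)
  have "x \<bullet> x = 0 \<longleftrightarrow> (\<forall>n. coord x n = 0)"
    unfolding inner_ell2_def
    by (subst suminf_eq_zero_iff) (auto simp: summable_coord_inner)
  also have "\<dots> \<longleftrightarrow> x = 0"
    by (auto simp: zero_ell2.rep_eq intro: ell2_eqI)
  finally show "x \<bullet> x = 0 \<longleftrightarrow> x = 0" .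
qed (simp_all add: norm_ell2_def sgn_ell2_def dist_ell2_def uniformity_ell2_def open_ell2_def)

end

lift_definition unit_vector :: "nat \<Rightarrow> ell2" is "\<lambda>k n. if n = k then 1 else 0"
  subgoal for k
    by (rule summable_finite[of "{k}"]) auto
  done


section \<open>Operators, asymptotically Toeplitz operators and symbols\<close>

definition bounded_operator :: "(ell2 \<Rightarrow> ell2) \<Rightarrow> bool" where
  "bounded_operator A \<longleftrightarrow> bounded_linear A \<and> (\<forall>c x. A (scaleC c x) = scaleC c (A x))"

definition entry :: "(ell2 \<Rightarrow> ell2) \<Rightarrow> nat \<Rightarrow> nat \<Rightarrow> complex" where
  "entry A i j = coord (A (unit_vector j)) i"

lift_definition shift :: "ell2 \<Rightarrow> ell2" is "\<lambda>x n. case n of 0 \<Rightarrow> 0 | Suc m \<Rightarrow> x m"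
  by (subst summable_Suc_iff[symmetric]) simp

lift_definition backward_shift :: "ell2 \<Rightarrow> ell2" is "\<lambda>x n. x (Suc n)"
  by (simp add: summable_Suc_iff[where f = "\<lambda>n. (cmod (_ n))\<^sup>2"])

lemma adjoint_shift: "adjoint shift = backward_shift"
proof (rule adjoint_unique, intro allI)
  fix x y
  have "shift x \<bullet> y = (\<Sum>n. coord (shift x) (Suc n) \<bullet> coord y (Suc n))"
    unfolding inner_ell2_def
    by (subst suminf_split_head[OF summable_coord_inner]) (simp add: shift.rep_eq)
  then show "shift x \<bullet> y = x \<bullet> backward_shift y"
    by (simp add: inner_ell2_def shift.rep_eq backward_shift.rep_eq)
qed

definition uniformly_asymptotically_Toeplitz :: "(ell2 \<Rightarrow> ell2) \<Rightarrow> (ell2 \<Rightarrow> ell2) \<Rightarrow> bool" where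
  "uniformly_asymptotically_Toeplitz A T \<longleftrightarrow>
     bounded_operator A \<and> bounded_operator T \<and>
     (\<lambda>n. onorm (\<lambda>x. (adjoint shift ^^ n) (A ((shift ^^ n) x)) - T x)) \<longlonglongrightarrow> 0"

definition Fourier_coefficient :: "(complex \<Rightarrow> complex) \<Rightarrow> int \<Rightarrow> complex" where
  "Fourier_coefficient f k =
     (LBINT t:{0..2*pi}. f (cis t) * cis (- (of_int k * t))) / of_real (2 * pi)"

text \<open>
  The function \<open>f\<close> on the unit circle represents the symbol of \<open>T = (a\<^bsub>i-j\<^esub>)\<close>: it belongs to
  \<open>L\<^sup>\<infinity>\<close> of the circle and \<open>a\<^sub>k\<close> is its \<open>k\<close>-th Fourier coefficient.
\<close>

definition Toeplitz_symbol :: "(ell2 \<Rightarrow> ell2) \<Rightarrow> (complex \<Rightarrow> complex) \<Rightarrow> bool" where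
  "Toeplitz_symbol T f \<longleftrightarrow>
     (\<lambda>t. f (cis t)) \<in> borel_measurable lborel \<and>
     (\<exists>C. AE t in lborel. cmod (f (cis t)) \<le> C) \<and>
     (\<forall>i j. entry T i j = Fourier_coefficient f (int i - int j))"


section \<open>Orthonormal polynomials, Hessenberg matrix, regular measures\<close>

definition msupport :: "complex measure \<Rightarrow> complex set" where
  "msupport \<mu> = {z. \<forall>U. open U \<and> z \<in> U \<longrightarrow> emeasure \<mu> U > 0}"

definition orthonormal_polynomials :: "complex measure \<Rightarrow> (nat \<Rightarrow> complex poly) \<Rightarrow> bool" where
  "orthonormal_polynomials \<mu> P \<longleftrightarrow>
     (\<forall>n. degree (P n) = n \<and> lead_coeff (P n) \<in> \<real> \<and> Re (lead_coeff (P n)) > 0) \<and>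
     (\<forall>m n. (LINT z|\<mu>. poly (P m) z * cnj (poly (P n) z)) = (if m = n then 1 else 0))"

text \<open>Rows and columns are numbered from 0: \<open>d i j\<close> is the classical entry \<open>d\<^bsub>i+1,j+1\<^esub>\<close>.\<close>

definition Hessenberg_matrix ::
    "(nat \<Rightarrow> complex poly) \<Rightarrow> (nat \<Rightarrow> nat \<Rightarrow> complex) \<Rightarrow> bool" where
  "Hessenberg_matrix P d \<longleftrightarrow>
     (\<forall>n. monom 1 1 * P n = (\<Sum>k\<le>n + 1. smult (d k n) (P k))) \<and>
     (\<forall>i j. i > j + 1 \<longrightarrow> d i j = 0)"

text \<open>
  Logarithmic energy \<open>\<integral>\<integral> log (1 / |z - w|) d\<nu> d\<nu>\<close> of a probability measure carried by a bounded
  set. Since \<open>ln 0 = 0\<close> here, finiteness of the energy also requires the diagonal, where the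
  kernel is \<open>+\<infinity>\<close>, to be a null set.
\<close>

definition finite_log_energy :: "complex measure \<Rightarrow> bool" where
  "finite_log_energy \<nu> \<longleftrightarrow>
     (AE (z, w) in \<nu> \<Otimes>\<^sub>M \<nu>. z \<noteq> w) \<and> integrable (\<nu> \<Otimes>\<^sub>M \<nu>) (\<lambda>(z, w). ln (1 / cmod (z - w)))"

definition log_energy :: "complex measure \<Rightarrow> real" where
  "log_energy \<nu> = (LINT (z, w)|(\<nu> \<Otimes>\<^sub>M \<nu>). ln (1 / cmod (z - w)))"

definition log_capacity :: "complex set \<Rightarrow> real" where
  "log_capacity K =
     (let M = {\<nu>. prob_space \<nu> \<and> sets \<nu> = sets borel \<and> emeasure \<nu> K = 1 \<and> finite_log_energy \<nu>}
      in if M = {} then 0 else exp (- (INF \<nu>\<in>M. log_energy \<nu>)))"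

definition regular_measure :: "complex measure \<Rightarrow> (nat \<Rightarrow> complex poly) \<Rightarrow> bool" where
  "regular_measure \<mu> P \<longleftrightarrow>
     (\<lambda>n. Re (lead_coeff (P n)) powr (- 1 / real n)) \<longlonglongrightarrow> log_capacity (msupport \<mu>)"


section \<open>The Riemann sphere and exterior Riemann maps\<close>

definition Jordan_arc :: "complex set \<Rightarrow> bool" where
  "Jordan_arc J \<longleftrightarrow> J homeomorphic {0..1::real}"

text \<open>
  The Riemann sphere is the unit sphere of \<open>\<complex> \<times> \<real>\<close>; the plane is embedded by inverse
  stereographic projection, and the north pole \<open>(0, 1)\<close> is the point at infinity.
\<close>

definition stereographic :: "complex \<Rightarrow> complex \<times> real" where
  "stereographic z =
     (of_real (2 / ((cmod z)\<^sup>2 + 1)) * z, ((cmod z)\<^sup>2 - 1) / ((cmod z)\<^sup>2 + 1))"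

definition sphere_complement :: "complex set \<Rightarrow> (complex \<times> real) set" where
  "sphere_complement K = sphere 0 1 - stereographic ` K"

text \<open>
  Finite part of the conformal map between the exteriors in the Riemann sphere; the last two
  conditions say \<open>\<phi>(\<infinity>) = \<infinity>\<close> and \<open>\<phi>'(\<infinity>) = c > 0\<close>.
\<close>

definition exterior_Riemann_map :: "complex set \<Rightarrow> (complex \<Rightarrow> complex) \<Rightarrow> bool" where
  "exterior_Riemann_map K \<phi> \<longleftrightarrow>
     \<phi> holomorphic_on {z. cmod z > 1} \<and>
     bij_betw \<phi> {z. cmod z > 1} (- K) \<and>
     filterlim \<phi> at_infinity at_infinity \<and>
     (\<exists>c::real. c > 0 \<and> ((\<lambda>z. \<phi> z / z) \<longlongrightarrow> of_real c) at_infinity)"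

end

theory Submission
  imports Defs "HOL-Real_Asymp.Real_Asymp"
begin

text \<open>
  Let \<open>F z = a\<^sub>1 z + a\<^sub>0 + a\<^bsub>-1\<^esub> z\<^sup>-\<^sup>1 + \<dots>\<close> be the extension of the symbol \<open>f\<close> to \<open>\<bar>z\<bar> > 1\<close>; by the Poisson
  integral it is continuous up to the circle.

  On finitely supported vectors \<open>D\<close> is multiplication by \<open>z\<close> in \<open>L\<^sup>2(\<mu>)\<close>, so \<open>D - \<lambda>\<close> is bounded below
  by the distance of \<open>\<lambda>\<close> from \<open>\<Gamma>\<close>. Normalized Dirichlet kernels are approximate eigenvectors of \<open>T\<close> for the
  value \<open>\<lambda> = f z\<^sub>0\<close>, and shifted far out they are approximate eigenvectors of \<open>D\<close>. Hence \<open>f\<close> takes its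
  values in \<open>\<Gamma>\<close>.

  The subdiagonal entries of \<open>D\<close> are \<open>\<gamma>\<^sub>n / \<gamma>\<^bsub>n+1\<^esub>\<close>, so regularity gives \<open>a\<^sub>1 = cap \<Gamma>\<close>. The image of the
  uniform measure under the boundary values of \<open>\<phi>\<close> has energy at most \<open>- ln c\<close>, where
  \<open>c = \<phi>'(\<infinity>)\<close>; hence \<open>a\<^sub>1 \<ge> c\<close>.

  Finally consider \<open>q z = \<phi>\<^sup>-\<^sup>1 (F z) / z\<close> on the set where \<open>F z \<notin> \<Gamma>\<close>. At infinity \<open>\<bar>q\<bar>\<close> equals
  \<open>a\<^sub>1 / c \<ge> 1\<close>, while its boundary values are at most 1 (and less than 1 inside the domain, where
  \<open>\<bar>\<phi>\<^sup>-\<^sup>1 (F z)\<bar> \<rightarrow> 1\<close>). The maximum principle forces \<open>q = 1\<close>, that is \<open>F = \<phi>\<close>.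
\<close>

section \<open>Means over the unit circle\<close>

text \<open>The coordinate w = 1 / z removes infinity: \<open>F\<close> and \<open>\<phi>\<close>
  become w F(1/w) and w \<phi>(1/w), holomorphic on the disc, with values a_1 and c at 0. The
  obstacle is that neither the boundary behaviour of \<open>\<phi>\<close> nor the position of the
  values of \<open>F\<close> is known beforehand. \<open>F\<close> may enter \<Gamma>, where the
  inverse of \<open>\<phi>\<close> is undefined, so the maximum principle runs on an open set that
  only afterwards turns out to be the whole disc. All it asks of the inverse at \<Gamma> is that its
  modulus tends to 1, which is properness. The energy estimate uses boundary values of
  \<open>\<phi>\<close> almost everywhere, obtained by an L^2 argument; continuity of
  \<open>\<phi>\<close> up to the circle is a consequence of \<phi> = F.

  On the operator side, compressing by n shifts forgets the first n coordinates of the image. The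
  Dirichlet kernels therefore carry a second parameter m, a factor z^m that changes no modulus on
  the circle; as m grows the forgotten coordinates tend to 0, since the entries along a row of a
  bounded operator do.\<close>

definition circle_measure :: "real measure" where
  "circle_measure = density lborel (\<lambda>t. ennreal (indicator {0..2*pi} t / (2*pi)))"

lemma sets_circle_measure [simp, measurable_cong]: "sets circle_measure = sets borel"
  and space_circle_measure [simp]: "space circle_measure = UNIV"
  by (simp_all add: circle_measure_def)

lemma circle_measure_integral:
  fixes f :: "real \<Rightarrow> complex"
  assumes [measurable]: "f \<in> borel_measurable borel"
  shows "(LINT t|circle_measure. f t) = (LBINT t:{0..2*pi}. f t) / of_real (2 * pi)"
proof -
  have "(LINT t|circle_measure. f t) = (LINT t|lborel. (indicator {0..2*pi} t / (2*pi)) *\<^sub>R f t)"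
    unfolding circle_measure_def by (intro integral_density) auto
  also have "\<dots> = (LINT t|lborel. (indicator {0..2*pi} t *\<^sub>R f t) / of_real (2 * pi))"
    by (intro Bochner_Integration.integral_cong) (auto simp: scaleR_conv_of_real)
  finally show ?thesis by (simp only: set_lebesgue_integral_def integral_divide_zero)
qed

interpretation circle: prob_space circle_measure
proof
  have "emeasure circle_measure (space circle_measure) = 
     (\<integral>\<^sup>+ t. ennreal (inverse (2 * pi)) * indicator {0..2*pi} t \<partial>lborel)"
    unfolding circle_measure_def
    by (subst emeasure_density) (auto intro!: nn_integral_cong simp: indicator_def field_simps)
  also have "\<dots> = 1"
    by (subst nn_integral_cmult_indicator) (auto simp flip: ennreal_mult)
  finally show "emeasure circle_measure (space circle_measure) = 1" .
qed

lemma circle_prob_UNIV [simp]: "measure circle_measure UNIV = 1"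
  using circle.prob_space by simp

lemma circle_integrable_bounded:
  fixes f :: "real \<Rightarrow> 'a::{banach, second_countable_topology}"
  assumes "f \<in> borel_measurable borel" "\<And>t. norm (f t) \<le> B"
  shows "integrable circle_measure f"
  using assms by (intro circle.integrable_const_bound[where B = B]) auto

lemma measurable_cis_comp:
  fixes g :: "complex \<Rightarrow> 'a::topological_space"
  assumes "continuous_on (sphere 0 1) g"
  shows "(\<lambda>t. g (cis t)) \<in> borel_measurable borel"
  by (rule borel_measurable_continuous_onI, rule continuous_on_compose2[OF assms, of UNIV cis])
    (auto intro!: continuous_intros)

lemma measurable_cis [measurable]: "cis \<in> borel_measurable borel"
  by (intro borel_measurable_continuous_onI continuous_intros)

lemma measurable_cnj [measurable]: "cnj \<in> borel_measurable borel"
  by (intro borel_measurable_continuous_onI continuous_intros)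

lemma Fourier_coefficient_eq:
  assumes "(\<lambda>t. f (cis t)) \<in> borel_measurable borel"
  shows "Fourier_coefficient f k = (LINT t|circle_measure. f (cis t) * cis (- (of_int k * t)))"
proof -
  note [measurable] = assms
  show ?thesis
    by (subst circle_measure_integral)
      (auto simp: Fourier_coefficient_def scaleR_conv_of_real field_simps)
qed

lemma circle_cis_integral: "(LINT t|circle_measure. cis (of_int k * t)) = of_bool (k = 0)"
proof (cases "k = 0")
  case True
  then show ?thesis by (simp add: circle.prob_space)
next
  case False
  have m: "(\<lambda>t. cis (of_int k * t)) \<in> borel_measurable borel" by measurable
  define F where "F = (\<lambda>t::real. cis (of_int k * t) / (of_int k * \<i>))"
  have "(LBINT t. indicator {0..2*pi} t *\<^sub>R cis (of_int k * t)) = F (2 * pi) - F 0"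
  proof (rule integral_FTC_Icc)
    show "continuous_on {0..2*pi} (\<lambda>t. cis (of_int k * t))"
      by (intro continuous_intros)
    fix t :: real
    have "((\<lambda>z. exp (\<i> * (of_int k * z)) / (of_int k * \<i>)) has_field_derivative exp (\<i> * (of_int k * of_real t)))
        (at (of_real t))"
      using False by (auto intro!: derivative_eq_intros)
    from has_vector_derivative_real_field[OF this]
    show "(F has_vector_derivative cis (of_int k * t)) (at t within {0..2 * pi})"
      unfolding F_def cis_conv_exp o_def of_real_mult of_real_of_int_eq .
  qed auto
  also have "\<dots> = 0"
  proof -
    have "cis (of_int k * (2 * pi)) = cis (of_int k * 0)"
      using cis_multiple_2pi[of "of_int k"] by (simp add: ac_simps)
    then show ?thesis unfolding F_def by (simp only: diff_self)
  qed
  finally show ?thesis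
    using False unfolding circle_measure_integral[OF m] set_lebesgue_integral_def by simp
qed

text \<open>The terms are dominated by the summable constants \<open>norm (b k) * B\<close>. The
  factor \<open>h\<close> stays free because the mean value property, Parseval's identity and the
  Poisson integral differ only in it.\<close>

lemma circle_suminf_integral:
  fixes b :: "nat \<Rightarrow> complex" and e :: "nat \<Rightarrow> real \<Rightarrow> complex"
  assumes b: "summable (\<lambda>k. norm (b k))"
    and [measurable]: "\<And>k. e k \<in> borel_measurable borel" and e: "\<And>k t. norm (e k t) \<le> 1"
    and [measurable]: "h \<in> borel_measurable borel" and h: "\<And>t. norm (h t) \<le> B"
  shows "(\<lambda>k. b k * (LINT t|circle_measure. e k t * h t)) sums
           (LINT t|circle_measure. (\<Sum>k. b k * e k t) * h t)"
proof -
  have bd: "norm (b k * e k t * h t) \<le> norm (b k) * B" for k t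
    unfolding norm_mult using e[of k t] h[of t]
    by (intro mult_mono) (auto intro: mult_left_le mult_left_le_one_le)
  have sm: "summable (\<lambda>k. norm (b k * e k t * h t))" for t
    by (rule summable_comparison_test'[OF summable_mult2[OF b, of B]]) (use bd in auto)
  have sm1: "summable (\<lambda>k. b k * e k t)" for t
    by (rule summable_comparison_test'[OF b]) (use e[of _ t] in \<open>auto simp: norm_mult mult_left_le\<close>)
  have int: "integrable circle_measure (\<lambda>t. b k * e k t * h t)" for k
    by (rule circle_integrable_bounded[where B = "norm (b k) * B"]) (use bd in auto)
  have "(\<lambda>k. LINT t|circle_measure. b k * e k t * h t) sums 
     (LINT t|circle_measure. (\<Sum>k. b k * e k t * h t))"
  proof (rule sums_integral[OF int])
    show "AE t in circle_measure. summable (\<lambda>k. norm (b k * e k t * h t))"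
      using sm by simp
    have "norm (LINT t|circle_measure. norm (b k * e k t * h t)) \<le> norm (b k) * B" for k
    proof -
      have "(LINT t|circle_measure. norm (b k * e k t * h t)) \<le> (LINT t|circle_measure. norm (b k) * B)"
        using bd by (intro integral_mono integrable_norm int) auto
      then show ?thesis by (simp add: circle.prob_space)
    qed
    then show "summable (\<lambda>k. LINT t|circle_measure. norm (b k * e k t * h t))"
      by (intro summable_comparison_test'[OF summable_mult2[OF b, of B]]) auto
  qed
  moreover have "(LINT t|circle_measure. b k * e k t * h t) = b k * (LINT t|circle_measure. e k t * h t)" for k
    by (subst integral_mult_right_zero[symmetric]) (simp add: mult.assoc)
  moreover have "(\<Sum>k. b k * e k t * h t) = (\<Sum>k. b k * e k t) * h t" for t
    by (rule suminf_mult2[symmetric]) (rule sm1)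
  ultimately show ?thesis by (simp only:)
qed

section \<open>Power series on circles: mean values, Parseval's identity, radial limits\<close>

lemma holomorphic_power_series_disc:
  assumes "G holomorphic_on ball 0 R" "R > 0"
  obtains a where "a 0 = G 0"
    "\<And>w. norm w < R \<Longrightarrow> summable (\<lambda>k. norm (a k * w ^ k))"
    "\<And>w. norm w < R \<Longrightarrow> (\<lambda>k. a k * w ^ k) sums G w"
proof
  define a where "a = (\<lambda>k. (deriv ^^ k) G 0 / fact k)"
  show "a 0 = G 0" by (simp add: a_def)
  show sm: "(\<lambda>k. a k * w ^ k) sums G w" if "norm w < R" for w
    using holomorphic_power_series[OF assms(1), of w] that by (simp add: a_def)
  show "summable (\<lambda>k. norm (a k * w ^ k))" if w: "norm w < R" for w
  proof -
    \<comment> \<open>Convergence at a point of larger modulus, still inside the disc, gives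
      absolute convergence at w.\<close>
    have "norm (complex_of_real ((norm w + R) / 2)) < R" "norm w < norm (complex_of_real ((norm w + R) / 2))"
      using w norm_ge_zero[of w] assms(2) unfolding norm_of_real by (simp_all add: abs_of_pos)
    then show ?thesis
      using powser_insidea[of a "of_real ((norm w + R) / 2)" w] sm[THEN sums_summable]
      by blast
  qed
qed

lemma holomorphic_measurable_circle:
  assumes "G holomorphic_on ball 0 R" "norm c < R"
  shows "(\<lambda>t. G (c * cis t)) \<in> borel_measurable borel"
  using assms by (intro borel_measurable_continuous_onI continuous_on_compose2[OF holomorphic_on_imp_continuous_on[OF assms(1)]]
      continuous_intros) (auto simp: norm_mult)

text \<open>Together with uniqueness of sums this reads off the one coefficient that survives
  orthogonality.\<close>

lemma sums_mult_of_bool: "(\<lambda>k. f k * of_bool (k = n)) sums (f n :: complex)"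
  using sums_single[of n f] by (simp add: of_bool_def if_distrib cong: if_cong)

lemma circle_power_series_integral:
  assumes a: "\<And>w. norm w < R \<Longrightarrow> summable (\<lambda>k. norm (a k * w ^ k))"
    "\<And>w. norm w < R \<Longrightarrow> (\<lambda>k. a k * w ^ k) sums G w"
    and r: "norm c < R"
    and h: "h \<in> borel_measurable borel" "\<And>t. norm (h t) \<le> B"
  shows "(\<lambda>k. a k * c ^ k * (LINT t|circle_measure. cis (of_nat k * t) * h t)) sums
           (LINT t|circle_measure. G (c * cis t) * h t)"
proof -
  have "(\<Sum>k. a k * c ^ k * cis (of_nat k * t)) = G (c * cis t)" for t
  proof -
    have "cis (of_nat k * t) = cis t ^ k" for k by (simp add: Complex.DeMoivre)
    then show ?thesis
      using a(2)[of "c * cis t"] r by (simp only: norm_mult power_mult_distrib mult.assoc sums_iff) simp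
  qed
  then show ?thesis
    using circle_suminf_integral[of "\<lambda>k. a k * c ^ k" "\<lambda>k t. cis (of_nat k * t)", OF a(1)[OF r] _ _ h]
    by simp
qed

lemma circle_cis_integral_nat:
  "(LINT t|circle_measure. cis (of_nat j * t) * cis (- (of_nat k * t))) = of_bool (j = k)"
  using circle_cis_integral[of "int j - int k"] by (simp add: cis_mult algebra_simps)

lemma circle_mean_value:
  assumes G: "G holomorphic_on ball 0 R" and r: "norm c < R"
  shows "(LINT t|circle_measure. G (c * cis t)) = G 0"
proof -
  have "R > 0" using r norm_ge_zero[of c] by linarith
  then obtain a where a: "a 0 = G 0"
    "\<And>w. norm w < R \<Longrightarrow> summable (\<lambda>k. norm (a k * w ^ k))"
    "\<And>w. norm w < R \<Longrightarrow> (\<lambda>k. a k * w ^ k) sums G w"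
    using holomorphic_power_series_disc[OF G] by metis
  have "(\<lambda>k. a k * c ^ k * of_bool (k = 0)) sums (LINT t|circle_measure. G (c * cis t))"
    using circle_power_series_integral[OF a(2,3) r, of "\<lambda>_. 1" 1] circle_cis_integral[of "int _"] by simp
  from sums_unique2[OF this sums_mult_of_bool] show ?thesis using a(1) by simp
qed

text \<open>The polarized form with two radii supplies the cross terms when the L^2 distance between
  the restrictions of G to two circles is expanded.\<close>

lemma circle_parseval:
  assumes a: "\<And>w. norm w < R \<Longrightarrow> summable (\<lambda>k. norm (a k * w ^ k))"
    "\<And>w. norm w < R \<Longrightarrow> (\<lambda>k. a k * w ^ k) sums G w"
    and G: "G holomorphic_on ball 0 R"
    and r: "norm c < R" and s: "norm d < R"
  shows "(\<lambda>k. a k * c ^ k * cnj (a k * d ^ k)) sums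
           (LINT t|circle_measure. G (c * cis t) * cnj (G (d * cis t)))"
proof -
  note [measurable] = holomorphic_measurable_circle[OF G s]
  have "compact (cball (0::complex) (norm d))" by simp
  moreover have "continuous_on (cball 0 (norm d)) G"
    using s by (intro continuous_on_subset[OF holomorphic_on_imp_continuous_on[OF G]]) auto
  ultimately have "bounded (G ` cball 0 (norm d))"
    by (intro compact_imp_bounded compact_continuous_image)
  then obtain B where B: "\<And>w. norm w \<le> norm d \<Longrightarrow> norm (G w) \<le> B"
    by (force simp: bounded_iff)
  have coef: "(LINT t|circle_measure. cis (of_nat k * t) * cnj (G (d * cis t))) = cnj (a k * d ^ k)" for k
  proof -
    have "(\<lambda>j. a j * d ^ j * (LINT t|circle_measure. cis (of_nat j * t) * cis (- (of_nat k * t)))) sums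
      (LINT t|circle_measure. G (d * cis t) * cis (- (of_nat k * t)))"
      by (rule circle_power_series_integral[OF a s, where B = 1]) auto
    from sums_unique2[OF this[unfolded circle_cis_integral_nat] sums_mult_of_bool]
    have "(LINT t|circle_measure. G (d * cis t) * cis (- (of_nat k * t))) = a k * d ^ k" .
    then have "(LINT t|circle_measure. cnj (G (d * cis t) * cis (- (of_nat k * t)))) = cnj (a k * d ^ k)"
      by (simp only: Bochner_Integration.integral_cnj)
    then show ?thesis by (simp add: cis_cnj mult.commute)
  qed
  show ?thesis
    using circle_power_series_integral[OF a r, of "\<lambda>t. cnj (G (d * cis t))" B] B
    unfolding coef by (simp add: norm_mult)
qed

text \<open>
  The squared means \<open>I (\<rho>\<^sup>2)\<close> of \<open>\<bar>G\<bar>\<^sup>2\<close> over circles increase to a finite limit, and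
  \<open>\<parallel>G\<^sub>\<rho> - G\<^sub>\<sigma>\<parallel>\<^sup>2 = I (\<rho>\<^sup>2) + I (\<sigma>\<^sup>2) - 2 I (\<rho> \<sigma>)\<close>, so radii can be chosen along which the
  differences are summable in \<open>L\<^sup>1\<close>.
\<close>

lemma bounded_holomorphic_radial_limits:
  assumes G: "G holomorphic_on ball 0 1" and M: "\<And>w. norm w < 1 \<Longrightarrow> norm (G w) \<le> M"
  obtains \<rho> :: "nat \<Rightarrow> real" where "\<And>j. 0 < \<rho> j" "\<And>j. \<rho> j < 1" "\<And>j. \<rho> j < \<rho> (Suc j)" "\<rho> \<longlonglongrightarrow> 1"
    "AE t in circle_measure. convergent (\<lambda>j. G (of_real (\<rho> j) * cis t))"
proof -
  obtain a where a: "a 0 = G 0"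
    "\<And>w. norm w < 1 \<Longrightarrow> summable (\<lambda>k. norm (a k * w ^ k))"
    "\<And>w. norm w < 1 \<Longrightarrow> (\<lambda>k. a k * w ^ k) sums G w"
    using holomorphic_power_series_disc[OF G] by (metis zero_less_one)
  define I where "I = (\<lambda>x::real. \<Sum>k. (norm (a k))\<^sup>2 * x ^ k)"
  have par: "(\<lambda>k. (norm (a k))\<^sup>2 * (r * s) ^ k) sums I (r * s)"
       "(LINT t|circle_measure. G (of_real r * cis t) * cnj (G (of_real s * cis t))) = of_real (I (r * s))"
    if "0 < r" "r < 1" "0 < s" "s < 1" for r s
  proof -
    have "(\<lambda>k. a k * of_real r ^ k * cnj (a k * of_real s ^ k)) sums
           (LINT t|circle_measure. G (of_real r * cis t) * cnj (G (of_real s * cis t)))"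
      by (rule circle_parseval[OF a(2,3) G]) (use that in auto)
    moreover have "a k * of_real r ^ k * cnj (a k * of_real s ^ k) = of_real ((norm (a k))\<^sup>2 * (r * s) ^ k)" for k
      using complex_norm_square[of "a k"] by (simp add: power_mult_distrib mult_ac)
    ultimately have 1: "(\<lambda>k. complex_of_real ((norm (a k))\<^sup>2 * (r * s) ^ k)) sums
           (LINT t|circle_measure. G (of_real r * cis t) * cnj (G (of_real s * cis t)))" by simp
    from sums_Re[OF this] show 2: "(\<lambda>k. (norm (a k))\<^sup>2 * (r * s) ^ k) sums I (r * s)"
      by (simp add: I_def sums_iff)
    show "(LINT t|circle_measure. G (of_real r * cis t) * cnj (G (of_real s * cis t))) = of_real (I (r * s))"
      using sums_unique2[OF 1] sums_of_real[OF 2] by simp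
  qed
  have mono: "I (r * s) \<le> I (r' * s')" 
    if "0 < r" "r < 1" "0 < s" "s < 1" "r \<le> r'" "s \<le> s'" "r' < 1" "s' < 1" for r s r' s'
  proof (rule sums_le[OF _ par(1) par(1)])
    show "(norm (a k))\<^sup>2 * (r * s) ^ k \<le> (norm (a k))\<^sup>2 * (r' * s') ^ k" for k
      using that by (intro mult_left_mono power_mono mult_mono) auto
  qed (use that in auto)
  note meas = holomorphic_measurable_circle[OF G]
  have measr[measurable]: "(\<lambda>t. G (of_real r * cis t)) \<in> borel_measurable borel" if "0 < r" "r < 1" for r
    using meas[of "of_real r"] that by simp
  have intr: "integrable circle_measure (\<lambda>t. G (of_real r * cis t) * cnj (G (of_real s * cis t)))"
    if "0 < r" "r < 1" "0 < s" "s < 1" for r s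
    using that M[of "of_real r * cis _"] M[of "of_real s * cis _"] order_trans[OF norm_ge_zero M[of 0]]
    by (intro circle_integrable_bounded[where B = "M * M"] borel_measurable_times
         measurable_compose[OF measr measurable_cnj]) (auto simp: norm_mult intro!: mult_mono)
  have bd: "I (r * r) \<le> M * M" if "0 < r" "r < 1" for r
  proof -
    have "norm (LINT t|circle_measure. G (of_real r * cis t) * cnj (G (of_real r * cis t))) 
      \<le> (LINT t|circle_measure. M * M)"
    proof (rule Bochner_Integration.integral_norm_bound_integral[OF intr])
      show "norm (G (of_real r * cis t) * cnj (G (of_real r * cis t))) \<le> M * M" for t
        using that M[of "of_real r * cis t"] order_trans[OF norm_ge_zero M[of 0]] 
        unfolding norm_mult complex_mod_cnj by (intro mult_mono) (auto simp: norm_mult)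
    qed (use that in auto)
    then show ?thesis using that by (simp add: par)
  qed
  define L where "L = (SUP r\<in>{0<..<1}. I (r * r))"
  have bdd: "bdd_above ((\<lambda>r. I (r * r)) ` {0<..<1})" using bd by (intro bdd_aboveI2) auto
  have L: "I (r * r) \<le> L" if "0 < r" "r < 1" for r
    unfolding L_def using that bdd by (intro cSUP_upper) auto
  \<comment> \<open>The bound 1 - 1/(n+1) forces the radii to 1. The deficit 4^-n makes the squared
    L^2 norms of consecutive differences at most 4^-n, hence their L^1 norms at most 2^-n, which is
    summable.\<close>
  define P where "P = (\<lambda>n::nat. \<lambda>x::real. 0 < x \<and> x < 1 \<and> 1 - 1 / (real n + 1) \<le> x \<and> L - (1/4)^n < I (x * x))"
  have ex: "\<exists>x. P n x \<and> y < x" if "y < 1" for n y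
  proof -
    have "L - (1/4)^n < (SUP r\<in>{0<..<1}. I (r * r))" unfolding L_def by simp
    then obtain z where z: "0 < z" "z < 1" "L - (1/4)^n < I (z * z)"
      by (subst (asm) less_cSUP_iff[OF _ bdd]) auto
    define m where "m = Max {y, z, 1 - 1 / (real n + 1)}"
    have "m < 1" using that z by (simp add: m_def)
    then obtain x where x: "m < x" "x < 1" using dense by blast
    moreover from x have "z < x" "y < x" "1 - 1 / (real n + 1) < x" by (auto simp: m_def)
    moreover have "I (z * z) \<le> I (x * x)" using z x \<open>z < x\<close> by (intro mono) auto
    ultimately show ?thesis using z by (intro exI[of _ x]) (auto simp: P_def add.commute)
  qed
  obtain \<rho> where \<rho>: "\<And>n. P n (\<rho> n)" "\<And>n. \<rho> n < \<rho> (Suc n)"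
  proof (rule exE[OF dependent_nat_choice[of P "\<lambda>n x y. x < y"]])
    show "\<exists>x. P 0 x" using ex[of 0 0] by auto
    show "\<exists>y. P (Suc n) y \<and> x < y" if "P n x" for x n using ex[of x "Suc n"] that by (auto simp: P_def)
  qed auto
  have \<rho>1: "0 < \<rho> j" "\<rho> j < 1" "1 - 1 / (real j + 1) \<le> \<rho> j" "L - (1/4)^j < I (\<rho> j * \<rho> j)" for j 
    using \<rho>(1)[of j] by (auto simp: P_def add.commute)
  have lim: "\<rho> \<longlonglongrightarrow> 1"
  proof (rule tendsto_sandwich)
    show "(\<lambda>j. 1 - 1 / (real j + 1)) \<longlonglongrightarrow> 1" by real_asymp
    show "(\<lambda>_. 1::real) \<longlonglongrightarrow> 1" by simp
    show "\<forall>\<^sub>F n in sequentially. 1 - 1 / (real n + 1) \<le> \<rho> n" using \<rho>1 by simp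
    show "\<forall>\<^sub>F n in sequentially. \<rho> n \<le> 1" using \<rho>1(2) by (simp add: less_imp_le)
  qed
  define h where "h = (\<lambda>j t. G (of_real (\<rho> (Suc j)) * cis t) - G (of_real (\<rho> j) * cis t))"
  have [measurable]: "h j \<in> borel_measurable borel" for j
    unfolding h_def by (intro borel_measurable_diff measr \<rho>1)
  have hM: "norm (h j t) \<le> 2 * M" for j t
    using norm_triangle_ineq4[of "G (of_real (\<rho> (Suc j)) * cis t)" "G (of_real (\<rho> j) * cis t)"]
      M[of "of_real (\<rho> (Suc j)) * cis t"] M[of "of_real (\<rho> j) * cis t"] \<rho>1
    unfolding h_def by (simp add: norm_mult abs_of_pos)
  have hint: "integrable circle_measure (\<lambda>t. norm (h j t))" for j
    by (rule circle_integrable_bounded[where B = "2 * M"]) (use hM in auto)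
  have hint2: "integrable circle_measure (\<lambda>t. (norm (h j t))\<^sup>2)" for j
    by (rule circle_integrable_bounded[where B = "(2 * M)\<^sup>2"]) (use power_mono[OF hM norm_ge_zero, of _ _ 2] in auto)
  have h2: "(LINT t|circle_measure. (norm (h j t))\<^sup>2) \<le> (1/4)^j" for j
  proof -
    let ?r = "\<rho> j" and ?s = "\<rho> (Suc j)"
    let ?A = "\<lambda>r s t. G (of_real r * cis t) * cnj (G (of_real s * cis t))"
    have "complex_of_real (LINT t|circle_measure. (norm (h j t))\<^sup>2) = (LINT t|circle_measure. of_real ((norm (h j t))\<^sup>2))"
      by (rule integral_complex_of_real[symmetric])
    also have "\<dots> = (LINT t|circle_measure. ?A ?s ?s t + ?A ?r ?r t - ?A ?s ?r t - ?A ?r ?s t)"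
      by (intro Bochner_Integration.integral_cong refl) (simp only: complex_norm_square h_def complex_cnj_diff, simp add: algebra_simps)
    also have "\<dots> = of_real (I (?s * ?s) + I (?r * ?r) - I (?s * ?r) - I (?r * ?s))"
      by (simp add: intr \<rho>1 par)
    finally have "(LINT t|circle_measure. (norm (h j t))\<^sup>2) = I (?s * ?s) + I (?r * ?r) - I (?s * ?r) - I (?r * ?s)"
      by (simp only: of_real_eq_iff)
    \<comment> \<open>Replacing both cross terms by \<open>I (?r * ?r)\<close> leaves at most I(s^2)
      - I(r^2), which is below L - (L - 4^-j).\<close>
    moreover have "I (?r * ?r) \<le> I (?r * ?s)" using \<rho>1 \<rho>(2)[of j] by (intro mono) (auto simp: less_imp_le)
    ultimately show ?thesis using L[of ?s] \<rho>1(4)[of j] \<rho>1(1,2) by (simp add: mult.commute)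
  qed
  have h1: "(LINT t|circle_measure. norm (h j t)) \<le> (1/2)^j" for j
  proof -
    \<comment> \<open>The weighted inequality 2x \<le> 2^j x^2 + 2^-j passes from L^2 to L^1 in
      place of Cauchy-Schwarz; the weight balances the two terms.\<close>
    have "(LINT t|circle_measure. norm (h j t)) \<le> (LINT t|circle_measure. (2^j * (norm (h j t))\<^sup>2 + (1/2)^j) / 2)"
    proof (rule integral_mono[OF hint])
      fix t
      have "0 \<le> 2^j * (norm (h j t) - (1/2)^j)\<^sup>2" by simp
      also have "\<dots> = 2^j * (norm (h j t))\<^sup>2 + (1/2)^j - 2 * norm (h j t)"
        by (simp add: power2_eq_square algebra_simps power_one_over)
      finally show "norm (h j t) \<le> (2^j * (norm (h j t))\<^sup>2 + (1/2)^j) / 2" by simp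
    qed (use hint2 in auto)
    also have "\<dots> = (2^j * (LINT t|circle_measure. (norm (h j t))\<^sup>2) + (1/2)^j) / 2"
      using hint2[of j] by simp
    also have "\<dots> \<le> (2^j * (1/4)^j + (1/2)^j) / 2"
      using h2[of j] by (intro divide_right_mono add_right_mono mult_left_mono) auto
    also have "\<dots> = (1/2)^j" by (simp flip: power_mult_distrib)
    finally show ?thesis .
  qed
  have "AE t in circle_measure. (\<Sum>j. ennreal (norm (h j t))) \<noteq> \<infinity>"
  proof (rule nn_integral_PInf_AE)
    have "(\<integral>\<^sup>+ t. (\<Sum>j. ennreal (norm (h j t))) \<partial>circle_measure) = (\<Sum>j. \<integral>\<^sup>+ t. ennreal (norm (h j t)) \<partial>circle_measure)"
      by (rule nn_integral_suminf) simp
    also have "\<dots> = (\<Sum>j. ennreal (LINT t|circle_measure. norm (h j t)))"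
      by (intro suminf_cong nn_integral_eq_integral hint) simp
    also have "\<dots> \<le> (\<Sum>j. ennreal ((1/2)^j))"
      by (intro suminf_le summableI ennreal_leI h1)
    also have "\<dots> = ennreal (\<Sum>j. (1/2)^j)"
      by (intro suminf_ennreal2 complete_algebra_summable_geometric) auto
    also have "\<dots> < \<infinity>" by simp
    finally show "(\<integral>\<^sup>+ t. (\<Sum>j. ennreal (norm (h j t))) \<partial>circle_measure) \<noteq> \<infinity>" by simp
  qed simp
  then have "AE t in circle_measure. convergent (\<lambda>j. G (of_real (\<rho> j) * cis t))"
  proof eventually_elim
    case (elim t)
    then have "summable (\<lambda>j. norm (h j t))" by (intro summable_suminf_not_top) auto
    then have "summable (\<lambda>j. h j t)" by (rule summable_norm_cancel)
    then have "convergent (\<lambda>n. (\<Sum>j<n. h j t))" by (simp add: summable_iff_convergent)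
    then have "convergent (\<lambda>n. (\<Sum>j<n. h j t) + G (of_real (\<rho> 0) * cis t))"
      by (intro convergent_add convergent_const)
    then show ?case unfolding h_def by (subst (asm) sum_lessThan_telescope) simp
  qed
  with \<rho>1(1,2) \<rho>(2) lim that show ?thesis by blast
qed

section \<open>The Poisson kernel and continuous extension to the closed disc\<close>

definition Poisson_kernel :: "complex \<Rightarrow> complex \<Rightarrow> real" where
  "Poisson_kernel u z = (1 - (norm u)\<^sup>2) / (norm (z - u))\<^sup>2"

lemma Poisson_kernel_nonneg: "norm u < 1 \<Longrightarrow> 0 \<le> Poisson_kernel u z"
  by (simp add: Poisson_kernel_def power_le_one)

text \<open>The two summands are the geometric series over the frequencies \<le> 0 and > 0 in z, so
  the kernel can be integrated termwise.\<close>

lemma Poisson_kernel_eq: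
  assumes "norm u < 1" "norm z = 1"
  shows "of_real (Poisson_kernel u z) = 1 / (1 - u * cnj z) + cnj u * z / (1 - cnj u * z)"
proof -
  have nz: "z * cnj z = 1" using assms complex_norm_square[of z] by simp
  have n1: "1 - u * cnj z \<noteq> 0" "1 - cnj u * z \<noteq> 0"
  proof -
    have "norm (u * cnj z) < 1" "norm (cnj u * z) < 1" using assms by (auto simp: norm_mult)
    then show "1 - u * cnj z \<noteq> 0" "1 - cnj u * z \<noteq> 0" by auto
  qed
  have "of_real ((norm (z - u))\<^sup>2) = (z - u) * cnj (z - u)" by (rule complex_norm_square)
  also have "\<dots> = (z * cnj z) * (1 - u * cnj z) * (1 - cnj u * z)"
    using nz by (simp add: algebra_simps)
  finally have d: "of_real ((norm (z - u))\<^sup>2) = (1 - u * cnj z) * (1 - cnj u * z)" using nz by simp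
  have n: "of_real (1 - (norm u)\<^sup>2) = 1 - u * cnj u"
    by (simp only: of_real_diff of_real_1 complex_norm_square)
  have "1 / (1 - u * cnj z) + cnj u * z / (1 - cnj u * z) = 
     (1 - cnj u * z + cnj u * z * (1 - u * cnj z)) / ((1 - u * cnj z) * (1 - cnj u * z))"
    using n1 by (simp add: field_simps)
  also have "1 - cnj u * z + cnj u * z * (1 - u * cnj z) = 1 - u * cnj u * (z * cnj z)"
    by (simp add: algebra_simps)
  finally show ?thesis
    unfolding Poisson_kernel_def of_real_divide d n using nz by simp
qed

lemma measurable_Poisson_kernel [measurable]: "(\<lambda>t. Poisson_kernel u (cis t)) \<in> borel_measurable borel"
  unfolding Poisson_kernel_def by measurable

lemma Poisson_kernel_le:
  assumes "norm z = 1" "norm u < 1"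
  shows "Poisson_kernel u z \<le> (1 - (norm u)\<^sup>2) / (1 - norm u)\<^sup>2"
proof -
  have "1 - norm u \<le> norm (z - u)" using assms norm_triangle_ineq2[of z u] by simp
  then show ?thesis using assms unfolding Poisson_kernel_def
    by (intro divide_left_mono power_mono mult_pos_pos) (auto simp: power_le_one)
qed

text \<open>Term k pairs the Fourier coefficient of index k with that of index -(k+1), so the
  two-sided expansion is a single series over the naturals.\<close>

lemma Poisson_integral:
  assumes u: "norm u < 1"
    and [measurable]: "g \<in> borel_measurable borel" and B: "\<And>t. norm (g t) \<le> B"
  shows "(\<lambda>k. u ^ k * (LINT t|circle_measure. g t * cis (- (of_nat k * t)))
            + cnj u ^ Suc k * (LINT t|circle_measure. g t * cis (of_nat (Suc k) * t))) sums
         (LINT t|circle_measure. g t * of_real (Poisson_kernel u (cis t)))"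
proof -
  have sm: "summable (\<lambda>k. norm (v ^ k))" if "norm v < 1" for v :: complex
    using that by (simp add: norm_power)
  have 1: "(\<lambda>k. u ^ k * (LINT t|circle_measure. cis (- (of_nat k * t)) * g t)) sums
         (LINT t|circle_measure. (\<Sum>k. u ^ k * cis (- (of_nat k * t))) * g t)"
    by (rule circle_suminf_integral[OF sm[OF u] _ _ _ B]) auto
  have 2: "(\<lambda>k. cnj u ^ Suc k * (LINT t|circle_measure. cis (of_nat (Suc k) * t) * g t)) sums
         (LINT t|circle_measure. (\<Sum>k. cnj u ^ Suc k * cis (of_nat (Suc k) * t)) * g t)"
  proof (rule circle_suminf_integral[OF _ _ _ _ B])
    show "summable (\<lambda>k. norm (cnj u ^ Suc k))" using sm[of "cnj u"] u
      by (subst summable_Suc_iff) simp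
  qed auto
  have s1: "(\<lambda>k. u ^ k * cis (- (of_nat k * t))) sums (1 / (1 - u * cnj (cis t)))" for t
  proof -
    have "(\<lambda>k. (u * cis (- t)) ^ k) sums (1 / (1 - u * cis (- t)))"
      using u by (intro geometric_sums) (simp add: norm_mult)
    then show ?thesis by (simp add: power_mult_distrib Complex.DeMoivre cis_cnj)
  qed
  have s2: "(\<lambda>k. cnj u ^ Suc k * cis (of_nat (Suc k) * t)) sums (cnj u * cis t / (1 - cnj u * cis t))" for t
  proof -
    have "(\<lambda>k. cnj u * cis t * (cnj u * cis t) ^ k) sums (cnj u * cis t * (1 / (1 - cnj u * cis t)))"
      using u by (intro sums_mult geometric_sums) (simp add: norm_mult)
    moreover have "cnj u * cis t * (cnj u * cis t) ^ k = cnj u ^ Suc k * cis (of_nat (Suc k) * t)" for k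
      by (subst Complex.DeMoivre[symmetric]) (simp add: power_mult_distrib)
    ultimately show ?thesis by simp
  qed
  have e1: "(\<Sum>k. u ^ k * cis (- (of_nat k * t))) = 1 / (1 - u * cnj (cis t))" for t
    using s1 by (simp add: sums_iff)
  have e2: "(\<Sum>k. cnj u ^ Suc k * cis (of_nat (Suc k) * t)) = cnj u * cis t / (1 - cnj u * cis t)" for t
    using sums_unique[OF s2] by simp
  have i1: "integrable circle_measure (\<lambda>t. 1 / (1 - u * cnj (cis t)) * g t)"
   and i2: "integrable circle_measure (\<lambda>t. cnj u * cis t / (1 - cnj u * cis t) * g t)"
  proof -
    have B0: "0 \<le> B" using order_trans[OF norm_ge_zero B[of 0]] .
    have "norm (v / (1 - w)) \<le> 1 / (1 - norm u)" if "norm v \<le> 1" "norm w = norm u" for v w :: complex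
    proof -
      have "1 - norm u \<le> norm (1 - w)" using that norm_triangle_ineq2[of 1 w] by simp
      then show ?thesis using u that unfolding norm_divide by (intro frac_le) auto
    qed
    note b = this
    show "integrable circle_measure (\<lambda>t. 1 / (1 - u * cnj (cis t)) * g t)"
      by (rule circle_integrable_bounded[where B = "1 / (1 - norm u) * B"], measurable)
        (unfold norm_mult, intro mult_mono b B, use u B0 in \<open>auto simp: norm_mult\<close>)
    show "integrable circle_measure (\<lambda>t. cnj u * cis t / (1 - cnj u * cis t) * g t)"
      by (rule circle_integrable_bounded[where B = "1 / (1 - norm u) * B"], measurable)
        (unfold norm_mult, intro mult_mono b B, use u B0 in \<open>auto simp: norm_mult\<close>)
  qed
  have "(LINT t|circle_measure. 1 / (1 - u * cnj (cis t)) * g t) +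
     (LINT t|circle_measure. cnj u * cis t / (1 - cnj u * cis t) * g t) =
     (LINT t|circle_measure. g t * of_real (Poisson_kernel u (cis t)))"
  proof -
    have "1 / (1 - u * cnj (cis t)) * g t + cnj u * cis t / (1 - cnj u * cis t) * g t
        = g t * of_real (Poisson_kernel u (cis t))" for t
      by (simp only: Poisson_kernel_eq[OF u norm_cis] distrib_right[symmetric] mult.commute[of "g t"])
    then show ?thesis using Bochner_Integration.integral_add[OF i1 i2] by (simp only:)
  qed
  with sums_add[OF 1[unfolded e1] 2[unfolded e2]] show ?thesis
    by (simp only: mult.commute[of "g _"])
qed

lemma Poisson_kernel_integral:
  assumes u: "norm u < 1"
  shows "(LINT t|circle_measure. Poisson_kernel u (cis t)) = 1"
proof -
  have "(\<lambda>k. u ^ k * (LINT t|circle_measure. 1 * cis (- (of_nat k * t)))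
            + cnj u ^ Suc k * (LINT t|circle_measure. 1 * cis (of_nat (Suc k) * t))) sums
         (LINT t|circle_measure. 1 * of_real (Poisson_kernel u (cis t)))"
    by (rule Poisson_integral[OF u]) auto
  moreover have "u ^ k * (LINT t|circle_measure. 1 * cis (- (of_nat k * t)))
            + cnj u ^ Suc k * (LINT t|circle_measure. 1 * cis (of_nat (Suc k) * t)) = u ^ k * of_bool (k = 0)" for k
    using circle_cis_integral[of "int (Suc k)"] circle_cis_integral[of "- int k"] by simp
  ultimately have "(\<lambda>k. u ^ k * of_bool (k = 0)) sums of_real (LINT t|circle_measure. Poisson_kernel u (cis t))"
    by simp
  from sums_unique2[OF this sums_mult_of_bool] show ?thesis by simp
qed

lemma Poisson_integrable:
  fixes g :: "real \<Rightarrow> complex"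
  assumes u: "norm u < 1"
    and [measurable]: "g \<in> borel_measurable borel" and B: "\<And>t. norm (g t) \<le> B"
  shows "integrable circle_measure (\<lambda>t. g t * of_real (Poisson_kernel u (cis t)))"
proof (rule circle_integrable_bounded)
  show "norm (g t * of_real (Poisson_kernel u (cis t))) \<le> B * ((1 - (norm u)\<^sup>2) / (1 - norm u)\<^sup>2)" for t
    unfolding norm_mult using u Poisson_kernel_le[of "cis t" u] Poisson_kernel_nonneg[OF u, of "cis t"] B
      order_trans[OF norm_ge_zero B[of 0]]
    by (intro mult_mono) auto
qed measurable

lemma Poisson_integral_tendsto:
  fixes g :: "complex \<Rightarrow> complex"
  assumes g: "continuous_on (sphere 0 1) g" and z0: "norm z0 = 1" 
  shows "((\<lambda>u. LINT t|circle_measure. g (cis t) * of_real (Poisson_kernel u (cis t))) \<longlongrightarrow> g z0) (at z0 within ball 0 1)"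
proof (rule tendstoI)
  fix e :: real assume e: "e > 0"
  note [measurable] = measurable_cis_comp[OF g]
  have "bounded (g ` sphere 0 1)"
    by (intro compact_imp_bounded compact_continuous_image g) auto
  then obtain B where B: "\<And>z. norm z = 1 \<Longrightarrow> norm (g z) \<le> B" by (force simp: bounded_iff)
  have "continuous (at z0 within sphere 0 1) g" using g z0 by (simp add: continuous_on_eq_continuous_within)
  then obtain d where d: "d > 0" "\<And>z. norm z = 1 \<Longrightarrow> dist z z0 < d \<Longrightarrow> dist (g z) (g z0) < e / 2"
    unfolding continuous_within_eps_delta using e by (metis half_gt_zero mem_sphere_0)
  \<comment> \<open>Where \<open>cis t\<close> is at distance at least d from z0, it is at distance
    at least d/2 from u, so the kernel is at most (1 - |u|^2) * 4 / d^2; the factor 2 B bounds the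
    difference of the values of g.\<close>
  define C where "C = 2 * B * (4 / d\<^sup>2)"
  have C: "0 \<le> C" unfolding C_def using order_trans[OF norm_ge_zero B[OF z0]] by simp
  have key: "norm ((LINT t|circle_measure. g (cis t) * of_real (Poisson_kernel u (cis t))) - g z0) 
      \<le> e / 2 + C * (1 - (norm u)\<^sup>2)" if u: "norm u < 1" "dist u z0 < d / 2" for u
  proof -
    have i1: "integrable circle_measure (\<lambda>t. g (cis t) * of_real (Poisson_kernel u (cis t)))"
      by (rule Poisson_integrable[OF u(1), where B = B]) (use B in auto)
    have i2: "integrable circle_measure (\<lambda>t. g z0 * of_real (Poisson_kernel u (cis t)))"
      by (rule Poisson_integrable[OF u(1), where B = B]) (use B z0 in auto)
    have i3: "integrable circle_measure (\<lambda>t. Poisson_kernel u (cis t))"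
      by (rule circle_integrable_bounded[where B = "(1 - (norm u)\<^sup>2) / (1 - norm u)\<^sup>2"])
        (use Poisson_kernel_le[OF _ u(1)] Poisson_kernel_nonneg[OF u(1)] in auto)
    have "(LINT t|circle_measure. g (cis t) * of_real (Poisson_kernel u (cis t))) - g z0 =
       (LINT t|circle_measure. g (cis t) * of_real (Poisson_kernel u (cis t)) - g z0 * of_real (Poisson_kernel u (cis t)))"
      using Poisson_kernel_integral[OF u(1)] by (simp add: i1 i2)
    also have "norm \<dots> \<le> (LINT t|circle_measure. e / 2 * Poisson_kernel u (cis t) + C * (1 - (norm u)\<^sup>2))"
    proof (rule Bochner_Integration.integral_norm_bound_integral)
      fix t
      let ?p = "Poisson_kernel u (cis t)"
      have "norm (g (cis t) - g z0) * ?p \<le> e / 2 * ?p + C * (1 - (norm u)\<^sup>2)"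
      proof (cases "dist (cis t) z0 < d")
        case True
        then have "norm (g (cis t) - g z0) \<le> e / 2" using d(2)[of "cis t"] by (simp add: dist_norm)
        then have "norm (g (cis t) - g z0) * ?p \<le> e / 2 * ?p"
          by (intro mult_right_mono Poisson_kernel_nonneg u)
        moreover have "0 \<le> C * (1 - (norm u)\<^sup>2)" using C u by (simp add: power_le_one)
        ultimately show ?thesis by linarith
      next
        case False
        then have "d / 2 \<le> norm (cis t - u)" using u(2) dist_triangle[of "cis t" z0 u] by (simp add: dist_norm)
        then have "(d / 2)\<^sup>2 \<le> (norm (cis t - u))\<^sup>2" using d(1) by (intro power_mono) auto
        then have "?p \<le> (1 - (norm u)\<^sup>2) / (d / 2)\<^sup>2"
          unfolding Poisson_kernel_def using d(1) u(1) 
          by (intro divide_left_mono mult_pos_pos) (auto simp: power_le_one intro: less_le_trans[rotated])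
        moreover have "norm (g (cis t) - g z0) \<le> 2 * B"
          using norm_triangle_ineq4[of "g (cis t)" "g z0"] B[of "cis t"] B[OF z0] by simp
        ultimately have "norm (g (cis t) - g z0) * ?p \<le> (2 * B) * ((1 - (norm u)\<^sup>2) / (d / 2)\<^sup>2)"
          by (intro mult_mono Poisson_kernel_nonneg u) (use order_trans[OF norm_ge_zero B[OF z0]] in auto)
        also have "\<dots> = C * (1 - (norm u)\<^sup>2)" by (simp add: C_def power_divide)
        also have "\<dots> \<le> e / 2 * ?p + C * (1 - (norm u)\<^sup>2)" using e Poisson_kernel_nonneg[OF u(1)] by simp
        finally show ?thesis .
      qed
      then show "norm (g (cis t) * of_real ?p - g z0 * of_real ?p) \<le> e / 2 * ?p + C * (1 - (norm u)\<^sup>2)"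
        using Poisson_kernel_nonneg[OF u(1), of "cis t"] by (simp add: norm_mult flip: left_diff_distrib)
    qed (use i1 i2 i3 in auto)
    also have "\<dots> = e / 2 + C * (1 - (norm u)\<^sup>2)"
      using i3 Poisson_kernel_integral[OF u(1)] by simp
    finally show ?thesis .
  qed
  have "((\<lambda>u. C * (1 - (norm u)\<^sup>2)) \<longlongrightarrow> C * (1 - (norm z0)\<^sup>2)) (at z0 within ball 0 1)"
    by (intro tendsto_intros)
  then have "\<forall>\<^sub>F u in at z0 within ball 0 1. C * (1 - (norm u)\<^sup>2) < e / 2"
    using order_tendstoD(2)[of _ _ _ "e/2"] z0 e by fastforce
  moreover have "\<forall>\<^sub>F u in at z0 within ball 0 1. dist u z0 < d / 2"
    using d(1) by (intro tendstoD[OF tendsto_ident_at]) auto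
  moreover have "\<forall>\<^sub>F u in at z0 within ball 0 1. norm u < 1"
    by (simp add: eventually_at_filter)
  ultimately show "\<forall>\<^sub>F u in at z0 within ball 0 1. 
     dist (LINT t|circle_measure. g (cis t) * of_real (Poisson_kernel u (cis t))) (g z0) < e"
  proof eventually_elim
    case (elim u)
    then show ?case using key[of u] by (simp add: dist_norm)
  qed
qed

text \<open>Without positive frequencies the Poisson integral of g at \<open>cnj w\<close> is a
  power series in w: the integral gives continuity up to the circle, the series gives holomorphy.
  The conjugation turns the remaining powers z^-k into w^k, since \<open>cnj w\<close> is 1 / w on
  the circle.\<close>

lemma analytic_boundary_extension:
  fixes g :: "complex \<Rightarrow> complex"
  assumes g: "continuous_on (sphere 0 1) g" and F: "\<And>k. k > 0 \<Longrightarrow> Fourier_coefficient g k = 0"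
  obtains A where "continuous_on (cball 0 1) A" "A holomorphic_on ball 0 1" 
    "\<And>w. norm w = 1 \<Longrightarrow> A w = g (cnj w)" "A 0 = Fourier_coefficient g 0"
proof -
  define A where "A = (\<lambda>w. if norm w < 1 then \<Sum>k. Fourier_coefficient g (- int k) * w ^ k else g (cnj w))"
  note m[measurable] = measurable_cis_comp[OF g]
  have "bounded (g ` sphere 0 1)"
    by (intro compact_imp_bounded compact_continuous_image g) auto
  then obtain B where B: "\<And>z. norm z = 1 \<Longrightarrow> norm (g z) \<le> B" by (force simp: bounded_iff)
  have sums: "(\<lambda>k. Fourier_coefficient g (- int k) * w ^ k) sums
      (LINT t|circle_measure. g (cis t) * of_real (Poisson_kernel (cnj w) (cis t)))" if w: "norm w < 1" for w
  proof -
    have "(\<lambda>k. cnj w ^ k * (LINT t|circle_measure. g (cis t) * cis (- (of_nat k * t)))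
            + cnj (cnj w) ^ Suc k * (LINT t|circle_measure. g (cis t) * cis (of_nat (Suc k) * t))) sums
         (LINT t|circle_measure. g (cis t) * of_real (Poisson_kernel (cnj w) (cis t)))" (is "?f sums ?I")
      by (rule Poisson_integral[where B = B]) (use w B in auto)
    also have "?f = (\<lambda>k. cnj w ^ k * Fourier_coefficient g (int k) + w ^ Suc k * Fourier_coefficient g (- int (Suc k)))"
      by (simp only: Fourier_coefficient_eq[OF m] of_int_minus of_int_of_nat_eq minus_minus mult_minus_left complex_cnj_cnj)
    also have "\<dots> = (\<lambda>k. Fourier_coefficient g 0 * of_bool (k = 0) + w ^ Suc k * Fourier_coefficient g (- int (Suc k)))"
      by (auto simp: F)
    \<comment> \<open>Index 0 carries both the constant term and the coefficient of w. Taking the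
      constant off leaves a power series starting at w^1, which is then re-indexed.\<close>
    finally have "(\<lambda>k. Fourier_coefficient g 0 * of_bool (k = 0) + w ^ Suc k * Fourier_coefficient g (- int (Suc k))
         - Fourier_coefficient g 0 * of_bool (k = 0)) sums (?I - Fourier_coefficient g 0)"
      by (rule sums_diff[OF _ sums_mult_of_bool])
    then have "(\<lambda>k. w ^ Suc k * Fourier_coefficient g (- int (Suc k))) sums (?I - Fourier_coefficient g 0)" by simp
    then have "(\<lambda>k. Fourier_coefficient g (- int (Suc k)) * w ^ Suc k) sums (?I - Fourier_coefficient g 0)"
      by (simp only: mult.commute)
    then show ?thesis
      by (subst (asm) sums_Suc_iff) simp
  qed
  have Aeq: "A w = (LINT t|circle_measure. g (cis t) * of_real (Poisson_kernel (cnj w) (cis t)))" if "norm w < 1" for w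
    using sums_unique[OF sums[OF that]] that by (simp add: A_def)
  have hol: "A holomorphic_on ball 0 1"
  proof (rule power_series_holomorphic)
    fix w :: complex assume "w \<in> ball 0 1"
    then show "(\<lambda>k. Fourier_coefficient g (- int k) * (w - 0) ^ k) sums A w"
      using sums[of w] Aeq[of w] by simp
  qed
  have "continuous_on (cball 0 1) A"
    unfolding continuous_on_eq_continuous_within
  proof
    fix w :: complex assume w: "w \<in> cball 0 1"
    show "continuous (at w within cball 0 1) A"
    proof (cases "norm w < 1")
      case True
      then have "continuous (at w) A"
        using holomorphic_on_imp_continuous_on[OF hol] continuous_on_interior[of "ball 0 1" A w] by auto
      then show ?thesis by (rule continuous_at_imp_continuous_at_within)
    next
      case False
      with w have w1: "norm w = 1" by simp
      have "((\<lambda>v. LINT t|circle_measure. g (cis t) * of_real (Poisson_kernel v (cis t))) \<longlongrightarrow> g (cnj w)) (at (cnj w) within ball 0 1)"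
        by (rule Poisson_integral_tendsto[OF g]) (use w1 in auto)
      moreover have "filterlim cnj (at (cnj w) within ball 0 1) (at w within ball 0 1)"
        by (auto simp: filterlim_at eventually_at_filter intro!: tendsto_intros)
      ultimately have "((\<lambda>v. LINT t|circle_measure. g (cis t) * of_real (Poisson_kernel (cnj v) (cis t))) \<longlongrightarrow> g (cnj w)) (at w within ball 0 1)"
        by (rule filterlim_compose)
      then have "(A \<longlongrightarrow> g (cnj w)) (at w within ball 0 1)"
        by (rule tendsto_cong[THEN iffD1, rotated]) (simp add: eventually_at_filter Aeq)
      \<comment> \<open>Within the closed disc a boundary point is also approached along the circle,
        where \<open>A\<close> is given by g itself and not by the Poisson integral.\<close>
      moreover have "(A \<longlongrightarrow> g (cnj w)) (at w within sphere 0 1)"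
      proof -
        have "continuous_on (sphere 0 1) (\<lambda>w. g (cnj w))"
          by (rule continuous_on_compose2[OF g]) (auto intro!: continuous_intros)
        then have "((\<lambda>w. g (cnj w)) \<longlongrightarrow> g (cnj w)) (at w within sphere 0 1)"
          using w1 by (simp add: continuous_on_def)
        then show ?thesis
          by (rule tendsto_cong[THEN iffD1, rotated]) (simp add: eventually_at_filter A_def)
      qed
      ultimately have "(A \<longlongrightarrow> g (cnj w)) (at w within (ball 0 1 \<union> sphere 0 1))"
        by (rule Lim_Un)
      moreover have "ball 0 1 \<union> sphere 0 1 = cball (0::complex) 1" by auto
      moreover have "A w = g (cnj w)" using w1 by (simp add: A_def)
      ultimately show ?thesis by (simp add: continuous_within)
    qed
  qed
  moreover note hol
  moreover have "A w = g (cnj w)" if "norm w = 1" for w using that by (simp add: A_def)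
  moreover have "A 0 = Fourier_coefficient g 0" by (simp add: A_def)
  ultimately show ?thesis using that by blast
qed

section \<open>The exterior Riemann map\<close>

text \<open>At points of the closed disc outside U the modulus of q tends to at most 1 \<le> |q 0|,
  so its supremum is attained in U. The set where it is attained is open by the maximum principle,
  and closed in the disc because a limit point outside U would have modulus equal to the supremum,
  hence at least 1. By connectedness it is the whole disc.\<close>

lemma max_modulus_disc:
  fixes q :: "complex \<Rightarrow> complex"
  assumes U: "open U" "U \<subseteq> ball 0 1" "0 \<in> U" and q: "q holomorphic_on U" and q0: "1 \<le> norm (q 0)"
    and lim: "\<And>w. norm w \<le> 1 \<Longrightarrow> w \<notin> U \<Longrightarrow> ((\<lambda>w. norm (q w)) \<longlongrightarrow> norm w) (at w within U)"
  shows "U = ball 0 1" "norm (q 0) = 1" "\<And>w. w \<in> U \<Longrightarrow> q w = q 0"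
proof -
  have cont: "continuous_on U q" using q by (rule holomorphic_on_imp_continuous_on)
  have seq_in: "(\<lambda>n. norm (q (f n))) \<longlonglongrightarrow> norm (q x)" if "\<And>n. f n \<in> U" "f \<longlonglongrightarrow> x" "x \<in> U" for f x
    using that cont by (intro tendsto_norm continuous_on_tendsto_compose[OF cont]) auto
  have seq_out: "(\<lambda>n. norm (q (f n))) \<longlonglongrightarrow> norm x" if "\<And>n. f n \<in> U" "f \<longlonglongrightarrow> x" "x \<notin> U" "norm x \<le> 1" for f x
  proof (rule filterlim_compose[OF lim[OF that(4,3)]])
    show "filterlim f (at x within U) sequentially"
      unfolding filterlim_at using that by (auto intro!: always_eventually)
  qed
  have bnd: "norm x \<le> 1" if "\<And>n. f n \<in> U" "f \<longlonglongrightarrow> x" for f x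
    using U(2) that by (intro LIMSEQ_le_const2[OF tendsto_norm[OF that(2)]]) (auto simp: less_imp_le subset_iff)
  obtain w1 where w1: "w1 \<in> U" "\<And>w. w \<in> U \<Longrightarrow> norm (q w) \<le> norm (q w1)"
  proof (cases "\<forall>w\<in>U. norm (q w) \<le> 1")
    case True
    then show ?thesis using that[of 0] U q0 by force
  next
    case False
    then obtain w2 where w2: "w2 \<in> U" "norm (q w2) > 1" by auto
    \<comment> \<open>This superlevel set is compact: along a sequence in it converging to a point
      outside U, the modulus of q would tend to at most 1, below its value at w2.\<close>
    define C where "C = {w\<in>U. norm (q w2) \<le> norm (q w)}"
    have "closed C"
      unfolding closed_sequential_limits
    proof (intro allI impI, elim conjE)
      fix f x assume f: "\<forall>n. f n \<in> C" "f \<longlonglongrightarrow> x"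
      then have fU: "\<And>n. f n \<in> U" "\<And>n. norm (q w2) \<le> norm (q (f n))" by (auto simp: C_def)
      show "x \<in> C"
      proof (cases "x \<in> U")
        case True
        then show ?thesis using LIMSEQ_le_const[OF seq_in[OF fU(1) f(2) True]] fU(2) by (auto simp: C_def)
      next
        case False
        have "norm x \<le> 1" by (rule bnd[OF fU(1) f(2)])
        moreover have "norm (q w2) \<le> norm x"
          using LIMSEQ_le_const[OF seq_out[OF fU(1) f(2) False calculation]] fU(2) by auto
        ultimately show ?thesis using w2 by simp
      qed
    qed
    moreover have "bounded C" using U(2) by (auto simp: C_def intro: bounded_subset[OF bounded_ball])
    ultimately have "compact C" by (simp add: compact_eq_bounded_closed)
    moreover have "w2 \<in> C" using w2 by (simp add: C_def)
    moreover have "continuous_on C (\<lambda>w. norm (q w))"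
      by (intro continuous_intros continuous_on_subset[OF cont]) (auto simp: C_def)
    ultimately obtain w1 where w1: "w1 \<in> C" "\<And>w. w \<in> C \<Longrightarrow> norm (q w) \<le> norm (q w1)"
      using continuous_attains_sup[of C] by blast
    then have "norm (q w) \<le> norm (q w1)" if "w \<in> U" for w
      using that by (cases "w \<in> C") (auto simp: C_def)
    then show ?thesis using that w1 by (auto simp: C_def)
  qed
  define M where "M = norm (q w1)"
  have M: "1 \<le> M" using w1(2)[OF U(3)] q0 by (simp add: M_def)
  define C where "C = {w\<in>U. norm (q w) = M}"
  have CU: "C \<subseteq> U" by (auto simp: C_def)
  have "open C"
    unfolding open_contains_ball
  proof
    fix w assume w: "w \<in> C"
    then obtain r where r: "r > 0" "ball w r \<subseteq> U"
      using U(1) CU by (meson open_contains_ball subsetD)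
    have "q constant_on ball w r"
    proof (rule maximum_modulus_principle[of q "ball w r" "ball w r" w])
      show "q holomorphic_on ball w r" using q r(2) by (rule holomorphic_on_subset)
      show "norm (q z) \<le> norm (q w)" if "z \<in> ball w r" for z
        using w1(2)[of z] w r(2) that by (auto simp: C_def M_def)
    qed (use r in auto)
    then have "q v = q w" if "v \<in> ball w r" for v
      using that r(1) by (metis centre_in_ball constant_on_def)
    then have "ball w r \<subseteq> C" using r(2) w unfolding C_def by (auto simp del: mem_ball)
    with r(1) show "\<exists>r>0. ball w r \<subseteq> C" by blast
  qed
  then have "openin (top_of_set (ball 0 1)) C"
    using CU U(2) by (meson open_subset order_trans)
  moreover have "ball 0 1 \<inter> closure C = C"
  proof (intro subset_antisym subsetI)
    fix x assume x: "x \<in> ball 0 1 \<inter> closure C"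
    then obtain f where "\<And>n. f n \<in> C" "f \<longlonglongrightarrow> x" by (auto simp: closure_sequential)
    with x have f: "\<And>n. f n \<in> U" "\<And>n. norm (q (f n)) = M" "norm x < 1" "f \<longlonglongrightarrow> x" by (auto simp: C_def)
    have "x \<in> U"
    proof (rule ccontr)
      assume "x \<notin> U"
      from seq_out[OF f(1,4) this] f(2,3) have "M = norm x" by (simp add: LIMSEQ_const_iff)
      with M f(3) show False by simp
    qed
    with seq_in[OF f(1,4)] f(2) show "x \<in> C" by (simp add: C_def LIMSEQ_const_iff)
  qed (use CU U(2) closure_subset[of C] in auto)
  then have "closedin (top_of_set (ball 0 1)) C"
    by (metis closed_closure closedin_closed_Int)
  moreover have "connected (ball (0::complex) 1)" by simp
  moreover have "C \<noteq> {}" using w1 by (auto simp: C_def M_def)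
  ultimately have C: "C = ball 0 1" by (metis connected_clopen)
  with CU U(2) show Ueq: "U = ball 0 1" by auto
  have "q constant_on ball 0 1"
    using maximum_modulus_principle[of q "ball 0 1" "ball 0 1" w1] q w1 unfolding Ueq by simp
  then show const: "\<And>w. w \<in> U \<Longrightarrow> q w = q 0"
    using Ueq by (metis U(3) constant_on_def)
  have "0 \<in> C" unfolding C by simp
  then have "norm (q 0) = M" by (simp add: C_def)
  \<comment> \<open>Any point of the circle serves: the constant modulus must agree with the
    boundary limit 1.\<close>
  have "((\<lambda>w. norm (q w)) \<longlongrightarrow> 1) (at 1 within U)" using lim[of 1] unfolding Ueq by simp
  then have "((\<lambda>w. norm (q 0)) \<longlongrightarrow> 1) (at 1 within U)"
    by (rule tendsto_cong[THEN iffD1, rotated]) (auto simp: eventually_at_filter const)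
  moreover have "at 1 within U \<noteq> bot"
    unfolding Ueq trivial_limit_within by (simp add: islimpt_ball)
  ultimately show "norm (q 0) = 1" by (metis tendsto_const_iff)
qed

section \<open>The exterior map near infinity, its inverse near the compact set, and
  uniqueness\<close>

locale exterior_map =
  fixes K :: "complex set" and \<phi> :: "complex \<Rightarrow> complex" and c :: real
  assumes compact_K: "compact K"
    and hol: "\<phi> holomorphic_on {z. 1 < norm z}"
    and bij: "bij_betw \<phi> {z. 1 < norm z} (- K)"
    and at_inf: "filterlim \<phi> at_infinity at_infinity"
    and c_pos: "c > 0" and c_lim: "((\<lambda>z. \<phi> z / z) \<longlongrightarrow> of_real c) at_infinity"
begin

lemma open_exterior: "open {z::complex. 1 < norm z}"
  by (intro open_Collect_less continuous_intros)

lemma inj: "\<phi> z = \<phi> w \<Longrightarrow> 1 < norm z \<Longrightarrow> 1 < norm w \<Longrightarrow> z = w"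
  using bij by (auto simp: bij_betw_def inj_on_def)

lemma notin_K: "1 < norm z \<Longrightarrow> \<phi> z \<notin> K"
  using bij by (auto simp: bij_betw_def)

text \<open>This is \<open>\<phi>\<close> in the coordinate w = 1 / z with its simple pole at
  infinity cleared; the value at 0 is \<phi>'(\<infinity>).\<close>

definition H :: "complex \<Rightarrow> complex" where
  "H w = (if w = 0 then of_real c else w * \<phi> (1 / w))"

lemma H_0 [simp]: "H 0 = of_real c" by (simp add: H_def)

lemma H_holomorphic: "H holomorphic_on ball 0 1"
proof (rule no_isolated_singularity)
  have "(\<lambda>w. w * \<phi> (1 / w)) holomorphic_on ball 0 1 - {0}"
    by (intro holomorphic_intros holomorphic_on_compose_gen[OF _ hol, unfolded o_def])
      (auto simp: norm_divide)
  then show hol: "H holomorphic_on ball 0 1 - {0}"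
    by (rule holomorphic_transform) (auto simp: H_def)
  show "continuous_on (ball 0 1) H"
    unfolding continuous_on_eq_continuous_at[OF open_ball]
  proof
    fix w :: complex assume w: "w \<in> ball 0 1"
    show "isCont H w"
    proof (cases "w = 0")
      case True
      have "filterlim (\<lambda>w::complex. inverse w) at_infinity (at 0)" by (rule filterlim_inverse_at_infinity)
      from filterlim_compose[OF c_lim this] have "((\<lambda>w. \<phi> (inverse w) / inverse w) \<longlongrightarrow> of_real c) (at 0)" .
      then have "(H \<longlongrightarrow> of_real c) (at 0)"
        by (rule tendsto_cong[THEN iffD1, rotated])
          (auto simp: eventually_at_filter H_def field_simps)
      then show ?thesis by (simp add: True isCont_def)
    next
      case False
      then show ?thesis using hol w
        by (intro continuous_on_interior[OF holomorphic_on_imp_continuous_on[OF hol]]) (auto simp: interior_diff)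
    qed
  qed
qed auto

lemma \<phi>_eq_H: "w \<noteq> 0 \<Longrightarrow> \<phi> (1 / w) = H w / w"
  by (simp add: H_def)

text \<open>By the open mapping theorem for 1 / \<phi>(1/u) at u = 0, values of large modulus are
  already taken far out; by injectivity no point of the annulus 1 < |z| \<le> R takes them again.
  This controls \<open>\<phi>\<close> up to the circle without knowing its boundary values.\<close>

lemma \<phi>_bounded: obtains B where "\<And>z. 1 < norm z \<Longrightarrow> norm z \<le> R \<Longrightarrow> norm (\<phi> z) \<le> B"
proof -
  have "isCont H 0"
    using continuous_on_interior[OF holomorphic_on_imp_continuous_on[OF H_holomorphic], of 0] by simp
  moreover have "H 0 \<noteq> 0" using c_pos by simp
  ultimately obtain d where d: "d > 0" "\<And>w. dist 0 w < d \<Longrightarrow> H w \<noteq> 0"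
    using continuous_at_avoid by blast
  \<comment> \<open>The last bound gives |1/u| > max 1 R for 0 < |u| < e, so that 1/u differs from
    every point of the annulus.\<close>
  define e where "e = min (min d 1) (1 / max 1 R)"
  have e: "0 < e" "e \<le> 1" "e \<le> d" "e \<le> 1 / max 1 R" using d by (auto simp: e_def)
  define E where "E = (\<lambda>u. u / H u)"
  have holE: "E holomorphic_on ball 0 e" unfolding E_def
    using e d by (intro holomorphic_intros holomorphic_on_subset[OF H_holomorphic]) auto
  have "\<not> E constant_on ball 0 e"
  proof
    assume "E constant_on ball 0 e"
    then obtain k where k: "\<And>u. norm u < e \<Longrightarrow> E u = k" by (auto simp: constant_on_def)
    from k[of 0] k[of "of_real (e / 2)"] e have "E (of_real (e / 2)) = 0" by (simp add: E_def)
    with d(2)[of "of_real (e / 2)"] e show False by (auto simp: E_def)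
  qed
  then have "open (E ` ball 0 e)"
    by (intro open_mapping_thm[OF holE]) auto
  moreover have "0 \<in> E ` ball 0 e" using e by (auto intro!: image_eqI[of _ _ 0] simp: E_def)
  ultimately obtain r where r: "r > 0" "ball 0 r \<subseteq> E ` ball 0 e" by (meson open_contains_ball)
  have "norm (\<phi> z) \<le> 1 / r" if z: "1 < norm z" "norm z \<le> R" for z
  proof (rule ccontr)
    assume "\<not> norm (\<phi> z) \<le> 1 / r"
    then have *: "1 / r < norm (\<phi> z)" by simp
    with r have nz: "\<phi> z \<noteq> 0" by (auto simp: field_simps)
    have "norm (1 / \<phi> z) < r" using * r nz by (simp add: norm_divide field_simps)
    then have "1 / \<phi> z \<in> E ` ball 0 e" using r(2) by auto
    then obtain u where u: "norm u < e" "1 / \<phi> z = E u" by auto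
    with nz have "u \<noteq> 0" by (auto simp: E_def)
    with u(2) nz have "\<phi> z = \<phi> (1 / u)" by (auto simp: E_def H_def field_simps)
    moreover have "max 1 R < norm (1 / u)"
    proof -
      have "norm u < 1 / max 1 R" using u(1) e(4) by simp
      then have "norm u * max 1 R < 1" by (simp add: less_divide_eq)
      then show ?thesis using \<open>u \<noteq> 0\<close> by (simp add: norm_divide less_divide_eq mult.commute)
    qed
    ultimately show False using inj[of z "1 / u"] z by auto
  qed
  then show ?thesis using that by blast
qed

definition \<psi> :: "complex \<Rightarrow> complex" where
  "\<psi> = inv_into {z. 1 < norm z} \<phi>"

lemma \<psi>_\<phi>: "1 < norm z \<Longrightarrow> \<psi> (\<phi> z) = z"
  using bij unfolding \<psi>_def bij_betw_def by (intro inv_into_f_f) auto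

lemma \<phi>_\<psi>: "v \<notin> K \<Longrightarrow> \<phi> (\<psi> v) = v"
  and norm_\<psi>: "v \<notin> K \<Longrightarrow> 1 < norm (\<psi> v)"
proof -
  assume "v \<notin> K"
  then have "v \<in> \<phi> ` {z. 1 < norm z}" using bij by (auto simp: bij_betw_def)
  then show "\<phi> (\<psi> v) = v" "1 < norm (\<psi> v)"
    unfolding \<psi>_def using inv_into_into[of v \<phi> "{z. 1 < norm z}"] by (auto simp: f_inv_into_f)
qed

lemma open_compl_K: "open (- K)"
  using compact_K compact_imp_closed by blast

lemma \<psi>_holomorphic: "\<psi> holomorphic_on - K"
proof -
  have im: "\<phi> ` {z. 1 < norm z} = - K" and ij: "inj_on \<phi> {z. 1 < norm z}"
    using bij by (auto simp: bij_betw_def)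
  from holomorphic_has_inverse[OF hol open_exterior ij] obtain g where
    g: "g holomorphic_on \<phi> ` {z. 1 < norm z}" "\<And>z. z \<in> {z. 1 < norm z} \<Longrightarrow> g (\<phi> z) = z" by metis
  from g(1) have "g holomorphic_on - K" unfolding im .
  then show ?thesis
  proof (rule holomorphic_transform)
    show "g v = \<psi> v" if "v \<in> - K" for v
      using g(2)[of "\<psi> v"] \<phi>_\<psi>[of v] norm_\<psi>[of v] that by simp
  qed
qed

lemma eventually_notin_K: "\<forall>\<^sub>F v in at_infinity. v \<notin> K"
  using compact_imp_bounded[OF compact_K] unfolding bounded_iff eventually_at_infinity
  by (metis add_le_same_cancel1 not_one_le_zero order_trans)

lemma \<psi>_at_infinity: "filterlim \<psi> at_infinity at_infinity"
  unfolding filterlim_at_infinity[OF order_refl]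
proof (intro allI impI)
  fix r :: real assume "r > 0"
  obtain B where B: "\<And>z. 1 < norm z \<Longrightarrow> norm z \<le> r \<Longrightarrow> norm (\<phi> z) \<le> B" using \<phi>_bounded by blast
  have "\<forall>\<^sub>F v in at_infinity. B + 1 \<le> norm (v::complex)" by (auto simp: eventually_at_infinity)
  then show "\<forall>\<^sub>F v in at_infinity. r \<le> norm (\<psi> v)"
    using eventually_notin_K
  proof eventually_elim
    case (elim v)
    then show ?case using B[OF norm_\<psi>[of v]] \<phi>_\<psi>[of v] by (cases "norm (\<psi> v) \<le> r") auto
  qed
qed

lemma \<psi>_div: "((\<lambda>v. \<psi> v / v) \<longlongrightarrow> 1 / of_real c) at_infinity"
proof -
  have "((\<lambda>v. \<phi> (\<psi> v) / \<psi> v) \<longlongrightarrow> of_real c) at_infinity"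
    by (rule filterlim_compose[OF c_lim \<psi>_at_infinity])
  then have "((\<lambda>v. 1 / (\<phi> (\<psi> v) / \<psi> v)) \<longlongrightarrow> 1 / of_real c) at_infinity"
    using c_pos by (intro tendsto_intros) auto
  then show ?thesis
    by (rule tendsto_cong[THEN iffD1, rotated]) (use eventually_notin_K in \<open>eventually_elim, simp add: \<phi>_\<psi>\<close>)
qed

text \<open>The compact piece 1 + e \<le> |z| \<le> R has a compact image that misses
  \<open>K\<close>, hence stays away from v0, and |z| \<ge> R is mapped away from v0 as well. So
  near v0 the inverse lands in 1 < |z| < 1 + e.\<close>

lemma norm_\<psi>_tendsto:
  assumes v0: "v0 \<in> K"
  shows "((\<lambda>v. norm (\<psi> v)) \<longlongrightarrow> 1) (at v0 within - K)"
proof (rule tendstoI)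
  fix e :: real assume e: "e > 0"
  have "\<forall>\<^sub>F z in at_infinity. norm v0 + 1 \<le> norm (\<phi> z)"
    using at_inf norm_ge_zero[of v0] unfolding filterlim_at_infinity[OF order_refl] by (auto simp: add_nonneg_pos)
  then obtain R where R: "\<And>z. R \<le> norm z \<Longrightarrow> norm v0 + 1 \<le> norm (\<phi> z)" by (auto simp: eventually_at_infinity)
  define S where "S = {z::complex. 1 + e \<le> norm z} \<inter> cball 0 R"
  have "closed {z::complex. 1 + e \<le> norm z}"
    by (intro closed_Collect_le continuous_intros)
  then have "compact S" unfolding S_def by (intro closed_Int_compact) auto
  moreover have "S \<subseteq> {z. 1 < norm z}" using e by (auto simp: S_def)
  ultimately have "closed (\<phi> ` S)"
    by (intro compact_imp_closed compact_continuous_image continuous_on_subset[OF holomorphic_on_imp_continuous_on[OF hol]])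
  moreover have "v0 \<notin> \<phi> ` S" using \<open>S \<subseteq> _\<close> notin_K v0 by auto
  ultimately have "\<forall>\<^sub>F v in nhds v0. v \<in> - (\<phi> ` S) \<inter> ball v0 1"
    by (intro eventually_nhds_in_open) auto
  then have "\<forall>\<^sub>F v in at v0 within - K. v \<notin> \<phi> ` S \<and> dist v0 v < 1 \<and> v \<notin> K"
    unfolding eventually_at_filter by eventually_elim auto
  then show "\<forall>\<^sub>F v in at v0 within - K. dist (norm (\<psi> v)) 1 < e"
  proof eventually_elim
    case (elim v)
    have "norm v < norm v0 + 1" using elim norm_triangle_ineq2[of v v0] by (simp add: dist_norm norm_minus_commute)
    then have "norm (\<psi> v) < R" using R[of "\<psi> v"] \<phi>_\<psi>[of v] elim by force
    then have "norm (\<psi> v) < 1 + e"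
      using elim \<phi>_\<psi>[of v] imageI[of "\<psi> v" S \<phi>] by (cases "norm (\<psi> v) < 1 + e") (auto simp: S_def)
    then show ?case using norm_\<psi>[of v] elim by (simp add: dist_real_def)
  qed
qed

text \<open>Here \<open>A w / w\<close> is the extended symbol at the point 1 / w. Once q = 1, the
  inverse of \<open>\<phi>\<close> sends it to 1 / w, and applying \<open>\<phi>\<close> identifies
  the two maps.\<close>

lemma exterior_map_unique:
  assumes A: "continuous_on (cball 0 1) A" "A holomorphic_on ball 0 1" "A 0 = of_real a" and a: "c \<le> a"
    and AK: "\<And>w. norm w = 1 \<Longrightarrow> A w / w \<in> K"
    and w: "norm w < 1" "w \<noteq> 0"
  shows "\<phi> (1 / w) = A w / w"
proof -
  define F where "F = (\<lambda>w. A w / w)"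
  have a0: "a > 0" using a c_pos by simp
  have contF: "continuous_on (cball 0 1 - {0}) F"
    unfolding F_def by (intro continuous_intros continuous_on_subset[OF A(1)]) auto
  have holF: "F holomorphic_on ball 0 1 - {0}"
    unfolding F_def by (intro holomorphic_intros holomorphic_on_subset[OF A(2)]) auto
  have A0: "(A \<longlongrightarrow> of_real a) (at 0)"
  proof -
    have "isCont A 0"
      using continuous_on_interior[OF holomorphic_on_imp_continuous_on[OF A(2)], of 0] by simp
    then show ?thesis using A(3) by (simp add: isCont_def)
  qed
  have F0: "filterlim F at_infinity (at 0)"
    unfolding F_def using a0
    by (intro filterlim_divide_at_infinity[OF A0]) (auto intro: tendsto_eq_intros simp: filterlim_at eventually_at_filter)
  \<comment> \<open>The true value of F at 0 is infinity, which lies outside \<open>K\<close>; 0 is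
    therefore included explicitly, \<open>F 0\<close> being only a default value.\<close>
  define U where "U = {w \<in> ball 0 1. w = 0 \<or> F w \<notin> K}"
  \<comment> \<open>The value a / c is the limit at 0, seen from w \<psi>(F w) = A w * (\<psi>(F w)
    / F w).\<close>
  define q where "q = (\<lambda>w. if w = 0 then of_real (a / c) else w * \<psi> (F w))"
  have FK: "\<forall>\<^sub>F w in at 0. F w \<notin> K"
    using F0 eventually_notin_K by (auto simp: filterlim_iff)
  have open1: "open (U - {0})"
  proof -
    have "open ((ball 0 1 - {0}) \<inter> F -` (- K))"
      by (intro continuous_open_preimage holomorphic_on_imp_continuous_on[OF holF] open_compl_K) (auto simp: open_delete)
    also have "(ball 0 1 - {0}) \<inter> F -` (- K) = U - {0}" by (auto simp: U_def)
    finally show ?thesis .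
  qed
  have "open U"
  proof -
    from FK obtain d where d: "d > 0" "\<And>w. w \<noteq> 0 \<Longrightarrow> dist w 0 < d \<Longrightarrow> F w \<notin> K"
      unfolding eventually_at by auto
    have "U = (U - {0}) \<union> ball 0 (min d 1)" using d by (auto simp: U_def)
    then show ?thesis using open1 by (metis open_Un open_ball)
  qed
  have "q holomorphic_on U"
  proof (rule no_isolated_singularity[of _ _ "{0}"])
    have "(\<lambda>w. w * \<psi> (F w)) holomorphic_on U - {0}"
      by (intro holomorphic_intros holomorphic_on_compose_gen[OF _ \<psi>_holomorphic, unfolded o_def]
          holomorphic_on_subset[OF holF]) (auto simp: U_def)
    then show hq: "q holomorphic_on U - {0}"
      by (rule holomorphic_transform) (auto simp: q_def)
    show "continuous_on U q"
      unfolding continuous_on_eq_continuous_at[OF \<open>open U\<close>]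
    proof
      fix w assume w: "w \<in> U"
      show "isCont q w"
      proof (cases "w = 0")
        case True
        have "((\<lambda>w. A w * (\<psi> (F w) / F w)) \<longlongrightarrow> of_real a * (1 / of_real c)) (at 0)"
          by (intro tendsto_intros A0 filterlim_compose[OF \<psi>_div F0])
        moreover have "\<forall>\<^sub>F w in at 0. A w * (\<psi> (F w) / F w) = q w"
        proof -
          have "\<forall>\<^sub>F w in at 0. A w \<noteq> 0" using A0 a0 by (intro tendsto_imp_eventually_ne) auto
          moreover have "\<forall>\<^sub>F w in at (0::complex). w \<noteq> 0" by (simp add: eventually_at_filter)
          ultimately show ?thesis by eventually_elim (simp add: q_def F_def)
        qed
        ultimately have "(q \<longlongrightarrow> of_real a * (1 / of_real c)) (at 0)"
          by (rule Lim_transform_eventually)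
        then show ?thesis by (simp add: True isCont_def q_def)
      next
        case False
        then show ?thesis using w open1
          by (intro continuous_on_interior[OF holomorphic_on_imp_continuous_on[OF hq]]) (simp add: interior_open)
      qed
    qed
  qed (use \<open>open U\<close> in auto)
  moreover have "((\<lambda>w. norm (q w)) \<longlongrightarrow> norm w0) (at w0 within U)" if w0: "norm w0 \<le> 1" "w0 \<notin> U" for w0
  proof -
    have nz: "w0 \<noteq> 0" using w0 by (auto simp: U_def)
    \<comment> \<open>Both kinds of point outside U end in \<open>K\<close>: those on the circle by
      hypothesis, those inside by the definition of U. So |\<psi>(F w)| tends to 1 and |q w| to
      |w0|.\<close>
    have K0: "F w0 \<in> K" using AK[of w0] w0 nz by (cases "norm w0 = 1") (auto simp: U_def F_def)
    have sub: "U - {0} \<subseteq> cball 0 1 - {0}" by (auto simp: U_def)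
    have ev: "\<forall>\<^sub>F w in at w0 within U. w \<in> U - {0}"
      using nz unfolding eventually_at_filter
      by (intro eventually_mono[OF t1_space_nhds[of w0 0]]) auto
    have "(F \<longlongrightarrow> F w0) (at w0 within (cball 0 1 - {0}))"
      using contF w0 nz by (simp add: continuous_on_def)
    then have "(F \<longlongrightarrow> F w0) (at w0 within (U - {0}))" by (rule tendsto_within_subset) (rule sub)
    then have tF: "(F \<longlongrightarrow> F w0) (at w0 within U)"
      using nz by (subst (asm) at_within_nhd[of w0 "- {0}" _ U]) auto
    have "\<forall>\<^sub>F w in at w0 within U. F w \<in> - K \<and> F w \<noteq> F w0"
      using ev by eventually_elim (use K0 in \<open>auto simp: U_def\<close>)
    with tF have "filterlim F (at (F w0) within - K) (at w0 within U)"
      by (auto simp: filterlim_at elim: eventually_mono)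
    from filterlim_compose[OF norm_\<psi>_tendsto[OF K0] this]
    have "((\<lambda>w. norm w * norm (\<psi> (F w))) \<longlongrightarrow> norm w0 * 1) (at w0 within U)"
      by (intro tendsto_intros) 
    moreover have "\<forall>\<^sub>F w in at w0 within U. norm w * norm (\<psi> (F w)) = norm (q w)"
      using ev by eventually_elim (simp add: q_def norm_mult)
    ultimately show ?thesis using Lim_transform_eventually by fastforce
  qed
  moreover have "1 \<le> norm (q 0)" using a c_pos by (simp add: q_def norm_divide)
  moreover have "U \<subseteq> ball 0 1" "0 \<in> U" by (auto simp: U_def)
  ultimately have Ueq: "U = ball 0 1" and q0: "norm (q 0) = 1" and const: "\<And>w. w \<in> U \<Longrightarrow> q w = q 0"
    using max_modulus_disc[of U q] \<open>open U\<close> by blast+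
  \<comment> \<open>The value a / c is a positive real number of modulus 1.\<close>
  have "q 0 = 1" using q0 a0 c_pos by (simp add: q_def norm_divide)
  moreover have wU: "w \<in> U" using w Ueq by simp
  ultimately have "w * \<psi> (F w) = 1" using const[of w] w by (simp add: q_def)
  then have "\<psi> (F w) = 1 / w" using w by (simp add: field_simps)
  then show ?thesis using \<phi>_\<psi>[of "F w"] wU w by (auto simp: U_def F_def)
qed

end

subsection \<open>A lower bound for the capacity\<close>

context exterior_map
begin

text \<open>By injectivity the function w (\<phi>(1/w) - \<phi> z), which has value c at 0, has no
  zero in |w| < 1/|z|. It has a holomorphic logarithm there, whose real part has mean ln c over |w|
  = r; the factor w accounts for ln r.\<close>

lemma ln_dist_mean:
  assumes "0 < r" "r * norm z < 1" "1 < norm z"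
  shows "integrable circle_measure (\<lambda>t. ln (norm (\<phi> z - \<phi> (1 / (of_real r * cis t)))))" (is "integrable _ ?f")
    and "(LINT t|circle_measure. ln (norm (\<phi> z - \<phi> (1 / (of_real r * cis t))))) = ln c - ln r"
proof -
  define R where "R = 1 / norm z"
  have z0: "0 < norm z" using assms by linarith
  have R: "r < R" "R < 1" using assms z0 by (auto simp: R_def pos_less_divide_eq)
  have hol: "(\<lambda>w. H w - w * \<phi> z) holomorphic_on ball 0 R"
    using R by (intro holomorphic_intros holomorphic_on_subset[OF H_holomorphic]) auto
  have nz: "H w - w * \<phi> z \<noteq> 0" if "w \<in> ball 0 R" for w
  proof (cases "w = 0")
    case False
    have "norm w * norm z < 1" using that z0 by (simp add: R_def pos_less_divide_eq)
    then have z: "norm z < norm (1 / w)" using False by (simp add: norm_divide field_simps)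
    then have "\<phi> (1 / w) \<noteq> \<phi> z" using inj[of "1 / w" z] assms by auto
    then show ?thesis using False by (simp add: H_def)
  qed (use c_pos in auto)
  have "r > 0" "0 \<in> ball (0::complex) R" using R assms by auto
  then obtain g where g: "g holomorphic_on ball 0 R" "\<And>w. w \<in> ball 0 R \<Longrightarrow> exp (g w) = H w - w * \<phi> z"
    using holomorphic_logarithm_exists[OF _ _ hol nz] by (metis convex_ball open_ball)
  have nr: "norm (complex_of_real r) < R" using R assms by simp
  have mean: "(LINT t|circle_measure. g (of_real r * cis t)) = g 0"
    by (rule circle_mean_value[OF g(1) nr])
  have eq: "?f t = Re (g (of_real r * cis t)) - ln r" for t
  proof -
    let ?w = "of_real r * cis t"
    have w: "?w \<in> ball 0 R" "?w \<noteq> 0" using R assms by (auto simp: norm_mult)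
    have "r * norm (\<phi> z - \<phi> (1 / ?w)) = norm (?w * (\<phi> (1 / ?w) - \<phi> z))"
      using assms by (simp add: norm_mult norm_minus_commute)
    also have "?w * (\<phi> (1 / ?w) - \<phi> z) = exp (g ?w)"
      unfolding g(2)[OF w(1)] using w(2) by (simp add: H_def algebra_simps)
    also have "norm \<dots> = exp (Re (g ?w))" by simp
    finally have e: "r * norm (\<phi> z - \<phi> (1 / ?w)) = exp (Re (g ?w))" .
    then have "norm (\<phi> z - \<phi> (1 / ?w)) \<noteq> 0" by auto
    then have "ln r + ?f t = Re (g ?w)" using e assms by (metis ln_exp ln_mult_pos zero_less_norm_iff norm_eq_zero)
    then show ?thesis by simp
  qed
  have "continuous_on (sphere 0 r) g"
    using R by (intro continuous_on_subset[OF holomorphic_on_imp_continuous_on[OF g(1)]]) auto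
  then have "bounded (g ` sphere 0 r)"
    by (intro compact_imp_bounded compact_continuous_image) auto
  then obtain B where B: "\<And>w. norm w = r \<Longrightarrow> norm (g w) \<le> B" by (force simp: bounded_iff)
  have int: "integrable circle_measure (\<lambda>t. g (of_real r * cis t))"
    using holomorphic_measurable_circle[OF g(1) nr] B assms
    by (intro circle_integrable_bounded[where B = B]) (auto simp: norm_mult)
  show "integrable circle_measure ?f" unfolding eq using int by auto
  have g0: "Re (g 0) = ln c"
  proof -
    have "exp (Re (g 0)) = norm (exp (g 0))" by simp
    also have "\<dots> = c" using g(2)[of 0] R assms c_pos by simp
    finally show ?thesis using c_pos by (metis ln_exp)
  qed
  show "(LINT t|circle_measure. ?f t) = ln c - ln r"
    unfolding eq using int mean g0 by (simp add: integral_Re)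
qed

text \<open>Otherwise \<open>\<psi>\<close> would be continuous at v and have modulus 1 there, but
  off \<open>K\<close> its modulus exceeds 1.\<close>

lemma boundary_limit_in_K:
  assumes z: "\<And>j. 1 < norm (z j)" "(\<lambda>j. norm (z j)) \<longlonglongrightarrow> 1" and v: "(\<lambda>j. \<phi> (z j)) \<longlonglongrightarrow> v"
  shows "v \<in> K"
proof (rule ccontr)
  assume "v \<notin> K"
  then have "(\<lambda>j. \<psi> (\<phi> (z j))) \<longlonglongrightarrow> \<psi> v"
    using notin_K z by (intro continuous_on_tendsto_compose[OF holomorphic_on_imp_continuous_on[OF \<psi>_holomorphic] v]) auto
  then have "(\<lambda>j. norm (z j)) \<longlonglongrightarrow> norm (\<psi> v)" by (simp add: \<psi>_\<phi> z tendsto_norm)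
  then have "norm (\<psi> v) = 1" using z(2) LIMSEQ_unique by blast
  with norm_\<psi>[OF \<open>v \<notin> K\<close>] show False by simp
qed

text \<open>The radial limit theorem applies to \<open>H\<close>, which is bounded on the whole
  disc; dividing by w returns to \<open>\<phi>\<close>. \<open>X j\<close> is \<open>\<phi>\<close>
  on the circle of radius 1 / \<rho> j, and these circles shrink to the unit circle from
  outside.\<close>

lemma radial_limits:
  obtains X :: "nat \<Rightarrow> real \<Rightarrow> complex" and \<Phi> \<rho> B where
    "\<And>j t. X j t = \<phi> (1 / (of_real (\<rho> j) * cis t))"
    "\<And>j. 0 < \<rho> j" "\<And>j. \<rho> j < 1" "\<And>j. \<rho> j < \<rho> (Suc j)" "\<rho> \<longlonglongrightarrow> 1"
    "\<And>j. X j \<in> borel_measurable borel" "\<Phi> \<in> borel_measurable borel"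
    "AE t in circle_measure. (\<lambda>j. X j t) \<longlonglongrightarrow> \<Phi> t"
    "AE t in circle_measure. \<Phi> t \<in> K"
    "\<And>j t. norm (X j t) \<le> B"
proof -
  have "bounded (H ` cball 0 (1/2))"
    by (intro compact_imp_bounded compact_continuous_image
        continuous_on_subset[OF holomorphic_on_imp_continuous_on[OF H_holomorphic]]) auto
  then obtain B1 where B1: "\<And>w. norm w \<le> 1/2 \<Longrightarrow> norm (H w) \<le> B1" by (force simp: bounded_iff)
  obtain B2 where B2: "\<And>z. 1 < norm z \<Longrightarrow> norm z \<le> 2 \<Longrightarrow> norm (\<phi> z) \<le> B2" using \<phi>_bounded by blast
  have HB: "norm (H w) \<le> max B1 B2" if w: "norm w < 1" for w
  proof (cases "norm w \<le> 1/2")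
    case False
    then have nz: "w \<noteq> 0" by auto
    have "norm (\<phi> (1 / w)) \<le> B2" using False w nz by (intro B2) (auto simp: norm_divide field_simps)
    then have "norm (H w) \<le> norm w * B2" using nz by (simp add: H_def norm_mult mult_left_mono)
    also have "\<dots> \<le> 1 * B2" using w order_trans[OF norm_ge_zero B2[of 2]] by (intro mult_right_mono) auto
    finally show ?thesis by simp
  qed (use B1[of w] in auto)
  obtain \<rho> where \<rho>: "\<And>j. 0 < \<rho> j" "\<And>j. \<rho> j < 1" "\<And>j. \<rho> j < \<rho> (Suc j)" "\<rho> \<longlonglongrightarrow> 1"
    "AE t in circle_measure. convergent (\<lambda>j. H (of_real (\<rho> j) * cis t))"
    using bounded_holomorphic_radial_limits[OF H_holomorphic HB] by blast
  define X where "X = (\<lambda>j t. \<phi> (1 / (of_real (\<rho> j) * cis t)))"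
  define \<Phi> where "\<Phi> = (\<lambda>t. lim (\<lambda>j. X j t))"
  have XH: "X j t = H (of_real (\<rho> j) * cis t) / (of_real (\<rho> j) * cis t)" for j t
    using \<rho>(1)[of j] by (simp add: X_def \<phi>_eq_H)
  have meas[measurable]: "X j \<in> borel_measurable borel" for j
  proof -
    have [measurable]: "(\<lambda>t. H (of_real (\<rho> j) * cis t)) \<in> borel_measurable borel"
      by (rule holomorphic_measurable_circle[OF H_holomorphic]) (use \<rho>(1,2)[of j] in auto)
    have "(\<lambda>t. H (of_real (\<rho> j) * cis t) / (of_real (\<rho> j) * cis t)) \<in> borel_measurable borel" by measurable
    then show ?thesis by (simp add: XH[abs_def])
  qed
  have m\<Phi>: "\<Phi> \<in> borel_measurable borel" unfolding \<Phi>_def by measurable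
  have AE1: "AE t in circle_measure. (\<lambda>j. X j t) \<longlonglongrightarrow> \<Phi> t"
    using \<rho>(5)
  proof eventually_elim
    case (elim t)
    then obtain l where l: "(\<lambda>j. H (of_real (\<rho> j) * cis t)) \<longlonglongrightarrow> l" by (auto simp: convergent_def)
    have "(\<lambda>j. H (of_real (\<rho> j) * cis t) / (of_real (\<rho> j) * cis t)) \<longlonglongrightarrow> l / (of_real 1 * cis t)"
      by (intro tendsto_intros l \<rho>) auto
    then have "convergent (\<lambda>j. X j t)" unfolding XH[symmetric] by (auto simp: convergent_def)
    then show ?case by (simp add: \<Phi>_def convergent_LIMSEQ_iff)
  qed
  have AE2: "AE t in circle_measure. \<Phi> t \<in> K"
    using AE1
  proof eventually_elim
    case (elim t)
    have n: "norm (1 / (of_real (\<rho> j) * cis t)) = 1 / \<rho> j" for j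
      using \<rho>(1)[of j] by (simp add: norm_divide norm_mult)
    show ?case
    proof (rule boundary_limit_in_K)
      show "1 < norm (1 / (of_real (\<rho> j) * cis t))" for j unfolding n using \<rho>(1,2)[of j] by simp
      have "(\<lambda>j. 1 / \<rho> j) \<longlonglongrightarrow> 1 / 1" by (intro tendsto_intros \<rho>) auto
      then show "(\<lambda>j. norm (1 / (of_real (\<rho> j) * cis t))) \<longlonglongrightarrow> 1" unfolding n by simp
      show "(\<lambda>j. \<phi> (1 / (of_real (\<rho> j) * cis t))) \<longlonglongrightarrow> \<Phi> t" using elim by (simp add: X_def)
    qed
  qed
  obtain B where B: "\<And>z. 1 < norm z \<Longrightarrow> norm z \<le> 1 / \<rho> 0 \<Longrightarrow> norm (\<phi> z) \<le> B" using \<phi>_bounded by blast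
  have "\<rho> 0 \<le> \<rho> j" for j by (rule lift_Suc_mono_le[of \<rho>]) (use \<rho>(3) less_imp_le in auto)
  then have XB: "norm (X j t) \<le> B" for j t
    unfolding X_def using \<rho>(1,2)[of j] \<rho>(1)[of 0]
    by (intro B) (auto simp: norm_divide norm_mult frac_le)
  show ?thesis
    using that[of X \<rho> \<Phi> B] X_def \<rho> meas m\<Phi> AE1 AE2 XB by blast
qed

end

section \<open>Logarithmic energy on product spaces and comparison with the capacity\<close>

lemma AE_pair_measure_both:
  assumes "sigma_finite_measure M" "AE x in M. P x"
  shows "AE p in M \<Otimes>\<^sub>M M. P (fst p) \<and> P (snd p)"
proof -
  interpret pair_sigma_finite M M using assms(1) by (simp add: pair_sigma_finite_def)
  obtain N where N: "N \<in> null_sets M" "{x\<in>space M. \<not> P x} \<subseteq> N"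
    using assms(2) by (auto elim!: AE_E)
  have [measurable]: "N \<in> sets M" using N by auto
  have "AE x in M. x \<notin> N" using N by (auto intro: AE_not_in)
  then have "AE x in M. AE y in M. fst (x, y) \<notin> N \<and> snd (x, y) \<notin> N"
  proof eventually_elim
    case (elim x)
    then show ?case using \<open>AE x in M. x \<notin> N\<close> by simp
  qed
  then have "AE p in M \<Otimes>\<^sub>M M. fst p \<notin> N \<and> snd p \<notin> N"
    by (intro AE_pair_measure) auto
  then show ?thesis
    using AE_space by eventually_elim (use N in \<open>auto simp: space_pair_measure\<close>)
qed

text \<open>The capacity uses an infimum of real numbers, which lies below its members only if the
  energies are bounded below.\<close>

lemma log_energy_bdd_below:
  assumes "compact K"
  obtains m where "\<And>\<nu>. prob_space \<nu> \<Longrightarrow> sets \<nu> = sets borel \<Longrightarrow> emeasure \<nu> K = 1 \<Longrightarrow> finite_log_energy \<nu> \<Longrightarrow> m \<le> log_energy \<nu>"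
proof -
  obtain B where B: "\<And>z. z \<in> K \<Longrightarrow> norm z \<le> B" using compact_imp_bounded[OF assms] by (auto simp: bounded_iff)
  \<comment> \<open>2 B bounds the distance of two points of \<open>K\<close>; C \<ge> 1 covers the
    diagonal, where the kernel has the default value 0.\<close>
  define C where "C = max 1 (2 * B)"
  have "- ln C \<le> log_energy \<nu>"
    if \<nu>: "prob_space \<nu>" "sets \<nu> = sets borel" "emeasure \<nu> K = 1" "finite_log_energy \<nu>" for \<nu>
  proof -
    interpret prob_space \<nu> by fact
    interpret pair_prob_space \<nu> \<nu> ..
    have "AE z in \<nu>. z \<in> K" using \<nu>(3) by (intro prob_space.AE_prob_1[OF \<nu>(1)]) (simp add: measure_def)
    then have AEK: "AE p in \<nu> \<Otimes>\<^sub>M \<nu>. fst p \<in> K \<and> snd p \<in> K"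
      by (intro AE_pair_measure_both) unfold_locales
    have "(LINT p|(\<nu> \<Otimes>\<^sub>M \<nu>). - ln C) \<le> log_energy \<nu>"
      unfolding log_energy_def
    proof (rule integral_mono_AE)
      show "AE p in \<nu> \<Otimes>\<^sub>M \<nu>. - ln C \<le> (case p of (z, w) \<Rightarrow> ln (1 / cmod (z - w)))"
        using AEK
      proof eventually_elim
        case (elim p)
        obtain z w where p: "p = (z, w)" by force
        have "norm (z - w) \<le> C" using norm_triangle_ineq4[of z w] B[of z] B[of w] elim p by (auto simp: C_def)
        then have "ln (norm (z - w)) \<le> ln C"
          by (cases "z = w") (auto simp: C_def intro!: ln_mono)
        then show ?case unfolding p by (cases "z = w") (auto simp: ln_div C_def)
      qed
      show "integrable (\<nu> \<Otimes>\<^sub>M \<nu>) (\<lambda>(z, w). ln (1 / cmod (z - w)))"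
        using \<nu>(4) by (simp add: finite_log_energy_def)
    qed auto
    then show ?thesis by (simp add: P.prob_space)
  qed
  with that show ?thesis by blast
qed

text \<open>
  The competitor is the image of the uniform measure under the boundary values of \<open>\<phi>\<close>. Its energy
  is bounded by Fatou's lemma along circles of different radii \<open>\<rho> j < \<rho> (j + 1)\<close>, which keeps
  the approximating kernels nonsingular.
\<close>

lemma (in exterior_map) log_capacity_ge: "c \<le> log_capacity K"
proof -
  obtain X :: "nat \<Rightarrow> real \<Rightarrow> complex" and \<Phi> \<rho> B where
    X: "\<And>j t. X j t = \<phi> (1 / (of_real (\<rho> j) * cis t))" and
    \<rho>: "\<And>j. 0 < \<rho> j" "\<And>j. \<rho> j < 1" "\<And>j. \<rho> j < \<rho> (Suc j)" "\<rho> \<longlonglongrightarrow> 1" and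
    meas[measurable]: "\<And>j. X j \<in> borel_measurable borel" "\<Phi> \<in> borel_measurable borel" and
    lim: "AE t in circle_measure. (\<lambda>j. X j t) \<longlonglongrightarrow> \<Phi> t" and
    \<Phi>K: "AE t in circle_measure. \<Phi> t \<in> K" and
    B: "\<And>j t. norm (X j t) \<le> B"
    by (rule radial_limits) (rule that, assumption+)
  \<comment> \<open>Scaling distances by b, which bounds them all, makes the kernel nonnegative, as
    Fatou's lemma requires; the scaling only adds ln b to the energy.\<close>
  define b where "b = 2 * (B + 1)"
  have b0: "b > 0" using order_trans[OF norm_ge_zero B[of 0 0]] by (simp add: b_def)
  interpret PP: pair_prob_space circle_measure circle_measure ..
  let ?PP = "circle_measure \<Otimes>\<^sub>M circle_measure"
  have Xb: "norm (X i s - X j t) \<le> b" for i j s t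
    using norm_triangle_ineq4[of "X i s" "X j t"] B[of i s] B[of j t] by (simp add: b_def)
  have nX: "norm (1 / (of_real (\<rho> j) * cis t)) = 1 / \<rho> j" for j t
    using \<rho>(1)[of j] by (simp add: norm_divide norm_mult)
  have Xne: "X (Suc j) s \<noteq> X j t" for j s t
  proof
    assume "X (Suc j) s = X j t"
    have n: "1 < norm (1 / (of_real (\<rho> i) * cis t))" for i t
      unfolding nX using \<rho>(1,2)[of i] by simp
    have "1 / (of_real (\<rho> (Suc j)) * cis s) = 1 / (of_real (\<rho> j) * cis t)"
      by (rule inj[OF \<open>X (Suc j) s = X j t\<close>[unfolded X] n n])
    then have "norm (1 / (of_real (\<rho> (Suc j)) * cis s)) = norm (1 / (of_real (\<rho> j) * cis t))"
      by (rule arg_cong)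
    then have "1 / \<rho> (Suc j) = 1 / \<rho> j" unfolding nX .
    with \<rho>(3)[of j] show False by simp
  qed
  define k where "k = (\<lambda>j p. ennreal (ln (b / norm (X (Suc j) (fst p) - X j (snd p)))))"
  have kmeas[measurable]: "k j \<in> borel_measurable ?PP" for j unfolding k_def by measurable
  \<comment> \<open>For every s the point on circle j + 1 lies strictly between the unit circle and
    circle j, so the inner integral is given by \<open>ln_dist_mean\<close> and does not depend on
    s.\<close>
  have kint: "(\<integral>\<^sup>+ p. k j p \<partial>?PP) = ennreal (ln b - (ln c - ln (\<rho> j)))" for j
  proof -
    have "(\<integral>\<^sup>+ p. k j p \<partial>?PP) = (\<integral>\<^sup>+ s. (\<integral>\<^sup>+ t. k j (s, t) \<partial>circle_measure) \<partial>circle_measure)"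
      by (rule circle.nn_integral_fst[symmetric]) measurable
    also have "\<dots> = (\<integral>\<^sup>+ s. ennreal (ln b - (ln c - ln (\<rho> j))) \<partial>circle_measure)"
    proof (intro nn_integral_cong)
      fix s
      let ?z = "1 / (of_real (\<rho> (Suc j)) * cis s)"
      have a: "0 < \<rho> j" "\<rho> j * norm ?z < 1" "1 < norm ?z"
        unfolding nX using \<rho>(1,2)[of "Suc j"] \<rho>(1,3)[of j] by auto
      note mean = ln_dist_mean[OF a, folded X]
      have "k j (s, t) = ennreal (ln b - ln (norm (X (Suc j) s - X j t)))" for t
        using Xne[of j s t] b0 by (simp add: k_def ln_div)
      then have "(\<integral>\<^sup>+ t. k j (s, t) \<partial>circle_measure) = 
          (\<integral>\<^sup>+ t. ennreal (ln b - ln (norm (X (Suc j) s - X j t))) \<partial>circle_measure)"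
        by simp
      also have "\<dots> = ennreal (LINT t|circle_measure. ln b - ln (norm (X (Suc j) s - X j t)))"
        using mean(1) Xne b0 Xb by (intro nn_integral_eq_integral) auto
      also have "(LINT t|circle_measure. ln b - ln (norm (X (Suc j) s - X j t))) = ln b - (ln c - ln (\<rho> j))"
        using mean by simp
      finally show "(\<integral>\<^sup>+ t. k j (s, t) \<partial>circle_measure) = ennreal (ln b - (ln c - ln (\<rho> j)))" .
    qed
    also have "\<dots> = ennreal (ln b - (ln c - ln (\<rho> j)))"
      using circle.emeasure_space_1 by simp
    finally show ?thesis .
  qed
  have "(\<lambda>j. ennreal (ln b - (ln c - ln (\<rho> j)))) \<longlonglongrightarrow> ennreal (ln b - (ln c - ln 1))"
    by (intro tendsto_ennrealI tendsto_intros \<rho>) auto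
  then have lim_kint: "liminf (\<lambda>j. \<integral>\<^sup>+ p. k j p \<partial>?PP) = ennreal (ln b - ln c)"
    unfolding kint by (simp add: lim_imp_Liminf)
  have fatou: "(\<integral>\<^sup>+ p. liminf (\<lambda>j. k j p) \<partial>?PP) \<le> ennreal (ln b - ln c)"
    using nn_integral_liminf[of k ?PP] lim_kint by simp
  have fin: "AE p in ?PP. liminf (\<lambda>j. k j p) \<noteq> \<infinity>"
    using fatou by (intro nn_integral_PInf_AE) (auto simp: top_unique)
  have "AE t in circle_measure. (\<lambda>j. X j t) \<longlonglongrightarrow> \<Phi> t \<and> \<Phi> t \<in> K"
    using lim \<Phi>K by eventually_elim simp
  from AE_pair_measure_both[OF circle.sigma_finite_measure_axioms this]
  have AEp: "AE p in ?PP. ((\<lambda>j. X j (fst p)) \<longlonglongrightarrow> \<Phi> (fst p) \<and> \<Phi> (fst p) \<in> K) \<and>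
        ((\<lambda>j. X j (snd p)) \<longlonglongrightarrow> \<Phi> (snd p) \<and> \<Phi> (snd p) \<in> K)" .
  define e where "e = (\<lambda>p. ln (b / norm (\<Phi> (fst p) - \<Phi> (snd p))))"
  have [measurable]: "e \<in> borel_measurable ?PP" unfolding e_def by measurable
  have AEe: "AE p in ?PP. \<Phi> (fst p) \<noteq> \<Phi> (snd p) \<and> 0 \<le> e p \<and> ennreal (e p) = liminf (\<lambda>j. k j p)"
    using AEp fin
  proof eventually_elim
    case (elim p)
    then have X1: "(\<lambda>j. X (Suc j) (fst p)) \<longlonglongrightarrow> \<Phi> (fst p)" and X2: "(\<lambda>j. X j (snd p)) \<longlonglongrightarrow> \<Phi> (snd p)"
      using LIMSEQ_Suc[of "\<lambda>j. X j (fst p)"] by auto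
    then have t: "(\<lambda>j. norm (X (Suc j) (fst p) - X j (snd p))) \<longlonglongrightarrow> norm (\<Phi> (fst p) - \<Phi> (snd p))"
      by (intro tendsto_intros)
    \<comment> \<open>Coinciding boundary values would make the kernels tend to infinity, which the
      finite lower limit excludes. This is the null diagonal demanded by finite energy.\<close>
    have ne: "\<Phi> (fst p) \<noteq> \<Phi> (snd p)"
    proof
      assume eq: "\<Phi> (fst p) = \<Phi> (snd p)"
      have "filterlim (\<lambda>j. norm (X (Suc j) (fst p) - X j (snd p))) (at_right 0) sequentially"
        using t eq Xne by (auto simp: filterlim_at)
      then have "filterlim (\<lambda>j. b / norm (X (Suc j) (fst p) - X j (snd p))) at_top sequentially"
        using b0 by (intro filterlim_compose[OF _ \<open>filterlim _ (at_right 0) _\<close>, of "\<lambda>x. b / x"]) real_asymp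
      then have "filterlim (\<lambda>j. ln (b / norm (X (Suc j) (fst p) - X j (snd p)))) at_top sequentially"
        by (rule filterlim_compose[OF ln_at_top])
      then have "(\<lambda>j. k j p) \<longlonglongrightarrow> \<infinity>"
        unfolding k_def by (simp add: ennreal_tendsto_top_eq_at_top)
      then have "liminf (\<lambda>j. k j p) = \<infinity>" by (intro lim_imp_Liminf) auto
      with elim show False by simp
    qed
    have "(\<lambda>j. k j p) \<longlonglongrightarrow> ennreal (e p)"
      unfolding k_def e_def using ne b0 by (intro tendsto_ennrealI tendsto_intros t) auto
    then have "ennreal (e p) = liminf (\<lambda>j. k j p)" by (simp add: lim_imp_Liminf)
    moreover have "norm (\<Phi> (fst p) - \<Phi> (snd p)) \<le> b"
      by (rule LIMSEQ_le_const2[OF t]) (use Xb in auto)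
    then have "0 \<le> e p" unfolding e_def using ne b0 by simp
    ultimately show ?case using ne by simp
  qed
  have nne: "(\<integral>\<^sup>+ p. ennreal (e p) \<partial>?PP) \<le> ennreal (ln b - ln c)"
    using fatou AEe by (subst nn_integral_cong_AE[where v = "\<lambda>p. liminf (\<lambda>j. k j p)"]) auto
  have inte: "integrable ?PP e"
    using AEe nne by (intro integrableI_nonneg) (auto intro: le_less_trans)
  \<comment> \<open>\<open>ennreal\<close> truncates negative numbers to 0, so the bound can be read
    as a real inequality only after this.\<close>
  have "0 \<le> ln b - ln c"
  proof -
    let ?z = "1 / (of_real (\<rho> 1) * cis 0)"
    have a: "0 < \<rho> 0" "\<rho> 0 * norm ?z < 1" "1 < norm ?z"
      unfolding nX using \<rho>(1,2)[of 1] \<rho>(1,3)[of 0] by auto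
    note mean = ln_dist_mean[OF a, folded X]
    have "0 \<le> (LINT t|circle_measure. ln b - ln (norm (X 1 0 - X 0 t)))"
    proof (intro integral_nonneg_AE AE_I2)
      show "0 \<le> ln b - ln (norm (X 1 0 - X 0 t))" for t
        using Xne[of 0 0 t] b0 Xb[of 1 0 0 t] by auto
    qed
    also have "\<dots> = ln b - ln c + ln (\<rho> 0)" using mean by simp
    finally show ?thesis using \<rho>(1,2)[of 0] ln_le_zero_iff[of "\<rho> 0"] by linarith
  qed
  then have inte_le: "(LINT p|?PP. e p) \<le> ln b - ln c"
    using nne AEe by (subst integral_eq_nn_integral) (auto intro!: enn2real_leI)
  define \<nu> where "\<nu> = distr circle_measure borel \<Phi>"
  have prob: "prob_space \<nu>" unfolding \<nu>_def by (rule circle.prob_space_distr) simp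
  have sets\<nu>: "sets \<nu> = sets borel" by (simp add: \<nu>_def)
  have Kb[measurable]: "K \<in> sets borel" using compact_K by (simp add: borel_compact)
  have \<nu>K: "emeasure \<nu> K = 1"
  proof (rule prob_space.emeasure_eq_1_AE[OF prob])
    show "AE z in \<nu>. z \<in> K"
      unfolding \<nu>_def using \<Phi>K by (subst AE_distr_iff) auto
  qed (simp add: sets\<nu>)
  have \<nu>\<nu>: "\<nu> \<Otimes>\<^sub>M \<nu> = distr ?PP (borel \<Otimes>\<^sub>M borel) (\<lambda>(s, t). (\<Phi> s, \<Phi> t))"
    unfolding \<nu>_def using prob[unfolded \<nu>_def]
    by (intro pair_measure_distr) (auto simp: prob_space_imp_sigma_finite)
  have le: "ln (1 / norm (\<Phi> (fst p) - \<Phi> (snd p))) = e p - ln b" if "\<Phi> (fst p) \<noteq> \<Phi> (snd p)" for p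
    using that b0 by (simp add: e_def ln_div)
  have AEle: "AE p in ?PP. e p - ln b = ln (1 / norm (\<Phi> (fst p) - \<Phi> (snd p)))"
    using AEe by eventually_elim (simp add: le)
  have fe: "finite_log_energy \<nu>"
    unfolding finite_log_energy_def \<nu>\<nu>
  proof
    show "AE (z, w) in distr ?PP (borel \<Otimes>\<^sub>M borel) (\<lambda>(s, t). (\<Phi> s, \<Phi> t)). z \<noteq> w"
      by (subst AE_distr_iff) (use AEe in \<open>auto simp: case_prod_beta elim: eventually_mono\<close>)
    show "integrable (distr ?PP (borel \<Otimes>\<^sub>M borel) (\<lambda>(s, t). (\<Phi> s, \<Phi> t))) (\<lambda>(z, w). ln (1 / cmod (z - w)))"
    proof (subst integrable_distr_eq)
      have "integrable ?PP (\<lambda>p. e p - ln b)" using inte by auto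
      then show "integrable ?PP (\<lambda>p. case (case p of (s, t) \<Rightarrow> (\<Phi> s, \<Phi> t)) of (z, w) \<Rightarrow> ln (1 / cmod (z - w)))"
        using AEle by (subst integrable_cong_AE[where g = "\<lambda>p. e p - ln b"]) (auto simp: case_prod_beta elim: eventually_mono)
    qed auto
  qed
  have "log_energy \<nu> = (LINT p|?PP. (case (case p of (s, t) \<Rightarrow> (\<Phi> s, \<Phi> t)) of (z, w) \<Rightarrow> ln (1 / cmod (z - w))))"
    unfolding log_energy_def \<nu>\<nu> by (rule integral_distr) auto
  also have "\<dots> = (LINT p|?PP. e p - ln b)"
    by (rule integral_cong_AE) (use AEle in \<open>auto simp: case_prod_beta elim: eventually_mono\<close>)
  also have "\<dots> \<le> - ln c" using inte inte_le by (simp add: PP.P.prob_space)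
  finally have en: "log_energy \<nu> \<le> - ln c" .
  define M where "M = {\<nu>. prob_space \<nu> \<and> sets \<nu> = sets borel \<and> emeasure \<nu> K = 1 \<and> finite_log_energy \<nu>}"
  have \<nu>M: "\<nu> \<in> M" using prob sets\<nu> \<nu>K fe by (simp add: M_def)
  obtain m where "\<And>\<nu>. prob_space \<nu> \<Longrightarrow> sets \<nu> = sets borel \<Longrightarrow> emeasure \<nu> K = 1 \<Longrightarrow> finite_log_energy \<nu> \<Longrightarrow> m \<le> log_energy \<nu>"
    using log_energy_bdd_below[OF compact_K] by blast
  then have "bdd_below (log_energy ` M)" by (intro bdd_belowI2[of _ m]) (auto simp: M_def)
  then have "(INF \<nu>\<in>M. log_energy \<nu>) \<le> - ln c"
    using \<nu>M en by (intro cINF_lower2) auto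
  then have "ln c \<le> - (INF \<nu>\<in>M. log_energy \<nu>)" by simp
  then have "exp (ln c) \<le> exp (- (INF \<nu>\<in>M. log_energy \<nu>))" by (rule exp_mono)
  then show ?thesis
    using \<nu>M c_pos unfolding log_capacity_def M_def[symmetric] Let_def by auto
qed

section \<open>Operators on square-summable sequences\<close>

lemma coord_simps [simp]:
  "coord 0 i = 0" "coord (x + y) i = coord x i + coord y i" "coord (x - y) i = coord x i - coord y i"
  "coord (scaleC a x) i = a * coord x i" "coord (r *\<^sub>R x) i = of_real r * coord x i"
  "coord (backward_shift x) i = coord x (Suc i)" "coord (unit_vector j) i = of_bool (i = j)"
  by (simp_all add: zero_ell2.rep_eq plus_ell2.rep_eq minus_ell2.rep_eq scaleC.rep_eq scaleR_ell2.rep_eq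
      backward_shift.rep_eq unit_vector.rep_eq)

lemma coord_sum [simp]: "coord (sum f A) i = (\<Sum>j\<in>A. coord (f j) i)"
  by (induction A rule: infinite_finite_induct) auto

lemma coord_shift_funpow: "coord ((shift ^^ n) x) i = (if i < n then 0 else coord x (i - n))"
proof (induction n arbitrary: i)
  case (Suc n)
  then show ?case by (cases i) (auto simp: shift.rep_eq)
qed simp

lemma coord_backward_shift_funpow [simp]: "coord ((backward_shift ^^ n) x) i = coord x (i + n)"
  by (induction n arbitrary: i) auto

lemma norm_ell2_sums: "(\<lambda>i. (cmod (coord x i))\<^sup>2) sums (norm x)\<^sup>2"
proof -
  have "(norm x)\<^sup>2 = (\<Sum>i. (cmod (coord x i))\<^sup>2)"
    unfolding power2_norm_eq_inner by (simp add: inner_ell2_def power2_norm_eq_inner[symmetric])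
  then show ?thesis using summable_sums[OF summable_coord[of x]] by simp
qed

lemma sum_coord_le_norm: "(\<Sum>i<n. (cmod (coord x i))\<^sup>2) \<le> (norm x)\<^sup>2"
  using norm_ell2_sums[of x] sum_le_suminf[OF summable_coord[of x], of "{..<n}"] by (simp add: sums_iff)

lemma norm_ell2_leI:
  assumes "\<And>n. (\<Sum>i<n. (cmod (coord x i))\<^sup>2) \<le> C"
  shows "(norm x)\<^sup>2 \<le> C"
  using norm_ell2_sums[of x] suminf_le_const[OF summable_coord[of x] assms] by (simp add: sums_iff)

lemma cmod_coord_le_norm: "cmod (coord x i) \<le> norm x"
proof -
  have "(cmod (coord x i))\<^sup>2 \<le> (\<Sum>j<Suc i. (cmod (coord x j))\<^sup>2)"
    by (rule member_le_sum) auto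
  also have "\<dots> \<le> (norm x)\<^sup>2" by (rule sum_coord_le_norm)
  finally show ?thesis by (rule power2_le_imp_le) simp
qed

lemma norm_ell2_split: "(norm x)\<^sup>2 = (\<Sum>i<n. (cmod (coord x i))\<^sup>2) + (norm ((backward_shift ^^ n) x))\<^sup>2"
proof -
  have "(\<lambda>i. (cmod (coord x (i + n)))\<^sup>2) sums (norm ((backward_shift ^^ n) x))\<^sup>2"
    using norm_ell2_sums[of "(backward_shift ^^ n) x"] by simp
  then show ?thesis
    using suminf_split_initial_segment[OF summable_coord[of x], of n] norm_ell2_sums[of x] by (simp add: sums_iff)
qed

definition fin_vec :: "(nat \<Rightarrow> complex) \<Rightarrow> nat \<Rightarrow> ell2" where
  "fin_vec a N = (\<Sum>j<N. scaleC (a j) (unit_vector j))"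

lemma coord_fin_vec [simp]: "coord (fin_vec a N) i = (if i < N then a i else 0)"
proof -
  have "coord (fin_vec a N) i = (\<Sum>j<N. if i = j then a j else 0)"
    unfolding fin_vec_def by (auto intro!: sum.cong)
  then show ?thesis by simp
qed

lemma norm_eq_sum:
  assumes "\<And>i. i \<ge> N \<Longrightarrow> coord x i = 0"
  shows "(norm x)\<^sup>2 = (\<Sum>i<N. (cmod (coord x i))\<^sup>2)"
proof -
  have "(\<lambda>i. (cmod (coord x i))\<^sup>2) sums (\<Sum>i<N. (cmod (coord x i))\<^sup>2)"
    by (rule sums_finite) (use assms in auto)
  then show ?thesis using norm_ell2_sums sums_unique2 by blast
qed

lemma norm_unit_vector [simp]: "norm (unit_vector j) = 1"
proof -
  have "(norm (unit_vector j))\<^sup>2 = (\<Sum>i<Suc j. (cmod (of_bool (i = j)))\<^sup>2)"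
    by (subst norm_eq_sum[where N = "Suc j"]) auto
  also have "\<dots> = 1" by simp
  finally show ?thesis using norm_ge_zero[of "unit_vector j"] by (auto simp: power2_eq_1_iff)
qed

lemma bounded_linear_operator: "bounded_operator A \<Longrightarrow> bounded_linear A"
  by (simp add: bounded_operator_def)

lemma coord_operator_fin_vec:
  assumes A: "bounded_operator A"
  shows "coord (A (fin_vec a N)) i = (\<Sum>j<N. entry A i j * a j)"
proof -
  have "A (fin_vec a N) = (\<Sum>j<N. A (scaleC (a j) (unit_vector j)))"
    unfolding fin_vec_def by (rule linear_sum[OF bounded_linear.linear[OF bounded_linear_operator[OF A]]])
  also have "\<dots> = (\<Sum>j<N. scaleC (a j) (A (unit_vector j)))"
    using A by (simp add: bounded_operator_def)
  finally show ?thesis by (simp add: entry_def mult.commute)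
qed

lemma bounded_linear_shift_funpow: "bounded_linear (shift ^^ n)"
proof (rule bounded_linear_intro[where K = 1])
  fix x y r
  show "(shift ^^ n) (x + y) = (shift ^^ n) x + (shift ^^ n) y"
    "(shift ^^ n) (r *\<^sub>R x) = r *\<^sub>R (shift ^^ n) x"
    by (rule ell2_eqI, simp add: coord_shift_funpow)+
  have "(backward_shift ^^ n) ((shift ^^ n) x) = x"
    by (rule ell2_eqI) (simp add: coord_shift_funpow)
  then have "(norm ((shift ^^ n) x))\<^sup>2 = (norm x)\<^sup>2"
    using norm_ell2_split[of "(shift ^^ n) x" n] by (simp add: coord_shift_funpow)
  then show "norm ((shift ^^ n) x) \<le> norm x * 1" by simp
qed

lemma bounded_linear_backward_shift_funpow: "bounded_linear (backward_shift ^^ n)"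
proof (rule bounded_linear_intro[where K = 1])
  fix x y r
  show "(backward_shift ^^ n) (x + y) = (backward_shift ^^ n) x + (backward_shift ^^ n) y"
    "(backward_shift ^^ n) (r *\<^sub>R x) = r *\<^sub>R (backward_shift ^^ n) x"
    by (rule ell2_eqI, simp)+
  have "(norm ((backward_shift ^^ n) x))\<^sup>2 \<le> (norm x)\<^sup>2"
    using norm_ell2_split[of x n] by (simp add: sum_nonneg)
  from power2_le_imp_le[OF this] show "norm ((backward_shift ^^ n) x) \<le> norm x * 1" by simp
qed

section \<open>Asymptotically Toeplitz operators and their entries\<close>

definition shift_defect :: "(ell2 \<Rightarrow> ell2) \<Rightarrow> (ell2 \<Rightarrow> ell2) \<Rightarrow> nat \<Rightarrow> ell2 \<Rightarrow> ell2" where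
  "shift_defect A T n x = (backward_shift ^^ n) (A ((shift ^^ n) x)) - T x"

lemma uniformly_asymptotically_Toeplitz_iff:
  "uniformly_asymptotically_Toeplitz A T \<longleftrightarrow>
     bounded_operator A \<and> bounded_operator T \<and> (\<lambda>n. onorm (shift_defect A T n)) \<longlonglongrightarrow> 0"
  by (simp add: uniformly_asymptotically_Toeplitz_def adjoint_shift shift_defect_def[abs_def])

lemma bounded_linear_shift_defect:
  assumes "bounded_operator A" "bounded_operator T"
  shows "bounded_linear (shift_defect A T n)"
  unfolding shift_defect_def[abs_def]
  by (intro bounded_linear_sub bounded_linear_compose[OF bounded_linear_backward_shift_funpow]
      bounded_linear_compose[OF bounded_linear_operator[OF assms(1)]]
      bounded_linear_shift_funpow bounded_linear_operator[OF assms(2)])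

text \<open>The compression by n shifts has the entry of A at (i + n, j + n) in place (i, j), and
  entries are bounded by the operator norm.\<close>

lemma entry_limit:
  assumes "uniformly_asymptotically_Toeplitz A T"
  shows "(\<lambda>n. entry A (i + n) (j + n)) \<longlonglongrightarrow> entry T i j"
proof -
  have A: "bounded_operator A" "bounded_operator T" and lim: "(\<lambda>n. onorm (shift_defect A T n)) \<longlonglongrightarrow> 0"
    using assms by (auto simp: uniformly_asymptotically_Toeplitz_iff)
  have sh: "(shift ^^ n) (unit_vector j) = unit_vector (j + n)" for n
    by (rule ell2_eqI) (auto simp: coord_shift_funpow)
  have "(\<lambda>n. entry A (i + n) (j + n) - entry T i j) \<longlonglongrightarrow> 0"
  proof (rule Lim_null_comparison[OF _ lim], rule always_eventually, rule allI)
    fix n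
    have "entry A (i + n) (j + n) - entry T i j = coord (shift_defect A T n (unit_vector j)) i"
      by (simp add: shift_defect_def entry_def sh)
    also have "norm \<dots> \<le> norm (shift_defect A T n (unit_vector j))" by (rule cmod_coord_le_norm)
    also have "\<dots> \<le> onorm (shift_defect A T n)"
      using onorm[OF bounded_linear_shift_defect[OF A], of n "unit_vector j"] by simp
    finally show "norm (entry A (i + n) (j + n) - entry T i j) \<le> onorm (shift_defect A T n)" .
  qed
  then show ?thesis by (rule LIM_zero_cancel)
qed

text \<open>Rows are square-summable: applying A to the conjugate of a truncated row with square sum
  s gives s \<le> C sqrt s, hence s \<le> C^2 for every truncation.\<close>

lemma entry_row_tendsto_0:
  assumes A: "bounded_operator A"
  shows "(\<lambda>j. entry A i j) \<longlonglongrightarrow> 0"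
proof -
  define C where "C = onorm A"
  have bd: "(\<Sum>j<N. (cmod (entry A i j))\<^sup>2) \<le> C\<^sup>2" for N
  proof -
    define s where "s = (\<Sum>j<N. (cmod (entry A i j))\<^sup>2)"
    define y where "y = fin_vec (\<lambda>j. cnj (entry A i j)) N"
    have s0: "0 \<le> s" unfolding s_def by (intro sum_nonneg) auto
    have ny: "(norm y)\<^sup>2 = s"
      unfolding y_def s_def by (subst norm_eq_sum[where N = N]) auto
    have "of_real s = coord (A y) i"
      by (simp only: y_def coord_operator_fin_vec[OF A] s_def of_real_sum complex_norm_square)
    then have "s = cmod (coord (A y) i)" using s0 by (metis abs_of_nonneg norm_of_real)
    also have "\<dots> \<le> C * norm y"
      unfolding C_def by (rule order_trans[OF cmod_coord_le_norm onorm[OF bounded_linear_operator[OF A]]])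
    finally have "s\<^sup>2 \<le> C\<^sup>2 * s" using s0 ny power_mono[of s "C * norm y" 2] by (simp add: power_mult_distrib)
    then show "s \<le> C\<^sup>2" using s0 by (cases "s = 0") (auto simp: power2_eq_square)
  qed
  have "summable (\<lambda>j. (cmod (entry A i j))\<^sup>2)"
    by (rule summableI_nonneg_bounded[where x = "C\<^sup>2"]) (use bd in auto)
  then have "(\<lambda>j. sqrt ((cmod (entry A i j))\<^sup>2)) \<longlonglongrightarrow> sqrt 0"
    by (intro tendsto_real_sqrt summable_LIMSEQ_zero)
  then show ?thesis by (simp add: tendsto_norm_zero_iff)
qed

section \<open>Bessel's inequality and the Dirichlet kernel\<close>

lemma circle_trig_poly_integral:
  assumes [measurable]: "h \<in> borel_measurable borel" and B: "\<And>t. norm (h t) \<le> B"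
  shows "(LINT t|circle_measure. (\<Sum>j\<in>J. a j * cis (of_nat j * t)) * h t) = 
    (\<Sum>j\<in>J. a j * (LINT t|circle_measure. cis (of_nat j * t) * h t))"
proof -
  have int: "integrable circle_measure (\<lambda>t. cis (of_nat j * t) * h t)" for j
    by (rule circle_integrable_bounded[where B = B]) (use B in \<open>auto simp: norm_mult\<close>)
  have "(LINT t|circle_measure. (\<Sum>j\<in>J. a j * cis (of_nat j * t)) * h t) =
     (LINT t|circle_measure. (\<Sum>j\<in>J. a j * (cis (of_nat j * t) * h t)))"
    by (simp add: sum_distrib_right mult.assoc)
  also have "\<dots> = (\<Sum>j\<in>J. (LINT t|circle_measure. a j * (cis (of_nat j * t) * h t)))"
    by (rule Bochner_Integration.integral_sum) (intro integrable_mult_right int)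
  finally show ?thesis by simp
qed

lemma trig_poly_bounded: "norm (\<Sum>j\<in>J. a j * cis (of_nat j * t)) \<le> (\<Sum>j\<in>J. norm (a j))"
  by (rule sum_norm_le) (simp add: norm_mult)

lemma trig_poly_coeff:
  assumes "finite J"
  shows "(LINT t|circle_measure. (\<Sum>j\<in>J. a j * cis (of_nat j * t)) * cis (- (of_nat i * t))) = (if i \<in> J then a i else 0)"
  using assms by (subst circle_trig_poly_integral[where B = 1]) (auto simp: circle_cis_integral_nat of_bool_def if_distrib cong: if_cong)

text \<open>Expands the mean of |g - S|^2 for the partial sum S; all cross terms equal the square
  sum of the coefficients. Only nonnegative frequencies occur, matching the one-sided coordinates of
  the sequence space.\<close>

lemma circle_bessel:
  assumes [measurable]: "g \<in> borel_measurable borel" and B: "\<And>t. norm (g t) \<le> B"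
  shows "(\<Sum>i<n. (cmod (LINT t|circle_measure. g t * cis (- (of_nat i * t))))\<^sup>2) \<le> (LINT t|circle_measure. (cmod (g t))\<^sup>2)"
proof -
  define c where "c = (\<lambda>i::nat. LINT t|circle_measure. g t * cis (- (of_nat i * t)))"
  define S where "S = (\<lambda>t. \<Sum>i<n. c i * cis (of_nat i * t))"
  have [measurable]: "S \<in> borel_measurable borel" unfolding S_def by measurable
  have Sb: "norm (S t) \<le> (\<Sum>i<n. norm (c i))" for t unfolding S_def by (rule trig_poly_bounded)
  define C where "C = max B (\<Sum>i<n. norm (c i))"
  have gC: "norm (g t) \<le> C" and SC: "norm (S t) \<le> C" for t using B[of t] Sb[of t] by (auto simp: C_def)
  have C0: "0 \<le> C" using order_trans[OF norm_ge_zero gC[of 0]] .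
  have int: "integrable circle_measure (\<lambda>t. u t * cnj (v t))"
    if [measurable]: "u \<in> borel_measurable borel" "v \<in> borel_measurable borel" and "\<And>t. norm (u t) \<le> C" "\<And>t. norm (v t) \<le> C" for u v
    by (rule circle_integrable_bounded[where B = "C * C"])
      (use that C0 in \<open>auto simp: norm_mult intro!: mult_mono\<close>)
  note ints = int[of g g] int[of g S] int[of S g] int[of S S]
  define s where "s = (\<Sum>i<n. (cmod (c i))\<^sup>2)"
  have cg: "(LINT t|circle_measure. cis (of_nat i * t) * cnj (g t)) = cnj (c i)" for i
  proof -
    have "cnj (c i) = (LINT t|circle_measure. cnj (g t * cis (- (of_nat i * t))))"
      unfolding c_def by (rule Bochner_Integration.integral_cnj[symmetric])
    then show ?thesis by (simp add: cis_cnj mult.commute)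
  qed
  have cS: "(LINT t|circle_measure. cis (of_nat i * t) * cnj (S t)) = (if i < n then cnj (c i) else 0)" for i
  proof -
    have "(LINT t|circle_measure. cnj (S t * cis (- (of_nat i * t)))) = cnj (LINT t|circle_measure. S t * cis (- (of_nat i * t)))"
      by (rule Bochner_Integration.integral_cnj)
    also have "(LINT t|circle_measure. S t * cis (- (of_nat i * t))) = (if i < n then c i else 0)"
      unfolding S_def by (simp add: trig_poly_coeff)
    finally show ?thesis by (simp add: cis_cnj mult.commute)
  qed
  have Sg: "(LINT t|circle_measure. S t * cnj (g t)) = of_real s"
    unfolding S_def by (subst circle_trig_poly_integral[where B = B])
      (use B in \<open>auto simp: cg s_def simp del: of_real_power simp flip: complex_norm_square\<close>)
  have SS: "(LINT t|circle_measure. S t * cnj (S t)) = of_real s"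
  proof -
    have "(LINT t|circle_measure. (\<Sum>i<n. c i * cis (of_nat i * t)) * cnj (S t)) =
       (\<Sum>i<n. c i * (LINT t|circle_measure. cis (of_nat i * t) * cnj (S t)))"
      by (rule circle_trig_poly_integral[where B = C]) (use SC in auto)
    also have "\<dots> = (\<Sum>i<n. c i * cnj (c i))" by (intro sum.cong refl) (simp add: cS)
    finally show ?thesis unfolding s_def of_real_sum complex_norm_square by (simp only: S_def)
  qed
  have gS: "(LINT t|circle_measure. g t * cnj (S t)) = of_real s"
  proof -
    have "cnj (LINT t|circle_measure. S t * cnj (g t)) = (LINT t|circle_measure. g t * cnj (S t))"
      by (simp add: Bochner_Integration.integral_cnj[symmetric] mult.commute del: Bochner_Integration.integral_cnj)
    then show ?thesis using Sg by simp
  qed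
  have "of_real (LINT t|circle_measure. (cmod (g t - S t))\<^sup>2) = (LINT t|circle_measure. complex_of_real ((cmod (g t - S t))\<^sup>2))"
    by (rule integral_complex_of_real[symmetric])
  also have "\<dots> = (LINT t|circle_measure. g t * cnj (g t) - g t * cnj (S t) - S t * cnj (g t) + S t * cnj (S t))"
    by (simp only: complex_norm_square complex_cnj_diff) (simp add: algebra_simps)
  also have "\<dots> = (LINT t|circle_measure. g t * cnj (g t)) - of_real s"
    using ints gC SC by (simp add: gS Sg SS)
  also have "(LINT t|circle_measure. g t * cnj (g t)) = of_real (LINT t|circle_measure. (cmod (g t))\<^sup>2)"
    by (simp only: complex_norm_square[symmetric] integral_complex_of_real)
  finally have "(LINT t|circle_measure. (cmod (g t - S t))\<^sup>2) = (LINT t|circle_measure. (cmod (g t))\<^sup>2) - s"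
    by (simp only: of_real_diff[symmetric] of_real_eq_iff)
  moreover have "0 \<le> (LINT t|circle_measure. (cmod (g t - S t))\<^sup>2)" by simp
  ultimately show ?thesis by (simp add: s_def c_def)
qed

lemma trig_poly_norm:
  assumes "finite J"
  shows "(LINT t|circle_measure. (cmod (\<Sum>j\<in>J. a j * cis (of_nat j * t)))\<^sup>2) = (\<Sum>j\<in>J. (cmod (a j))\<^sup>2)"
proof -
  let ?S = "\<lambda>t. \<Sum>j\<in>J. a j * cis (of_nat j * t)"
  have cS: "(LINT t|circle_measure. cis (of_nat i * t) * cnj (?S t)) = cnj (a i)" if "i \<in> J" for i
  proof -
    have "(LINT t|circle_measure. cnj (?S t * cis (- (of_nat i * t)))) = cnj (LINT t|circle_measure. ?S t * cis (- (of_nat i * t)))"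
      by (rule Bochner_Integration.integral_cnj)
    also have "(LINT t|circle_measure. ?S t * cis (- (of_nat i * t))) = a i"
      using that assms by (simp only: trig_poly_coeff if_True)
    finally show ?thesis by (simp add: cis_cnj mult.commute)
  qed
  have "of_real (LINT t|circle_measure. (cmod (?S t))\<^sup>2) = (LINT t|circle_measure. ?S t * cnj (?S t))"
    by (simp only: complex_norm_square[symmetric] integral_complex_of_real)
  also have "\<dots> = (\<Sum>j\<in>J. a j * (LINT t|circle_measure. cis (of_nat j * t) * cnj (?S t)))"
    by (rule circle_trig_poly_integral[where B = "\<Sum>j\<in>J. norm (a j)"])
      (use trig_poly_bounded[of a _ J] in \<open>auto simp del: cnj_sum\<close>)
  also have "\<dots> = (\<Sum>j\<in>J. a j * cnj (a j))" by (intro sum.cong refl) (simp only: cS)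
  also have "\<dots> = of_real (\<Sum>j\<in>J. (cmod (a j))\<^sup>2)" by (simp only: complex_norm_square of_real_sum)
  finally show ?thesis by (simp only: of_real_eq_iff)
qed

section \<open>Normalized Dirichlet kernels as approximate eigenvectors of a Toeplitz
  operator\<close>

lemma dirichlet_square_le:
  fixes w :: complex
  assumes "norm w = 1" "w \<noteq> 1"
  shows "(cmod (\<Sum>j<N. w ^ j))\<^sup>2 \<le> 4 / (cmod (w - 1))\<^sup>2"
proof -
  have "(\<Sum>j<N. w ^ j) = (w ^ N - 1) / (w - 1)" using assms(2) by (rule geometric_sum)
  moreover have "cmod (w ^ N - 1) \<le> 2"
    using norm_triangle_ineq4[of "w ^ N" 1] assms(1) by (simp add: norm_power)
  then have "(cmod (w ^ N - 1))\<^sup>2 \<le> 2\<^sup>2" by (intro power_mono) auto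
  ultimately show ?thesis using assms(2) by (simp add: norm_divide power_divide divide_right_mono)
qed

text \<open>A Dirichlet kernel peaking at z0 (on the circle) and of mean square 1 for N > 0.
  Changing m multiplies it by a unimodular function but moves its coefficient sequence, which is
  \<open>dirichlet_vec\<close>, arbitrarily far out.\<close>

definition dirichlet_poly :: "complex \<Rightarrow> nat \<Rightarrow> nat \<Rightarrow> real \<Rightarrow> complex" where
  "dirichlet_poly z0 m N t = (\<Sum>j\<in>{m..<m+N}. cnj z0 ^ j / of_real (sqrt (real N)) * cis (of_nat j * t))"

lemma measurable_dirichlet_poly [measurable]: "dirichlet_poly z0 m N \<in> borel_measurable borel"
  unfolding dirichlet_poly_def[abs_def] by measurable

lemma dirichlet_poly_norm:
  assumes "norm z0 = 1"
  shows "(cmod (dirichlet_poly z0 m N t))\<^sup>2 = (cmod (\<Sum>j<N. (cnj z0 * cis t) ^ j))\<^sup>2 / real N"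
proof -
  have "dirichlet_poly z0 m N t = (\<Sum>j<N. cnj z0 ^ (j + m) / of_real (sqrt (real N)) * cis (of_nat (j + m) * t))"
    unfolding dirichlet_poly_def by (rule sum.reindex_bij_witness[of _ "\<lambda>j. j + m" "\<lambda>j. j - m"]) auto
  also have "\<dots> = (\<Sum>j<N. (cnj z0 * cis t) ^ m / of_real (sqrt (real N)) * (cnj z0 * cis t) ^ j)"
  proof (intro sum.cong refl)
    fix j
    have "cis (of_nat (j + m) * t) = cis t ^ (j + m)" by (simp only: Complex.DeMoivre)
    then show "cnj z0 ^ (j + m) / of_real (sqrt (real N)) * cis (of_nat (j + m) * t) =
        (cnj z0 * cis t) ^ m / of_real (sqrt (real N)) * (cnj z0 * cis t) ^ j"
      by (simp only: power_add power_mult_distrib) simp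
  qed
  also have "\<dots> = (cnj z0 * cis t) ^ m / of_real (sqrt (real N)) * (\<Sum>j<N. (cnj z0 * cis t) ^ j)"
    by (rule sum_distrib_left[symmetric])
  finally show ?thesis using assms
    by (simp add: norm_mult norm_divide norm_power power_mult_distrib power_divide)
qed

text \<open>The modulus of the kernel does not depend on m, so one N serves every m and can be fixed
  before the frequencies are moved out.\<close>

lemma dirichlet_concentration:
  assumes f: "continuous_on (sphere 0 1) f" and z0: "norm z0 = 1" and e: "e > 0"
  shows "\<exists>N>0. \<forall>m. (LINT t|circle_measure. (cmod ((f (cis t) - f z0) * dirichlet_poly z0 m N t))\<^sup>2) < e"
proof -
  note [measurable] = measurable_cis_comp[OF f]
  have "bounded (f ` sphere 0 1)"
    by (intro compact_imp_bounded compact_continuous_image f) auto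
  then obtain B where B: "\<And>z. norm z = 1 \<Longrightarrow> norm (f z) \<le> B" by (force simp: bounded_iff)
  have B0: "0 \<le> B" using order_trans[OF norm_ge_zero B[OF z0]] .
  have "continuous (at z0 within sphere 0 1) f" using f z0 by (simp add: continuous_on_eq_continuous_within)
  moreover have "sqrt (e / 2) > 0" using e by simp
  ultimately obtain d where d: "d > 0" "\<And>z. norm z = 1 \<Longrightarrow> dist z z0 < d \<Longrightarrow> dist (f z) (f z0) < sqrt (e / 2)"
    unfolding continuous_within_eps_delta by (metis mem_sphere_0)
  \<comment> \<open>At distance at least d from z0, the first factor bounds |f - f z0|^2 and the
    second the unnormalized kernel squared. Normalization divides by N, which is then taken large
    enough for this part to stay below e / 2.\<close>
  define C where "C = (2 * B)\<^sup>2 * (4 / d\<^sup>2)"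
  have "\<exists>N::nat. 2 * C / e < real N" by (rule reals_Archimedean2)
  then obtain N0 :: nat where N0: "2 * C / e < real N0" by blast
  define N where "N = Suc N0"
  have N: "C / real N < e / 2"
  proof -
    have "2 * C / e < real N" using N0 by (simp add: N_def)
    then show ?thesis using e by (simp add: N_def field_simps)
  qed
  have "(LINT t|circle_measure. (cmod ((f (cis t) - f z0) * dirichlet_poly z0 m N t))\<^sup>2) < e" for m
  proof -
    let ?p = "dirichlet_poly z0 m N"
    define Q where "Q = (\<Sum>j\<in>{m..<m+N}. cmod (cnj z0 ^ j / of_real (sqrt (real N))))"
    have pQ: "norm (?p t) \<le> Q" for t unfolding dirichlet_poly_def Q_def by (rule trig_poly_bounded)
    have fB: "norm (f (cis t) - f z0) \<le> 2 * B" for t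
      using norm_triangle_ineq4[of "f (cis t)" "f z0"] B[of "cis t"] B[OF z0] by simp
    have i1: "integrable circle_measure (\<lambda>t. (cmod (?p t))\<^sup>2)"
      by (rule circle_integrable_bounded[where B = "Q\<^sup>2"]) (use pQ in \<open>auto intro: power_mono\<close>)
    have i2: "integrable circle_measure (\<lambda>t. (cmod ((f (cis t) - f z0) * ?p t))\<^sup>2)"
    proof (rule circle_integrable_bounded[where B = "(2 * B * Q)\<^sup>2"])
      fix t
      have "cmod ((f (cis t) - f z0) * ?p t) \<le> 2 * B * Q"
        unfolding norm_mult using B0 by (intro mult_mono fB pQ) auto
      then have "(cmod ((f (cis t) - f z0) * ?p t))\<^sup>2 \<le> (2 * B * Q)\<^sup>2" by (intro power_mono) auto
      then show "norm ((cmod ((f (cis t) - f z0) * ?p t))\<^sup>2) \<le> (2 * B * Q)\<^sup>2" by simp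
    qed measurable
    have one: "(LINT t|circle_measure. (cmod (?p t))\<^sup>2) = 1"
      unfolding dirichlet_poly_def by (subst trig_poly_norm) (use z0 in \<open>auto simp: norm_divide norm_power power_divide N_def\<close>)
    have "(LINT t|circle_measure. (cmod ((f (cis t) - f z0) * ?p t))\<^sup>2) \<le> (LINT t|circle_measure. e / 2 * (cmod (?p t))\<^sup>2 + C / real N)"
    proof (rule integral_mono[OF i2])
      fix t
      show "(cmod ((f (cis t) - f z0) * ?p t))\<^sup>2 \<le> e / 2 * (cmod (?p t))\<^sup>2 + C / real N"
      proof (cases "dist (cis t) z0 < d")
        case True
        then have "(cmod (f (cis t) - f z0))\<^sup>2 \<le> (sqrt (e / 2))\<^sup>2"
          using d(2)[of "cis t"] by (intro power_mono) (auto simp: dist_norm)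
        then have "(cmod (f (cis t) - f z0))\<^sup>2 * (cmod (?p t))\<^sup>2 \<le> e / 2 * (cmod (?p t))\<^sup>2"
          using e by (intro mult_right_mono) auto
        moreover have "0 \<le> C / real N" by (simp add: C_def)
        ultimately show ?thesis unfolding norm_mult power_mult_distrib by linarith
      next
        case False
        have zz: "z0 * cnj z0 = 1" using z0 complex_norm_square[of z0] by simp
        have "cnj z0 * cis t - 1 = cnj z0 * (cis t - z0)" using zz by (simp add: algebra_simps)
        then have eq: "cmod (cnj z0 * cis t - 1) = cmod (cis t - z0)" using z0 by (simp add: norm_mult)
        have far: "d \<le> cmod (cis t - z0)" using False by (simp add: dist_norm)
        have "cnj z0 * cis t \<noteq> 1" using eq far d(1) by fastforce
        then have "(cmod (\<Sum>j<N. (cnj z0 * cis t) ^ j))\<^sup>2 \<le> 4 / (cmod (cis t - z0))\<^sup>2"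
          using dirichlet_square_le[of "cnj z0 * cis t" N] eq z0 by (simp add: norm_mult)
        also have "\<dots> \<le> 4 / d\<^sup>2" using far d(1) by (intro divide_left_mono power_mono mult_pos_pos) auto
        finally have "(cmod (?p t))\<^sup>2 \<le> 4 / d\<^sup>2 / real N"
          unfolding dirichlet_poly_norm[OF z0] by (intro divide_right_mono) auto
        moreover have "(cmod (f (cis t) - f z0))\<^sup>2 \<le> (2 * B)\<^sup>2" by (intro power_mono fB) auto
        ultimately have "(cmod (f (cis t) - f z0))\<^sup>2 * (cmod (?p t))\<^sup>2 \<le> (2 * B)\<^sup>2 * (4 / d\<^sup>2 / real N)"
          by (intro mult_mono) auto
        also have "\<dots> = C / real N" by (simp add: C_def)
        also have "\<dots> \<le> e / 2 * (cmod (?p t))\<^sup>2 + C / real N" using e by simp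
        finally show ?thesis unfolding norm_mult power_mult_distrib .
      qed
    qed (use i1 in auto)
    also have "\<dots> = e / 2 + C / real N" using i1 one by simp
    also have "\<dots> < e" using N by linarith
    finally show ?thesis .
  qed
  then show ?thesis by (intro exI[of _ N]) (auto simp: N_def)
qed

definition dirichlet_vec :: "complex \<Rightarrow> nat \<Rightarrow> nat \<Rightarrow> ell2" where
  "dirichlet_vec z0 m N = fin_vec (\<lambda>j. if m \<le> j then cnj z0 ^ j / of_real (sqrt (real N)) else 0) (m + N)"

lemma norm_dirichlet_vec:
  assumes "norm z0 = 1" "N > 0"
  shows "norm (dirichlet_vec z0 m N) = 1"
proof -
  have "(norm (dirichlet_vec z0 m N))\<^sup>2 = (\<Sum>j<m+N. (cmod (coord (dirichlet_vec z0 m N) j))\<^sup>2)"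
    by (rule norm_eq_sum) (simp add: dirichlet_vec_def)
  also have "\<dots> = (\<Sum>j\<in>{m..<m+N}. 1 / real N)"
    using assms by (intro sum.mono_neutral_cong_right)
      (auto simp: dirichlet_vec_def norm_divide norm_power power_divide)
  also have "\<dots> = 1" using assms by simp
  finally show ?thesis using norm_ge_zero[of "dirichlet_vec z0 m N"] by (auto simp: power2_eq_1_iff)
qed

text \<open>
  The coordinates of \<open>(T - \<lambda>) x\<close> are Fourier coefficients of \<open>(f - \<lambda>) p\<close>, where \<open>p\<close> is the
  trigonometric polynomial with coefficient sequence \<open>x\<close>; the rest is Bessel's inequality.
\<close>

lemma Toeplitz_dirichlet_vec:
  assumes T: "bounded_operator T" and f: "continuous_on (sphere 0 1) f" "Toeplitz_symbol T f"
  shows "(norm (T (dirichlet_vec z0 m N) - scaleC l (dirichlet_vec z0 m N)))\<^sup>2 \<le>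
     (LINT t|circle_measure. (cmod ((f (cis t) - l) * dirichlet_poly z0 m N t))\<^sup>2)"
proof (rule norm_ell2_leI)
  fix n
  note m[measurable] = measurable_cis_comp[OF f(1)]
  have "bounded (f ` sphere 0 1)"
    by (intro compact_imp_bounded compact_continuous_image f(1)) auto
  then obtain B where B: "\<And>z. norm z = 1 \<Longrightarrow> norm (f z) \<le> B" by (force simp: bounded_iff)
  define g where "g = (\<lambda>t. (f (cis t) - l) * dirichlet_poly z0 m N t)"
  have [measurable]: "g \<in> borel_measurable borel" unfolding g_def by measurable
  define Q where "Q = (\<Sum>j\<in>{m..<m+N}. cmod (cnj z0 ^ j / of_real (sqrt (real N))))"
  have pQ: "norm (dirichlet_poly z0 m N t) \<le> Q" for t unfolding dirichlet_poly_def Q_def by (rule trig_poly_bounded)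
  have fl: "norm (f (cis t) - l) \<le> B + norm l" for t
    using norm_triangle_ineq4[of "f (cis t)" l] B[of "cis t"] by simp
  have gb: "norm (g t) \<le> (B + norm l) * Q" for t
    unfolding g_def norm_mult by (intro mult_mono fl pQ) (use order_trans[OF norm_ge_zero fl] in auto)
  define a where "a = (\<lambda>j. cnj z0 ^ j / of_real (sqrt (real N)))"
  have coef: "(LINT t|circle_measure. g t * cis (- (of_nat i * t))) =
     coord (T (dirichlet_vec z0 m N) - scaleC l (dirichlet_vec z0 m N)) i" for i
  proof -
    define h where "h = (\<lambda>t. (f (cis t) - l) * cis (- (of_nat i * t)))"
    have [measurable]: "h \<in> borel_measurable borel" unfolding h_def by measurable
    have "(LINT t|circle_measure. g t * cis (- (of_nat i * t))) = 
       (LINT t|circle_measure. (\<Sum>j\<in>{m..<m+N}. a j * cis (of_nat j * t)) * h t)"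
      by (simp add: g_def h_def dirichlet_poly_def a_def mult_ac)
    also have "\<dots> = (\<Sum>j\<in>{m..<m+N}. a j * (LINT t|circle_measure. cis (of_nat j * t) * h t))"
      by (rule circle_trig_poly_integral[where B = "B + norm l"]) (use fl in \<open>auto simp: h_def norm_mult\<close>)
    also have "\<dots> = (\<Sum>j\<in>{m..<m+N}. (entry T i j - l * of_bool (i = j)) * a j)"
    proof (intro sum.cong refl)
      fix j
      have int: "integrable circle_measure (\<lambda>t. f (cis t) * cis (- (of_int (int i - int j) * t)))"
        "integrable circle_measure (\<lambda>t. l * cis (- (of_int (int i - int j) * t)))"
        by (rule circle_integrable_bounded[where B = "B + norm l"], measurable,
            use B order_trans[OF norm_ge_zero B[of 1]] in \<open>auto simp: norm_mult add_increasing2\<close>)+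
      have "(LINT t|circle_measure. cis (of_nat j * t) * h t) =
         (LINT t|circle_measure. f (cis t) * cis (- (of_int (int i - int j) * t)) - l * cis (- (of_int (int i - int j) * t)))"
        by (intro Bochner_Integration.integral_cong refl) (simp add: h_def cis_mult algebra_simps)
      also have "\<dots> = Fourier_coefficient f (int i - int j) - l * of_bool (i = j)"
      proof -
        have "(LINT t|circle_measure. cis (- (of_int (int i - int j) * t))) = of_bool (i = j)"
          using circle_cis_integral[of "int j - int i"] by (auto simp: algebra_simps)
        then show ?thesis
          by (simp only: Bochner_Integration.integral_diff[OF int] Fourier_coefficient_eq[OF m] integral_mult_right_zero)
      qed
      finally show "a j * (LINT t|circle_measure. cis (of_nat j * t) * h t) = (entry T i j - l * of_bool (i = j)) * a j"
        using f(2) by (simp add: Toeplitz_symbol_def)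
    qed
    also have "\<dots> = (\<Sum>j\<in>{m..<m+N}. entry T i j * a j) - l * (if m \<le> i \<and> i < m + N then a i else 0)"
    proof -
      have "(\<Sum>j\<in>{m..<m+N}. l * of_bool (i = j) * a j) = (\<Sum>j\<in>{m..<m+N}. if i = j then l * a j else 0)"
        by (intro sum.cong) auto
      also have "\<dots> = l * (if m \<le> i \<and> i < m + N then a i else 0)" by simp
      finally show ?thesis by (simp add: left_diff_distrib sum_subtractf)
    qed
    also have "(\<Sum>j\<in>{m..<m+N}. entry T i j * a j) = (\<Sum>j<m+N. entry T i j * (if m \<le> j then a j else 0))"
      by (intro sum.mono_neutral_cong_left) auto
    also have "\<dots> - l * (if m \<le> i \<and> i < m + N then a i else 0) = coord (T (dirichlet_vec z0 m N) - scaleC l (dirichlet_vec z0 m N)) i"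
      unfolding dirichlet_vec_def coord_simps coord_operator_fin_vec[OF T] by (simp add: a_def cong: if_cong)
    finally show ?thesis .
  qed
  show "(\<Sum>i<n. (cmod (coord (T (dirichlet_vec z0 m N) - scaleC l (dirichlet_vec z0 m N)) i))\<^sup>2)
       \<le> (LINT t|circle_measure. (cmod ((f (cis t) - l) * dirichlet_poly z0 m N t))\<^sup>2)"
    using circle_bessel[of g "(B + norm l) * Q" n] gb unfolding coef by (simp add: g_def)
qed

section \<open>Orthonormal polynomials and the Hessenberg operator\<close>

text \<open>The complement of the support is a union of open null sets, and countably many of them
  cover it by Lindelof's theorem.\<close>

lemma AE_msupport:
  assumes "sets \<mu> = sets borel"
  shows "AE z in \<mu>. z \<in> msupport \<mu>"
proof -
  define F where "F = {U. open U \<and> emeasure \<mu> U = 0}"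
  have "\<And>U. U \<in> F \<Longrightarrow> open U" by (simp add: F_def)
  from Lindelof[OF this] obtain F' where F': "F' \<subseteq> F" "countable F'" "\<Union>F' = \<Union>F" by blast
  have "\<Union>F' \<in> null_sets \<mu>"
  proof (rule null_sets_UN'[of F' id, simplified])
    show "countable F'" by fact
    show "U \<in> null_sets \<mu>" if "U \<in> F'" for U
      using that F'(1) assms by (auto simp: F_def null_sets_def)
  qed
  moreover have "- msupport \<mu> = \<Union>F"
    by (auto simp: msupport_def F_def not_gr_zero)
  ultimately have "- msupport \<mu> \<in> null_sets \<mu>" using F'(3) by simp
  then show ?thesis by (rule AE_I'[of "- msupport \<mu>"]) auto
qed

locale hessenberg =
  fixes \<mu> :: "complex measure" and P :: "nat \<Rightarrow> complex poly" and d :: "nat \<Rightarrow> nat \<Rightarrow> complex"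
  assumes prob: "prob_space \<mu>" and sets_eq [measurable_cong, simp]: "sets \<mu> = sets borel"
    and compact: "compact (msupport \<mu>)"
    and orth: "orthonormal_polynomials \<mu> P"
    and hess: "Hessenberg_matrix P d"
begin

lemma integrable_on_support:
  fixes g :: "complex \<Rightarrow> complex"
  assumes g: "continuous_on UNIV g"
  shows "integrable \<mu> g"
proof -
  interpret prob_space \<mu> by (rule prob)
  have "bounded (g ` msupport \<mu>)"
    by (intro compact_imp_bounded compact_continuous_image compact continuous_on_subset[OF g]) auto
  then obtain B where B: "\<And>z. z \<in> msupport \<mu> \<Longrightarrow> norm (g z) \<le> B" by (force simp: bounded_iff)
  show ?thesis
  proof (rule integrable_const_bound[where B = B])
    show "AE z in \<mu>. norm (g z) \<le> B" using AE_msupport[OF sets_eq] by eventually_elim (rule B)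
    show "g \<in> borel_measurable \<mu>"
      using borel_measurable_continuous_onI[OF g] measurable_cong_sets[OF sets_eq refl] by blast
  qed
qed

lemma orthonormal: "(LINT z|\<mu>. poly (P m) z * cnj (poly (P n) z)) = (if m = n then 1 else 0)"
  using orth by (simp add: orthonormal_polynomials_def)

lemma norm_expansion:
  "(LINT z|\<mu>. (cmod (\<Sum>i<n. c i * poly (P i) z))\<^sup>2) = (\<Sum>i<n. (cmod (c i))\<^sup>2)"
proof -
  let ?p = "\<lambda>i j z. c i * cnj (c j) * (poly (P i) z * cnj (poly (P j) z))"
  have int: "integrable \<mu> (?p i j)" for i j
    by (rule integrable_on_support) (intro continuous_intros)
  have "complex_of_real (LINT z|\<mu>. (cmod (\<Sum>i<n. c i * poly (P i) z))\<^sup>2) = (LINT z|\<mu>. (\<Sum>i<n. \<Sum>j<n. ?p i j z))"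
    unfolding integral_complex_of_real[symmetric]
    by (intro Bochner_Integration.integral_cong refl)
      (simp only: complex_norm_square cnj_sum sum_product complex_cnj_mult mult_ac)
  also have "\<dots> = (\<Sum>i<n. \<Sum>j<n. LINT z|\<mu>. ?p i j z)"
    by (simp add: Bochner_Integration.integral_sum int)
  also have "\<dots> = (\<Sum>i<n. \<Sum>j<n. if i = j then c i * cnj (c j) else 0)"
    by (intro sum.cong refl) (simp add: orthonormal)
  also have "\<dots> = (\<Sum>i<n. c i * cnj (c i))" by (intro sum.cong refl) simp
  also have "\<dots> = of_real (\<Sum>i<n. (cmod (c i))\<^sup>2)" by (simp only: complex_norm_square of_real_sum)
  finally show ?thesis by (simp only: of_real_eq_iff)
qed

text \<open>Padding with the zero entries of the Hessenberg matrix gives all columns n < N the same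
  range of summation, so that double sums can be exchanged.\<close>

lemma recurrence:
  assumes "n < N"
  shows "z * poly (P n) z = (\<Sum>k<Suc N. d k n * poly (P k) z)"
proof -
  have "monom 1 1 * P n = (\<Sum>k\<le>n + 1. smult (d k n) (P k))"
    using hess by (simp add: Hessenberg_matrix_def)
  from arg_cong[OF this, of "\<lambda>p. poly p z"]
  have "z * poly (P n) z = (\<Sum>k\<le>n + 1. d k n * poly (P k) z)"
    by (simp add: poly_monom poly_sum)
  also have "\<dots> = (\<Sum>k<Suc N. d k n * poly (P k) z)"
    using assms hess by (intro sum.mono_neutral_left) (auto simp: Hessenberg_matrix_def)
  finally show ?thesis .
qed

text \<open>Among the terms of the recurrence only P (n+1) reaches degree n + 1, so comparing
  coefficients of z^(n+1) isolates this entry.\<close>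

lemma subdiagonal: "d (Suc n) n = of_real (Re (lead_coeff (P n)) / Re (lead_coeff (P (Suc n))))"
proof -
  have deg: "degree (P m) = m" "lead_coeff (P m) \<in> \<real>" "Re (lead_coeff (P m)) > 0" for m
    using orth unfolding orthonormal_polynomials_def by blast+
  have "monom 1 1 * P n = (\<Sum>k\<le>n + 1. smult (d k n) (P k))"
    using hess by (simp add: Hessenberg_matrix_def)
  from arg_cong[OF this, of "\<lambda>p. coeff p (Suc n)"]
  have "coeff (P n) n = (\<Sum>k\<le>Suc n. d k n * coeff (P k) (Suc n))"
    by (simp add: coeff_monom_mult coeff_sum del: sum.atMost_Suc)
  also have "\<dots> = (\<Sum>k\<in>{Suc n}. d k n * coeff (P k) (Suc n))"
    by (rule sum.mono_neutral_right) (auto simp: coeff_eq_0 deg(1))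
  finally have e: "lead_coeff (P n) = d (Suc n) n * lead_coeff (P (Suc n))" by (simp add: deg(1))
  have r: "lead_coeff (P m) = of_real (Re (lead_coeff (P m)))" for m
    using deg(2)[of m] by (metis of_real_Re)
  have nz: "Re (lead_coeff (P (Suc n))) \<noteq> 0" using deg(3)[of "Suc n"] by simp
  have "of_real (Re (lead_coeff (P n))) = d (Suc n) n * of_real (Re (lead_coeff (P (Suc n))))"
    using e r by metis
  then show ?thesis using nz by (simp add: field_simps)
qed

text \<open>If the vector holds the coefficients of a polynomial Q, its image under D - l holds
  those of (z - l) Q. Parseval in L^2(\<mu>) on both sides reduces the claim to a pointwise bound on
  the support.\<close>

lemma operator_bounded_below:
  assumes D: "bounded_operator D" "\<And>i j. entry D i j = d i j"
    and r: "\<And>z. z \<in> msupport \<mu> \<Longrightarrow> r \<le> cmod (z - l)" "0 \<le> r"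
  shows "r * norm (fin_vec b N) \<le> norm (D (fin_vec b N) - scaleC l (fin_vec b N))"
proof -
  let ?x = "fin_vec b N" and ?y = "D (fin_vec b N) - scaleC l (fin_vec b N)"
  have y: "coord ?y i = (\<Sum>j<N. d i j * b j) - (if i < N then l * b i else 0)" for i
    by (simp add: coord_operator_fin_vec[OF D(1)] D(2))
  have y0: "coord ?y i = 0" if "i \<ge> Suc N" for i
    unfolding y using that hess by (auto simp: Hessenberg_matrix_def)
  let ?Q = "\<lambda>z. \<Sum>j<N. b j * poly (P j) z"
  have Q: "(\<Sum>i<Suc N. coord ?y i * poly (P i) z) = (z - l) * ?Q z" for z
  proof -
    have "(\<Sum>i<Suc N. coord ?y i * poly (P i) z) = 
       (\<Sum>i<Suc N. \<Sum>j<N. b j * (d i j * poly (P i) z)) - (\<Sum>i<Suc N. (if i < N then l * b i else 0) * poly (P i) z)"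
      unfolding y left_diff_distrib sum_subtractf sum_distrib_right by (simp only: mult_ac)
    also have "(\<Sum>i<Suc N. \<Sum>j<N. b j * (d i j * poly (P i) z)) = (\<Sum>j<N. b j * (z * poly (P j) z))"
      by (subst sum.swap) (intro sum.cong refl, simp add: recurrence[of _ N] sum_distrib_left del: sum.lessThan_Suc)
    also have "(\<Sum>i<Suc N. (if i < N then l * b i else 0) * poly (P i) z) = l * ?Q z"
      by (simp add: sum_distrib_left mult.assoc)
    also have "(\<Sum>j<N. b j * (z * poly (P j) z)) - l * ?Q z = (z - l) * ?Q z"
      by (simp add: sum_distrib_left left_diff_distrib mult_ac sum_subtractf right_diff_distrib)
    finally show ?thesis .
  qed
  have contQ: "continuous_on UNIV ?Q" by (intro continuous_intros)
  have int: "integrable \<mu> (\<lambda>z. (cmod (g z))\<^sup>2)" if "continuous_on UNIV g" for g :: "complex \<Rightarrow> complex"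
  proof -
    have "integrable \<mu> (\<lambda>z. complex_of_real ((cmod (g z))\<^sup>2))"
      by (rule integrable_on_support) (intro continuous_intros that)
    from integrable_Re[OF this] show ?thesis by simp
  qed
  have "r\<^sup>2 * (norm ?x)\<^sup>2 = r\<^sup>2 * (\<Sum>i<N. (cmod (b i))\<^sup>2)"
    by (subst norm_eq_sum[where N = N]) auto
  also have "\<dots> = (LINT z|\<mu>. r\<^sup>2 * (cmod (?Q z))\<^sup>2)"
    using norm_expansion[of b N] by simp
  also have "\<dots> \<le> (LINT z|\<mu>. (cmod ((z - l) * ?Q z))\<^sup>2)"
  proof (rule integral_mono_AE)
    show "integrable \<mu> (\<lambda>z. r\<^sup>2 * (cmod (?Q z))\<^sup>2)" by (intro integrable_mult_right int contQ)
    show "integrable \<mu> (\<lambda>z. (cmod ((z - l) * ?Q z))\<^sup>2)" by (intro int continuous_intros)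
    show "AE z in \<mu>. r\<^sup>2 * (cmod (?Q z))\<^sup>2 \<le> (cmod ((z - l) * ?Q z))\<^sup>2"
      using AE_msupport[OF sets_eq]
    proof eventually_elim
      case (elim z)
      then have "r\<^sup>2 \<le> (cmod (z - l))\<^sup>2" using r by (intro power_mono) auto
      then show ?case unfolding norm_mult power_mult_distrib by (intro mult_right_mono) auto
    qed
  qed
  also have "\<dots> = (\<Sum>i<Suc N. (cmod (coord ?y i))\<^sup>2)"
    unfolding Q[symmetric] by (rule norm_expansion)
  also have "\<dots> = (norm ?y)\<^sup>2" by (rule norm_eq_sum[symmetric]) (rule y0)
  finally have "(r * norm ?x)\<^sup>2 \<le> (norm ?y)\<^sup>2" by (simp add: power_mult_distrib)
  then show ?thesis by (rule power2_le_imp_le) simp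
qed

lemma symbol_in_support:
  assumes D: "\<And>i j. entry D i j = d i j" and DT: "uniformly_asymptotically_Toeplitz D T"
    and f: "continuous_on (sphere 0 1) f" "Toeplitz_symbol T f"
    and ne: "msupport \<mu> \<noteq> {}"
    and z0: "norm z0 = 1"
  shows "f z0 \<in> msupport \<mu>"
proof (rule ccontr)
  assume notin: "f z0 \<notin> msupport \<mu>"
  define l where "l = f z0"
  define r where "r = infdist l (msupport \<mu>)"
  have r: "r > 0" unfolding r_def l_def
    using notin compact ne by (simp add: compact_imp_closed infdist_pos_not_in_closed)
  have rK: "r \<le> cmod (z - l)" if "z \<in> msupport \<mu>" for z
    using infdist_le[OF that, of l] by (simp add: r_def dist_norm norm_minus_commute)
  have op: "bounded_operator D" "bounded_operator T" and lim: "(\<lambda>n. onorm (shift_defect D T n)) \<longlonglongrightarrow> 0"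
    using DT by (auto simp: uniformly_asymptotically_Toeplitz_iff)
  \<comment> \<open>Two errors below r/4 make the tail of (D - l) y shorter than r/2; the head will
    also be made shorter than r/2. Then r^2 < 2 (r/2)^2, a contradiction.\<close>
  have "\<forall>\<^sub>F n in sequentially. onorm (shift_defect D T n) < r / 4"
    using order_tendstoD(2)[OF lim, of "r / 4"] r by simp
  then obtain n where n: "onorm (shift_defect D T n) < r / 4" by (auto simp: eventually_sequentially)
  obtain N where N: "N > 0" "\<And>m. (LINT t|circle_measure. (cmod ((f (cis t) - l) * dirichlet_poly z0 m N t))\<^sup>2) < (r / 4)\<^sup>2"
    using dirichlet_concentration[OF f(1) z0, of "(r / 4)\<^sup>2"] r unfolding l_def by auto
  define x where "x = (\<lambda>m. dirichlet_vec z0 m N)"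
  define y where "y = (\<lambda>m. (shift ^^ n) (x m))"
  have nx: "norm (x m) = 1" for m unfolding x_def using z0 N(1) by (rule norm_dirichlet_vec)
  have Tx: "norm (T (x m) - scaleC l (x m)) < r / 4" for m
  proof -
    have "(norm (T (x m) - scaleC l (x m)))\<^sup>2 < (r / 4)\<^sup>2"
      using Toeplitz_dirichlet_vec[OF op(2) f, of z0 m N l] N(2)[of m] by (simp add: x_def)
    then show ?thesis by (rule power_less_imp_less_base) (use r in simp)
  qed
  define a where "a = (\<lambda>m j. if m + n \<le> j then cnj z0 ^ (j - n) / complex_of_real (sqrt (real N)) else 0)"
  have ya: "y m = fin_vec (a m) (m + N + n)" for m
    by (rule ell2_eqI) (auto simp: y_def x_def dirichlet_vec_def coord_shift_funpow a_def)
  have ydrop: "(backward_shift ^^ n) (y m) = x m" for m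
    by (rule ell2_eqI) (simp add: y_def coord_shift_funpow)
  have ny: "norm (y m) = 1" for m
  proof -
    have "(norm (y m))\<^sup>2 = 1"
      using norm_ell2_split[of "y m" n] by (simp add: ydrop nx) (simp add: y_def coord_shift_funpow)
    then show ?thesis using norm_ge_zero[of "y m"] by (auto simp: power2_eq_1_iff)
  qed
  define v where "v = (\<lambda>m. D (y m) - scaleC l (y m))"
  have lower: "r \<le> norm (v m)" for m
    using operator_bounded_below[OF op(1) D rK, of "a m" "m + N + n"] r ny[of m] by (simp add: v_def ya)
  have tail: "norm ((backward_shift ^^ n) (v m)) < r / 2" for m
  proof -
    have "(backward_shift ^^ n) (v m) = shift_defect D T n (x m) + (T (x m) - scaleC l (x m))"
    proof (rule ell2_eqI)
      fix i
      have "coord (y m) (i + n) = coord (x m) i" using ydrop[of m] coord_backward_shift_funpow[of n "y m" i] by simp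
      then show "coord ((backward_shift ^^ n) (v m)) i = coord (shift_defect D T n (x m) + (T (x m) - scaleC l (x m))) i"
        by (simp add: shift_defect_def v_def y_def)
    qed
    also have "norm \<dots> \<le> norm (shift_defect D T n (x m)) + norm (T (x m) - scaleC l (x m))"
      by (rule norm_triangle_ineq)
    also have "norm (shift_defect D T n (x m)) \<le> onorm (shift_defect D T n)"
      using onorm[OF bounded_linear_shift_defect[OF op], of n "x m"] nx[of m] by simp
    finally show ?thesis using n Tx[of m] by simp
  qed
  \<comment> \<open>The first n coordinates are invisible to the compression. Since y m starts at
    coordinate m + n, the term with l vanishes here, and the remaining N terms use row entries that
    move to the right as m grows and so tend to 0.\<close>
  have head: "(\<lambda>m. coord (v m) i) \<longlonglongrightarrow> 0" if "i < n" for i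
  proof -
    have row: "(\<lambda>j. d i j) \<longlonglongrightarrow> 0" using entry_row_tendsto_0[OF op(1), of i] by (simp add: D)
    have "coord (v m) i = (\<Sum>j<N. d i (j + m + n) * (cnj z0 ^ (j + m) / of_real (sqrt (real N))))" for m
    proof -
      have "coord (v m) i = (\<Sum>j<m+N+n. d i j * a m j)"
        using that unfolding v_def ya coord_simps coord_operator_fin_vec[OF op(1)] D by (simp add: a_def)
      also have "\<dots> = (\<Sum>j\<in>{m+n..<m+N+n}. d i j * (cnj z0 ^ (j - n) / of_real (sqrt (real N))))"
        by (intro sum.mono_neutral_cong_right) (auto simp: a_def)
      also have "\<dots> = (\<Sum>j<N. d i (j + m + n) * (cnj z0 ^ (j + m) / of_real (sqrt (real N))))"
        by (rule sum.reindex_bij_witness[of _ "\<lambda>j. j + m + n" "\<lambda>j. j - m - n"]) auto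
      finally show ?thesis .
    qed
    moreover have "(\<lambda>m. \<Sum>j<N. d i (j + m + n) * (cnj z0 ^ (j + m) / of_real (sqrt (real N)))) \<longlonglongrightarrow> 0"
    proof (rule tendsto_null_sum)
      fix j
      have "(\<lambda>m. d i (j + m + n)) \<longlonglongrightarrow> 0"
        using LIMSEQ_ignore_initial_segment[OF row, of "j + n"] by (simp add: ac_simps)
      then have "(\<lambda>m. cmod (d i (j + m + n)) * (1 / sqrt (real N))) \<longlonglongrightarrow> 0"
        by (intro tendsto_mult_left_zero tendsto_norm_zero)
      then show "(\<lambda>m. d i (j + m + n) * (cnj z0 ^ (j + m) / of_real (sqrt (real N)))) \<longlonglongrightarrow> 0"
        by (rule Lim_null_comparison[rotated])
          (use z0 in \<open>simp add: norm_mult norm_divide norm_power\<close>)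
    qed
    ultimately show ?thesis by simp
  qed
  have "(\<lambda>m. \<Sum>i<n. (cmod (coord (v m) i))\<^sup>2) \<longlonglongrightarrow> 0"
    by (rule tendsto_null_sum) (use head in \<open>auto intro!: tendsto_eq_intros\<close>)
  then have "\<forall>\<^sub>F m in sequentially. (\<Sum>i<n. (cmod (coord (v m) i))\<^sup>2) < (r / 2)\<^sup>2"
    using order_tendstoD(2)[of _ 0 sequentially "(r / 2)\<^sup>2"] r by simp
  then obtain m where m: "(\<Sum>i<n. (cmod (coord (v m) i))\<^sup>2) < (r / 2)\<^sup>2" by (auto simp: eventually_sequentially)
  have "r\<^sup>2 \<le> (norm (v m))\<^sup>2" using lower[of m] r by (intro power_mono) auto
  also have "\<dots> = (\<Sum>i<n. (cmod (coord (v m) i))\<^sup>2) + (norm ((backward_shift ^^ n) (v m)))\<^sup>2" by (rule norm_ell2_split)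
  also have "(norm ((backward_shift ^^ n) (v m)))\<^sup>2 \<le> (r / 2)\<^sup>2"
    using tail[of m] by (intro power_mono) auto
  finally have "r\<^sup>2 < 2 * (r / 2)\<^sup>2" using m by simp
  then show False using r by (simp add: power2_eq_square)
qed

end

text \<open>Both limits are the radius of convergence of the power series with coefficients g n, one
  by the ratio test, the other by the Cauchy-Hadamard formula.\<close>

lemma root_limit_eq_ratio_limit:
  fixes g :: "nat \<Rightarrow> real"
  assumes g: "\<And>n. g n > 0" and ratio: "(\<lambda>n. g n / g (Suc n)) \<longlonglongrightarrow> a"
    and root: "(\<lambda>n. g n powr (- 1 / real n)) \<longlonglongrightarrow> b" and b: "b > 0"
  shows "a = b"
proof -
  have 1: "conv_radius g = ereal a"
    by (rule conv_radius_ratio_limit[OF refl]) (use g ratio in \<open>auto simp: less_imp_neq[symmetric] abs_of_pos\<close>)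
  have "(\<lambda>n. inverse (g n powr (- 1 / real n))) \<longlonglongrightarrow> inverse b"
    using b by (intro tendsto_intros root) auto
  then have "(\<lambda>n. root n (norm (g n))) \<longlonglongrightarrow> inverse b"
  proof (rule Lim_transform_eventually)
    show "\<forall>\<^sub>F n in sequentially. inverse (g n powr (- 1 / real n)) = root n (norm (g n))"
      using eventually_gt_at_top[of 0]
    proof eventually_elim
      case (elim n)
      have "g n powr (- 1 / real n) = inverse (g n powr (1 / real n))"
        by (simp flip: powr_minus)
      then show ?case using elim g[of n] by (simp add: root_powr_inverse)
    qed
  qed
  then have "limsup (\<lambda>n. ereal (root n (norm (g n)))) = ereal (inverse b)"
    by (intro lim_imp_Limsup) auto
  then have "conv_radius g = ereal b" using b by (simp add: conv_radius_def)
  with 1 show ?thesis by simp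
qed

theorem theorem1:
  fixes \<mu> :: "complex measure" and P :: "nat \<Rightarrow> complex poly" and d :: "nat \<Rightarrow> nat \<Rightarrow> complex"
    and D T :: "ell2 \<Rightarrow> ell2" and f \<phi> :: "complex \<Rightarrow> complex" and \<Gamma> :: "complex set"
  assumes "prob_space \<mu>" and "sets \<mu> = sets borel"
    and "\<Gamma> = msupport \<mu>" and "compact \<Gamma>" and "infinite \<Gamma>"
    and "orthonormal_polynomials \<mu> P"
    and "Hessenberg_matrix P d"
    and "regular_measure \<mu> P"
    and "\<exists>\<J>. finite \<J> \<and> (\<forall>J\<in>\<J>. Jordan_arc J) \<and> \<Gamma> = \<Union>\<J>"
    and "simply_connected (sphere_complement \<Gamma>)"
    and "\<forall>i j. entry D i j = d i j"
    and "uniformly_asymptotically_Toeplitz D T"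
    and "Toeplitz_symbol T f" and "continuous_on (sphere 0 1) f"
    and "exterior_Riemann_map \<Gamma> \<phi>"
  shows "\<exists>g. continuous_on {z. cmod z \<ge> 1} g \<and> (\<forall>z. cmod z > 1 \<longrightarrow> g z = \<phi> z) \<and>
             (\<forall>z\<in>sphere 0 1. f z = g z)"
proof -
  interpret hessenberg \<mu> P d using assms(1,2,4,6,7) unfolding assms(3) by (rule hessenberg.intro)
  obtain c where c: "c > 0" "((\<lambda>z. \<phi> z / z) \<longlongrightarrow> of_real c) at_infinity"
    using assms(15) by (auto simp: exterior_Riemann_map_def)
  interpret exterior_map \<Gamma> \<phi> c
    using assms(4,15) c by unfold_locales (auto simp: exterior_Riemann_map_def)
  define a where "a = log_capacity \<Gamma>"
  have ca: "c \<le> a" unfolding a_def by (rule log_capacity_ge)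
  define \<gamma> where "\<gamma> = (\<lambda>n. Re (lead_coeff (P n)))"
  have \<gamma>: "\<gamma> n > 0" for n using assms(6) unfolding \<gamma>_def orthonormal_polynomials_def by blast
  have T: "entry T i j = Fourier_coefficient f (int i - int j)" for i j
    using assms(13) by (simp add: Toeplitz_symbol_def)
  have lim: "(\<lambda>n. d (i + n) n) \<longlonglongrightarrow> Fourier_coefficient f (int i)" for i
    using entry_limit[OF assms(12), of i 0] assms(11) by (simp add: T)
  have "(\<lambda>n. \<gamma> n / \<gamma> (Suc n)) \<longlonglongrightarrow> Re (Fourier_coefficient f 1)"
    using tendsto_Re[OF lim[of 1]] by (simp add: subdiagonal \<gamma>_def)
  moreover have "(\<lambda>n. \<gamma> n powr (- 1 / real n)) \<longlonglongrightarrow> a"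
    using assms(8) unfolding regular_measure_def \<gamma>_def a_def assms(3) .
  moreover have "a > 0" using ca c(1) by linarith
  ultimately have Rea: "Re (Fourier_coefficient f 1) = a"
    using \<gamma> by (intro root_limit_eq_ratio_limit[of \<gamma>])
  \<comment> \<open>The subdiagonal entries are quotients of leading coefficients, hence real, and
    so is their limit.\<close>
  have "Im (Fourier_coefficient f 1) = 0"
    using tendsto_Im[OF lim[of 1]] by (simp add: subdiagonal LIMSEQ_const_iff)
  with Rea have a1: "Fourier_coefficient f 1 = of_real a" by (simp add: complex_eq_iff)
  have a2: "Fourier_coefficient f (int i) = 0" if "i \<ge> 2" for i
    using lim[of i] that assms(7) by (simp add: Hessenberg_matrix_def LIMSEQ_const_iff)
  \<comment> \<open>On the circle this is f / z: the only positive frequency of f moves to 0, which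
    makes the analytic extension in w = 1 / z possible, with a_1 as its value at 0.\<close>
  define g where "g = (\<lambda>z. cnj z * f z)"
  have contg: "continuous_on (sphere 0 1) g"
    unfolding g_def by (intro continuous_intros assms(14))
  have Fg: "Fourier_coefficient g k = Fourier_coefficient f (k + 1)" for k
  proof -
    have "g (cis t) * cis (- (of_int k * t)) = f (cis t) * cis (- (of_int (k + 1) * t))" for t
    proof -
      have "g (cis t) * cis (- (of_int k * t)) = f (cis t) * (cis (- t) * cis (- (of_int k * t)))"
        by (simp add: g_def cis_cnj)
      also have "cis (- t) * cis (- (of_int k * t)) = cis (- (of_int (k + 1) * t))"
        by (simp add: cis_mult algebra_simps)
      finally show ?thesis .
    qed
    then show ?thesis unfolding Fourier_coefficient_def by (simp only:)
  qed
  have "Fourier_coefficient g k = 0" if "k > 0" for k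
    using a2[of "nat (k + 1)"] that by (simp add: Fg)
  from analytic_boundary_extension[OF contg this] obtain A where
    A: "continuous_on (cball 0 1) A" "A holomorphic_on ball 0 1"
      "\<And>w. norm w = 1 \<Longrightarrow> A w = g (cnj w)" "A 0 = Fourier_coefficient g 0" by blast
  have A0: "A 0 = of_real a" by (simp add: A Fg a1)
  have Aw: "A w / w = f (1 / w)" if "norm w = 1" for w
  proof -
    have "w * cnj w = 1" using that complex_norm_square[of w] by simp
    moreover from that have w0: "w \<noteq> 0" by auto
    ultimately have "cnj w = 1 / w" by (simp add: eq_divide_eq mult.commute)
    with w0 show ?thesis using that by (simp add: A g_def)
  qed
  have fK: "f z \<in> \<Gamma>" if "norm z = 1" for z
    unfolding assms(3)
    by (rule symbol_in_support[OF _ assms(12,14,13)]) (use that assms in auto)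
  have \<phi>A: "\<phi> (1 / w) = A w / w" if "norm w < 1" "w \<noteq> 0" for w
    by (rule exterior_map_unique[OF A(1,2) A0 ca _ that]) (use fK Aw in \<open>simp add: norm_divide\<close>)
  \<comment> \<open>This is F itself; being continuous on the closed exterior and equal to
    \<open>\<phi>\<close> outside the circle, it provides the boundary extension of
    \<open>\<phi>\<close>.\<close>
  define G where "G = (\<lambda>z. A (1 / z) * z)"
  have "continuous_on {z. cmod z \<ge> 1} G"
    unfolding G_def
    by (intro continuous_intros continuous_on_compose2[OF A(1)]) (auto simp: norm_divide divide_le_eq_1)
  moreover have "G z = \<phi> z" if "cmod z > 1" for z
  proof -
    have "z \<noteq> 0" using that by auto
    then show ?thesis using \<phi>A[of "1 / z"] that by (simp add: G_def norm_divide)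
  qed
  moreover have "f z = G z" if "z \<in> sphere 0 1" for z
  proof -
    have "z \<noteq> 0" "norm (1 / z) = 1" using that by (auto simp: norm_divide)
    with Aw[of "1 / z"] show ?thesis by (simp add: G_def)
  qed
  ultimately show ?thesis by (intro exI[of _ G]) auto
qed

end
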